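(* There is a quasi-polynomial time approximation scheme (QPTAS) for the problem $Q|f_i|C_{\min}$: for every fixed $\epsilon>0$ there is an algorithm running in quasi-polynomial time which, on any instance admitting a feasible assignment, outputs an assignment in which every machine $i$ receives at most $f_i$ jobs and total capacity at least $D_i/(1+\epsilon)$.
   Context: $Q|f_i|C_{\min}$ (cardinality-constrained non-uniform max-min allocation): given $m$ machines, machine $i$ having a demand $D_i>0$ and a cardinality constraint $f_i\in\mathbb{Z}_{\ge 1}$, and $n$ jobs with capacities $c_1,\dots,c_n>0$, a feasible assignment assigns each job to at most one machine such that machine $i$ receives at most $f_i$ jobs and the total capacity of the jobs assigned to machine $i$ is at least $D_i$. An $\alpha$-approximate solution is an assignment respecting the cardinality constraints in which every machine $i$ receives total capacity at least $D_i/\alpha$. *)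

theory Defs
  imports Complex_Main "HOL-Library.Log_Nat"
begin

section \<open>The model of computation\<close>

text \<open>
  The libraries provide no machine model, so algorithms are programs of a small first-order
  functional language over Lisp-style data (natural numbers and pairs), with call-by-value
  evaluation and the logarithmic cost measure: every step has unit cost, except that arithmetic
  and comparisons of numbers cost the total binary length of their operands. For a fixed
  program, the size of all data created during a run, represented with sharing, is linear in the
  input size plus the cost. Hence the model and (multi-tape) Turing machines simulate each other
  with polynomial overhead, and (quasi-)polynomial time means the same in both.
\<close>

datatype val = Nat nat | Pair val val

definition bits :: "nat \<Rightarrow> nat" where
  "bits n = Suc (floorlog 2 n)"

primrec val_size :: "val \<Rightarrow> nat" where
  "val_size (Nat n) = bits n"
| "val_size (Pair v w) = Suc (val_size v + val_size w)"

datatype arith = Add | Sub | Mul | Div | Eq | Less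

primrec apply_arith :: "arith \<Rightarrow> nat \<Rightarrow> nat \<Rightarrow> nat" where
  "apply_arith Add a b = a + b"
| "apply_arith Sub a b = a - b"
| "apply_arith Mul a b = a * b"
| "apply_arith Div a b = a div b"
| "apply_arith Eq a b = (if a = b then 1 else 0)"
| "apply_arith Less a b = (if a < b then 1 else 0)"

text \<open>
  Variables are de Bruijn indices into the environment. A program is the list of the bodies of its
  functions, which may be mutually recursive; the body of a called function is evaluated in the
  environment consisting of the argument values. In a conditional, a number other than 0 is true.
\<close>

datatype expr =
    Var nat
  | Const nat
  | Arith arith expr expr
  | MkPair expr expr
  | Fst expr
  | Snd expr
  | IsPair expr
  | If expr expr expr
  | Let expr expr
  | Call nat "expr list"

type_synonym prog = "expr list"

text \<open>
  \<open>eval P env e v t\<close>: in environment \<open>env\<close>, the expression \<open>e\<close> evaluates to \<open>v\<close> at cost \<open>t\<close>.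
  There is no \<open>v\<close> and \<open>t\<close> if the evaluation diverges or fails (e.g. for \<open>Fst\<close> of a number).
\<close>

inductive eval :: "prog \<Rightarrow> val list \<Rightarrow> expr \<Rightarrow> val \<Rightarrow> nat \<Rightarrow> bool"
  and evals :: "prog \<Rightarrow> val list \<Rightarrow> expr list \<Rightarrow> val list \<Rightarrow> nat \<Rightarrow> bool"
  for P :: prog
where
  eval_Var: "i < length env \<Longrightarrow> eval P env (Var i) (env ! i) 1"
| eval_Const: "eval P env (Const n) (Nat n) 1"
| eval_Arith:
    "eval P env e1 (Nat a) s \<Longrightarrow> eval P env e2 (Nat b) t \<Longrightarrow>
     eval P env (Arith f e1 e2) (Nat (apply_arith f a b)) (s + t + bits a + bits b)"
| eval_MkPair:
    "eval P env e1 v s \<Longrightarrow> eval P env e2 w t \<Longrightarrow>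
     eval P env (MkPair e1 e2) (Pair v w) (Suc (s + t))"
| eval_Fst: "eval P env e (Pair v w) t \<Longrightarrow> eval P env (Fst e) v (Suc t)"
| eval_Snd: "eval P env e (Pair v w) t \<Longrightarrow> eval P env (Snd e) w (Suc t)"
| eval_IsPair_Pair: "eval P env e (Pair v w) t \<Longrightarrow> eval P env (IsPair e) (Nat 1) (Suc t)"
| eval_IsPair_Nat: "eval P env e (Nat n) t \<Longrightarrow> eval P env (IsPair e) (Nat 0) (Suc t)"
| eval_If_True:
    "eval P env e (Nat n) s \<Longrightarrow> n \<noteq> 0 \<Longrightarrow> eval P env e1 v t \<Longrightarrow>
     eval P env (If e e1 e2) v (Suc (s + t))"
| eval_If_False:
    "eval P env e (Nat 0) s \<Longrightarrow> eval P env e2 v t \<Longrightarrow>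
     eval P env (If e e1 e2) v (Suc (s + t))"
| eval_Let:
    "eval P env e1 v s \<Longrightarrow> eval P (v # env) e2 w t \<Longrightarrow>
     eval P env (Let e1 e2) w (Suc (s + t))"
| eval_Call:
    "f < length P \<Longrightarrow> evals P env es vs s \<Longrightarrow> eval P vs (P ! f) v t \<Longrightarrow>
     eval P env (Call f es) v (Suc (s + t))"
| evals_Nil: "evals P env [] [] 0"
| evals_Cons:
    "eval P env e v s \<Longrightarrow> evals P env es vs t \<Longrightarrow>
     evals P env (e # es) (v # vs) (s + t)"

inductive_cases eval_VarE: "eval P env (Var i) v t"
inductive_cases eval_ConstE: "eval P env (Const n) v t"
inductive_cases eval_ArithE: "eval P env (Arith f e1 e2) v t"
inductive_cases eval_MkPairE: "eval P env (MkPair e1 e2) v t"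
inductive_cases eval_FstE: "eval P env (Fst e) v t"
inductive_cases eval_SndE: "eval P env (Snd e) v t"
inductive_cases eval_IsPairE: "eval P env (IsPair e) v t"
inductive_cases eval_IfE: "eval P env (If e e1 e2) v t"
inductive_cases eval_LetE: "eval P env (Let e1 e2) v t"
inductive_cases eval_CallE: "eval P env (Call f es) v t"
inductive_cases evals_NilE: "evals P env [] vs t"
inductive_cases evals_ConsE: "evals P env (e # es) vs t"

lemma eval_deterministic:
  "eval P env e v t \<Longrightarrow> eval P env e v' t' \<Longrightarrow> v' = v \<and> t' = t"
  "evals P env es vs t \<Longrightarrow> evals P env es vs' t' \<Longrightarrow> vs' = vs \<and> t' = t"
proof (induction arbitrary: v' t' and vs' t' rule: eval_evals.inducts)
  case eval_Var then show ?case by (auto elim: eval_VarE)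
next
  case eval_Const then show ?case by (auto elim: eval_ConstE)
next
  case eval_Arith
  from eval_Arith.prems show ?case
    by (rule eval_ArithE) (auto dest!: eval_Arith.IH(2,4))
next
  case eval_MkPair
  from eval_MkPair.prems show ?case
    by (rule eval_MkPairE) (auto dest!: eval_MkPair.IH(2,4))
next
  case eval_Fst
  from eval_Fst.prems show ?case
    by (rule eval_FstE) (auto dest!: eval_Fst.IH(2))
next
  case eval_Snd
  from eval_Snd.prems show ?case
    by (rule eval_SndE) (auto dest!: eval_Snd.IH(2))
next
  case eval_IsPair_Pair
  from eval_IsPair_Pair.prems show ?case
    by (rule eval_IsPairE) (auto dest!: eval_IsPair_Pair.IH(2))
next
  case eval_IsPair_Nat
  from eval_IsPair_Nat.prems show ?case
    by (rule eval_IsPairE) (auto dest!: eval_IsPair_Nat.IH(2))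
next
  case eval_If_True
  from eval_If_True.prems show ?case
    by (rule eval_IfE) (auto dest!: eval_If_True.IH(2,4) simp: eval_If_True.hyps)
next
  case eval_If_False
  from eval_If_False.prems show ?case
    by (rule eval_IfE) (auto dest!: eval_If_False.IH(2,4))
next
  case eval_Let
  from eval_Let.prems show ?case
    by (rule eval_LetE) (auto dest!: eval_Let.IH(2,4))
next
  case eval_Call
  from eval_Call.prems show ?case
    by (rule eval_CallE) (auto dest!: eval_Call.IH(3,5))
next
  case evals_Nil then show ?case by (auto elim: evals_NilE)
next
  case evals_Cons
  from evals_Cons.prems show ?case
    by (rule evals_ConsE) (auto dest!: evals_Cons.IH(2,4))
qed

definition runs :: "prog \<Rightarrow> val \<Rightarrow> val \<Rightarrow> nat \<Rightarrow> bool" where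
  "runs P x y t \<longleftrightarrow> eval P [x] (Call 0 [Var 0]) y t"

text \<open>\<open>T N = 2 ^ O((log N) ^ k)\<close> for some \<open>k\<close>\<close>

definition quasi_polynomial :: "(nat \<Rightarrow> nat) \<Rightarrow> bool" where
  "quasi_polynomial T \<longleftrightarrow>
     (\<exists>(C::real) (k::nat). \<forall>N\<ge>2. real (T N) \<le> 2 powr (C * log 2 (real N) ^ k))"

section \<open>Cardinality-constrained non-uniform max-min allocation\<close>

text \<open>
  A machine is given by its demand and its cardinality constraint, a job by its capacity; machines
  and jobs are numbered from 0. An assignment lists, for every job, the machine it is assigned to,
  if any.
\<close>

record alloc_instance =
  machines :: "(rat \<times> nat) list"
  jobs :: "rat list"

type_synonym assignment = "nat option list"

abbreviation demand :: "alloc_instance \<Rightarrow> nat \<Rightarrow> rat" where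
  "demand I i \<equiv> fst (machines I ! i)"

abbreviation card_bound :: "alloc_instance \<Rightarrow> nat \<Rightarrow> nat" where
  "card_bound I i \<equiv> snd (machines I ! i)"

abbreviation capacity :: "alloc_instance \<Rightarrow> nat \<Rightarrow> rat" where
  "capacity I j \<equiv> jobs I ! j"

definition valid_instance :: "alloc_instance \<Rightarrow> bool" where
  "valid_instance I \<longleftrightarrow>
     (\<forall>i < length (machines I). demand I i > 0 \<and> card_bound I i \<ge> 1) \<and>
     (\<forall>j < length (jobs I). capacity I j > 0)"

definition jobs_on :: "assignment \<Rightarrow> nat \<Rightarrow> nat set" where
  "jobs_on \<sigma> i = {j. j < length \<sigma> \<and> \<sigma> ! j = Some i}"

definition load :: "alloc_instance \<Rightarrow> assignment \<Rightarrow> nat \<Rightarrow> rat" where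
  "load I \<sigma> i = (\<Sum>j\<in>jobs_on \<sigma> i. capacity I j)"

definition respects_cardinalities :: "alloc_instance \<Rightarrow> assignment \<Rightarrow> bool" where
  "respects_cardinalities I \<sigma> \<longleftrightarrow>
     length \<sigma> = length (jobs I) \<and>
     (\<forall>i. Some i \<in> set \<sigma> \<longrightarrow> i < length (machines I)) \<and>
     (\<forall>i < length (machines I). card (jobs_on \<sigma> i) \<le> card_bound I i)"

definition feasible :: "alloc_instance \<Rightarrow> assignment \<Rightarrow> bool" where
  "feasible I \<sigma> \<longleftrightarrow>
     respects_cardinalities I \<sigma> \<and> (\<forall>i < length (machines I). load I \<sigma> i \<ge> demand I i)"

definition approx_solution :: "real \<Rightarrow> alloc_instance \<Rightarrow> assignment \<Rightarrow> bool" where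
  "approx_solution \<alpha> I \<sigma> \<longleftrightarrow>
     respects_cardinalities I \<sigma> \<and>
     (\<forall>i < length (machines I). of_rat (load I \<sigma> i) \<ge> of_rat (demand I i) / \<alpha>)"

section \<open>Encoding of inputs and outputs\<close>

primrec enc_list :: "('a \<Rightarrow> val) \<Rightarrow> 'a list \<Rightarrow> val" where
  "enc_list enc [] = Nat 0"
| "enc_list enc (x # xs) = Pair (enc x) (enc_list enc xs)"

text \<open>Used for positive rationals only: numerator and denominator in lowest terms.\<close>

definition enc_rat :: "rat \<Rightarrow> val" where
  "enc_rat r = (case quotient_of r of (p, q) \<Rightarrow> Pair (Nat (nat p)) (Nat (nat q)))"

definition enc_instance :: "alloc_instance \<Rightarrow> val" where
  "enc_instance I =
     Pair (enc_list (\<lambda>(D, f). Pair (enc_rat D) (Nat f)) (machines I)) (enc_list enc_rat (jobs I))"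

definition enc_assignment :: "assignment \<Rightarrow> val" where
  "enc_assignment = enc_list (\<lambda>a. case a of None \<Rightarrow> Nat 0 | Some i \<Rightarrow> Nat (Suc i))"

text \<open>Up to a constant factor, this is the length of the instance written in binary.\<close>

definition instance_size :: "alloc_instance \<Rightarrow> nat" where
  "instance_size I = val_size (enc_instance I)"

end

theory Submission
  imports Defs "HOL-Library.Multiset"
begin

text \<open>
  After scaling to integers, every job size is replaced by a representative within a factor
  \<open>1 + 1/E\<close> such that distinct representatives differ by more than that factor. The machines are
  processed by decreasing demand. For a machine of demand \<open>D\<close>, a single job of size at least \<open>D\<close>
  suffices, and it does not matter which one, since it also suffices for all later machines; the
  jobs of size at most \<open>D / ((n + 1) E)\<close> are negligible, and no earlier machine has touched them.
  Only \<open>O(log n)\<close> representatives lie between these bounds, so a partial assignment can be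
  summarised by the number of remaining large jobs and the numbers of remaining jobs of these
  sizes. Keeping one partial assignment per summary gives a dynamic program with \<open>n ^ O(log n)\<close>
  states.
\<close>

section \<open>Evaluation with bounded numbers\<close>

lemma bits_mono: "a \<le> b \<Longrightarrow> bits a \<le> bits b"
  unfolding bits_def by (simp add: floorlog_mono)

text \<open>
  If all operands of arithmetic are at most \<open>V\<close>, then each step costs at most \<open>2 * bits V + 1\<close>, so
  that it suffices to count steps.
\<close>

definition evb :: "prog \<Rightarrow> nat \<Rightarrow> val list \<Rightarrow> expr \<Rightarrow> val \<Rightarrow> nat \<Rightarrow> bool" where
  "evb P V env e v k \<longleftrightarrow> (\<exists>t \<le> k * (2 * bits V + 1). eval P env e v t)"

definition fn :: "prog \<Rightarrow> nat \<Rightarrow> nat \<Rightarrow> val \<Rightarrow> val \<Rightarrow> val \<Rightarrow> nat \<Rightarrow> bool" where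
  "fn P V f x y v k \<longleftrightarrow> f < length P \<and> evb P V [x, y] (P ! f) v k"

lemma evb_eqI: "evb P V env e v k \<Longrightarrow> v = v' \<Longrightarrow> k \<le> k' \<Longrightarrow> evb P V env e v' k'"
  unfolding evb_def by (meson mult_le_mono1 order_trans)

lemma fn_mono: "fn P V f x y v k \<Longrightarrow> k \<le> k' \<Longrightarrow> fn P V f x y v k'"
  unfolding fn_def by (blast intro: evb_eqI)

lemma evb_Var_nth: "i < length env \<Longrightarrow> evb P V env (Var i) (env ! i) 1"
  unfolding evb_def using eval_Var[of i env P] by (intro exI[of _ 1]) simp

lemma evb_Var:
  "evb P V (a # env) (Var 0) a 1"
  "evb P V (a # b # env) (Var 1) b 1"
  "evb P V (a # b # c # env) (Var 2) c 1"
  "evb P V (a # b # c # d # env) (Var 3) d 1"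
  "evb P V (a # b # c # d # e # env) (Var 4) e 1"
  "evb P V (a # b # c # d # e # g # env) (Var 5) g 1"
  using evb_Var_nth[of 0 "a # env"] evb_Var_nth[of 1 "a # b # env"]
    evb_Var_nth[of 2 "a # b # c # env"] evb_Var_nth[of 3 "a # b # c # d # env"]
    evb_Var_nth[of 4 "a # b # c # d # e # env"] evb_Var_nth[of 5 "a # b # c # d # e # g # env"]
  by simp_all

lemma evb_Const: "evb P V env (Const n) (Nat n) 1"
  unfolding evb_def using eval_Const[of P env n] by (intro exI[of _ 1]) simp

lemma evb_arith:
  assumes "evb P V env e1 (Nat a) s" "evb P V env e2 (Nat b) t" "a \<le> V" "b \<le> V"
  shows "evb P V env (Arith f e1 e2) (Nat (apply_arith f a b)) (s + t + 1)"
proof -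
  obtain s' t' where st: "eval P env e1 (Nat a) s'" "s' \<le> s * (2 * bits V + 1)"
    "eval P env e2 (Nat b) t'" "t' \<le> t * (2 * bits V + 1)"
    using assms(1,2) unfolding evb_def by blast
  have "bits a \<le> bits V" "bits b \<le> bits V"
    using assms(3,4) by (simp_all add: bits_mono)
  then have "s' + t' + bits a + bits b \<le> (s + t + 1) * (2 * bits V + 1)"
    using st(2,4) by (simp add: add_mult_distrib)
  then show ?thesis
    unfolding evb_def using eval_Arith[OF st(1,3)] by blast
qed

lemma evb_Arith:
  assumes "evb P V env e1 (Nat a) s" "evb P V env e2 (Nat b) t" "a \<le> V" "b \<le> V"
  shows "evb P V env (Arith Add e1 e2) (Nat (a + b)) (s + t + 1)"
    "evb P V env (Arith Mul e1 e2) (Nat (a * b)) (s + t + 1)"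
    "evb P V env (Arith Div e1 e2) (Nat (a div b)) (s + t + 1)"
    "evb P V env (Arith Eq e1 e2) (Nat (if a = b then 1 else 0)) (s + t + 1)"
    "evb P V env (Arith Less e1 e2) (Nat (if a < b then 1 else 0)) (s + t + 1)"
  using evb_arith[OF assms, of Add] evb_arith[OF assms, of Mul] evb_arith[OF assms, of Div]
    evb_arith[OF assms, of Eq] evb_arith[OF assms, of Less]
  by (simp_all only: apply_arith.simps)

lemma evb_MkPair:
  assumes "evb P V env e1 v s" "evb P V env e2 w t"
  shows "evb P V env (MkPair e1 e2) (Pair v w) (s + t + 1)"
proof -
  obtain s' t' where st: "eval P env e1 v s'" "s' \<le> s * (2 * bits V + 1)"
    "eval P env e2 w t'" "t' \<le> t * (2 * bits V + 1)"
    using assms unfolding evb_def by blast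
  then have "Suc (s' + t') \<le> (s + t + 1) * (2 * bits V + 1)"
    by (simp add: add_mult_distrib)
  then show ?thesis
    unfolding evb_def using eval_MkPair[OF st(1,3)] by blast
qed

lemma evb_Fst:
  assumes "evb P V env e (Pair v w) s"
  shows "evb P V env (Fst e) v (s + 1)"
proof -
  obtain s' where st: "eval P env e (Pair v w) s'" "s' \<le> s * (2 * bits V + 1)"
    using assms unfolding evb_def by blast
  then have "Suc s' \<le> (s + 1) * (2 * bits V + 1)"
    by (simp add: add_mult_distrib)
  then show ?thesis
    unfolding evb_def using eval_Fst[OF st(1)] by blast
qed

lemma evb_Snd:
  assumes "evb P V env e (Pair v w) s"
  shows "evb P V env (Snd e) w (s + 1)"
proof -
  obtain s' where st: "eval P env e (Pair v w) s'" "s' \<le> s * (2 * bits V + 1)"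
    using assms unfolding evb_def by blast
  then have "Suc s' \<le> (s + 1) * (2 * bits V + 1)"
    by (simp add: add_mult_distrib)
  then show ?thesis
    unfolding evb_def using eval_Snd[OF st(1)] by blast
qed

lemma evb_IsPair:
  assumes "evb P V env e x s"
  shows "evb P V env (IsPair e) (Nat (if \<exists>v w. x = Pair v w then 1 else 0)) (s + 1)"
proof -
  obtain s' where st: "eval P env e x s'" "s' \<le> s * (2 * bits V + 1)"
    using assms unfolding evb_def by blast
  then have "Suc s' \<le> (s + 1) * (2 * bits V + 1)"
    by (simp add: add_mult_distrib)
  moreover have "eval P env (IsPair e) (Nat (if \<exists>v w. x = Pair v w then 1 else 0)) (Suc s')"
    using st(1) eval_IsPair_Pair[of P env e] eval_IsPair_Nat[of P env e] by (cases x) auto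
  ultimately show ?thesis
    unfolding evb_def by blast
qed

lemma evb_If:
  assumes "evb P V env e (Nat (if b then 1 else 0)) s"
    and "b \<Longrightarrow> evb P V env e1 v k" and "\<not> b \<Longrightarrow> evb P V env e2 w l"
  shows "evb P V env (If e e1 e2) (if b then v else w) (s + k + l + 1)"
proof -
  obtain s' where s: "eval P env e (Nat (if b then 1 else 0)) s'" "s' \<le> s * (2 * bits V + 1)"
    using assms(1) unfolding evb_def by blast
  show ?thesis
  proof (cases b)
    case True
    then obtain t where t: "eval P env e1 v t" "t \<le> k * (2 * bits V + 1)"
      using assms(2) unfolding evb_def by blast
    have "Suc (s' + t) \<le> (s + k + l + 1) * (2 * bits V + 1)"
      using s(2) t(2) by (simp add: add_mult_distrib)
    with True s(1) t(1) show ?thesis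
      unfolding evb_def by (auto intro!: exI[of _ "Suc (s' + t)"] eval_If_True)
  next
    case False
    then obtain t where t: "eval P env e2 w t" "t \<le> l * (2 * bits V + 1)"
      using assms(3) unfolding evb_def by blast
    have "Suc (s' + t) \<le> (s + k + l + 1) * (2 * bits V + 1)"
      using s(2) t(2) by (simp add: add_mult_distrib)
    with False s(1) t(1) show ?thesis
      unfolding evb_def by (auto intro!: exI[of _ "Suc (s' + t)"] eval_If_False)
  qed
qed

lemma evb_Let:
  assumes "evb P V env e1 v s" "evb P V (v # env) e2 w t"
  shows "evb P V env (Let e1 e2) w (s + t + 1)"
proof -
  obtain s' t' where st: "eval P env e1 v s'" "s' \<le> s * (2 * bits V + 1)"
    "eval P (v # env) e2 w t'" "t' \<le> t * (2 * bits V + 1)"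
    using assms unfolding evb_def by blast
  then have "Suc (s' + t') \<le> (s + t + 1) * (2 * bits V + 1)"
    by (simp add: add_mult_distrib)
  then show ?thesis
    unfolding evb_def using eval_Let[OF st(1,3)] by blast
qed

lemma evb_Call:
  assumes "evb P V env e1 x s" "evb P V env e2 y t" "fn P V f x y v k"
  shows "evb P V env (Call f [e1, e2]) v (s + t + k + 1)"
proof -
  obtain s' t' k' where st: "eval P env e1 x s'" "s' \<le> s * (2 * bits V + 1)"
    "eval P env e2 y t'" "t' \<le> t * (2 * bits V + 1)"
    "f < length P" "eval P [x, y] (P ! f) v k'" "k' \<le> k * (2 * bits V + 1)"
    using assms unfolding evb_def fn_def by blast
  then have "Suc ((s' + (t' + 0)) + k') \<le> (s + t + k + 1) * (2 * bits V + 1)"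
    by (simp add: add_mult_distrib)
  moreover have "eval P env (Call f [e1, e2]) v (Suc ((s' + (t' + 0)) + k'))"
    by (rule eval_Call[OF st(5) evals_Cons[OF st(1) evals_Cons[OF st(3) evals_Nil]] st(6)])
  ultimately show ?thesis
    unfolding evb_def by blast
qed

lemmas evb_intros =
  evb_Var evb_Const evb_Arith evb_MkPair evb_Fst evb_Snd evb_IsPair evb_If evb_Let evb_Call

text \<open>
  All loops are structural recursions over a list with a second argument that may change in the
  recursive call; \<open>step\<close> is evaluated with the recursive result on top of the environment.
\<close>

definition list_rec :: "nat \<Rightarrow> expr \<Rightarrow> expr \<Rightarrow> expr \<Rightarrow> expr" where
  "list_rec f np base step =
     If (IsPair (Var 0)) (Let (Call f [Snd (Var 0), np]) step) base"

lemma fn_list_rec: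
  assumes f: "f < length P" "P ! f = list_rec f np base step"
    and base: "\<And>c. I [] c \<Longrightarrow> evb P V [Nat 0, ep c] base (g [] c) k"
    and np: "\<And>x xs c. I (x # xs) c \<Longrightarrow>
      evb P V [Pair (ea x) (enc_list ea xs), ep c] np (ep (h x c)) k'"
    and inv: "\<And>x xs c. I (x # xs) c \<Longrightarrow> I xs (h x c)"
    and step: "\<And>x xs c. I (x # xs) c \<Longrightarrow>
      evb P V [g xs (h x c), Pair (ea x) (enc_list ea xs), ep c] step (g (x # xs) c) k"
    and I: "I xs c"
  shows "fn P V f (enc_list ea xs) (ep c) (g xs c) (Suc (length xs) * (k + k' + 8))"
  using I
proof (induction xs arbitrary: c)
  case Nil
  have "evb P V [Nat 0, ep c] (list_rec f np base step)
      (if \<exists>v w. Nat 0 = Pair v w then g [] c else g [] c) (1 + 1 + 0 + k + 1)"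
    unfolding list_rec_def
    by (rule evb_If evb_IsPair evb_Var base Nil)+ (simp_all add: base Nil)
  then show ?case
    unfolding fn_def f(2) by (auto simp: f(1) intro: evb_eqI)
next
  case (Cons x xs)
  have "evb P V [Pair (ea x) (enc_list ea xs), ep c] (list_rec f np base step)
      (if \<exists>v w. Pair (ea x) (enc_list ea xs) = Pair v w then g (x # xs) c else g (x # xs) c)
      (1 + 1 + ((1 + 1) + k' + Suc (length xs) * (k + k' + 8) + 1 + k + 1) + 0 + 1)"
    unfolding list_rec_def
    by (rule evb_If evb_IsPair evb_Var evb_Let evb_Call evb_Snd np[OF Cons.prems]
        Cons.IH[OF inv[OF Cons.prems]] step[OF Cons.prems])+ auto
  then show ?case
    unfolding fn_def f(2) by (auto simp: f(1) intro: evb_eqI)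
qed

lemma fn_list_rec_const:
  assumes f: "f < length P" "P ! f = list_rec f (Var 1) base step"
    and base: "I [] \<Longrightarrow> evb P V [Nat 0, p] base (g []) k"
    and inv: "\<And>x xs. I (x # xs) \<Longrightarrow> I xs"
    and step: "\<And>x xs. I (x # xs) \<Longrightarrow>
      evb P V [g xs, Pair (ea x) (enc_list ea xs), p] step (g (x # xs)) k"
    and I: "I xs"
  shows "fn P V f (enc_list ea xs) p (g xs) (Suc (length xs) * (k + 9))"
proof -
  have "Suc (length xs) * (k + 1 + 8) = Suc (length xs) * (k + 9)"
    by simp
  then show ?thesis
    using fn_list_rec[of f P "Var 1" base step "\<lambda>xs (c::unit). I xs" V "\<lambda>_. p" "\<lambda>xs _. g xs"
        k ea "\<lambda>_ c. c" 1 xs "()"]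
      f base inv step I evb_Var(2)
    by metis
qed

section \<open>The program\<close>

definition scl_expr :: "expr \<Rightarrow> expr \<Rightarrow> expr" where
  "scl_expr l r = Arith Mul (Fst r) (Arith Div l (Snd r))"

definition option_expr :: "expr \<Rightarrow> expr \<Rightarrow> expr" where
  "option_expr xs p =
     MkPair (Fst (Fst p))
       (MkPair (Fst (Snd (Fst p))) (MkPair (MkPair (Fst (Snd p)) xs) (Snd (Snd (Fst p)))))"

definition main_body :: "nat \<Rightarrow> expr" where
  "main_body E =
     Let (Call 1 [Fst (Var 0), Call 2 [Snd (Var 0), Const 1]])
       (Let (Call 18
              [Call 5 [Fst (Var 1), MkPair (Var 0) (Const 0)],
               MkPair
                 (Arith Mul (Arith Add (Call 3 [Snd (Var 1), Const 0]) (Const 1)) (Const E))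
                 (Call 7 [Snd (Var 1), MkPair (Var 0) (Const 0)])])
         (If (IsPair (Var 0))
           (Call 20 [Snd (Var 2), MkPair (Fst (Fst (Var 0))) (Const 0)])
           (Const 0)))"

text \<open>
  Function 0 is the main program. 1, 2: common denominator of the demands and the capacities;
  3: length; 4, 5: scaled machines, sorted by insertion; 6, 7: insertion of a job into the classes,
  and the classes of all jobs; 8: append; 9, 10, 11: the options of a machine in one class, for all
  choices in the other classes, and in all classes; 12, 13: the accepted choices, for one and for
  all states; 14: summary of a state; 15: equality of lists; 16, 17: removal of states with equal
  summaries; 18: dynamic program; 19, 20: machine of a job and resulting assignment.
\<close>

definition qprog :: "nat \<Rightarrow> prog" where
  "qprog E =
   [main_body E,
    list_rec 1 (Var 1) (Var 1) (Arith Mul (Snd (Fst (Fst (Var 1)))) (Var 0)),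
    list_rec 2 (Var 1) (Var 1) (Arith Mul (Snd (Fst (Var 1))) (Var 0)),
    list_rec 3 (Var 1) (Const 0) (Arith Add (Var 0) (Const 1)),
    list_rec 4 (Var 1) (MkPair (Var 1) (Const 0))
      (If (Arith Less (Fst (Fst (Var 1))) (Fst (Var 2)))
         (MkPair (Fst (Var 1)) (Var 0)) (MkPair (Var 2) (Var 1))),
    list_rec 5 (MkPair (Fst (Var 1)) (Arith Add (Snd (Var 1)) (Const 1))) (Const 0)
      (Call 4 [Var 0, MkPair (scl_expr (Fst (Var 2)) (Fst (Fst (Var 1))))
         (MkPair (Snd (Fst (Var 1))) (Snd (Var 2)))]),
    list_rec 6 (Var 1)
      (MkPair (MkPair (Fst (Var 1)) (MkPair (Snd (Var 1)) (Const 0))) (Const 0))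
      (If (Arith Less (Arith Mul (Fst (Fst (Var 1))) (Const (E + 1)))
                      (Arith Mul (Fst (Var 2)) (Const E)))
         (MkPair (Fst (Var 1)) (Var 0))
         (If (Arith Less (Arith Mul (Fst (Var 2)) (Const (E + 1)))
                         (Arith Mul (Fst (Fst (Var 1))) (Const E)))
            (MkPair (Fst (Var 1)) (Var 0))
            (MkPair (MkPair (Fst (Fst (Var 1))) (MkPair (Snd (Var 2)) (Snd (Fst (Var 1)))))
                    (Snd (Var 1))))),
    list_rec 7 (MkPair (Fst (Var 1)) (Arith Add (Snd (Var 1)) (Const 1))) (Const 0)
      (Call 6 [Var 0, MkPair (scl_expr (Fst (Var 2)) (Fst (Var 1))) (Snd (Var 2))]),
    list_rec 8 (Var 1) (Var 1) (MkPair (Fst (Var 1)) (Var 0)),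
    list_rec 9
      (MkPair
        (MkPair
          (MkPair (Arith Add (Fst (Fst (Fst (Var 1)))) (Fst (Snd (Var 1))))
                  (Arith Add (Snd (Fst (Fst (Var 1)))) (Const 1)))
          (MkPair (MkPair (MkPair (Fst (Var 0)) (Snd (Snd (Snd (Var 1)))))
                          (Fst (Snd (Fst (Var 1)))))
                  (Snd (Snd (Fst (Var 1))))))
        (Snd (Var 1)))
      (MkPair (option_expr (Var 0) (Var 1)) (Const 0))
      (MkPair (option_expr (Var 1) (Var 2))
        (If (Arith Less (Fst (Snd (Var 2))) (Fst (Fst (Snd (Snd (Var 2))))))
          (If (Arith Less (Fst (Fst (Snd (Snd (Var 2)))))
                 (Arith Mul (Fst (Snd (Var 2))) (Snd (Fst (Snd (Snd (Var 2)))))))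
            (Var 0) (Const 0))
          (Const 0))),
    list_rec 10 (Var 1) (Const 0)
      (Call 8 [Call 9 [Snd (Fst (Var 2)),
                       MkPair (Fst (Var 1)) (MkPair (Fst (Fst (Var 2))) (Snd (Var 2)))],
               Var 0]),
    list_rec 11 (Var 1)
      (MkPair (MkPair (MkPair (Const 0) (Const 0)) (MkPair (Snd (Var 1)) (Const 0))) (Const 0))
      (Let (Call 10 [Var 0, MkPair (Fst (Var 1)) (Fst (Var 2))])
        (If (Arith Less (Fst (Fst (Var 2))) (Fst (Fst (Fst (Var 3)))))
          (Var 0)
          (If (IsPair (Snd (Fst (Var 2))))
            (MkPair
              (MkPair (MkPair (Fst (Fst (Var 2))) (Const 1))
                (MkPair (MkPair (MkPair (Fst (Snd (Fst (Var 2)))) (Snd (Fst (Var 3))))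
                                (Snd (Var 3)))
                        (MkPair (MkPair (Fst (Fst (Var 2))) (Snd (Snd (Fst (Var 2)))))
                                (Snd (Var 2)))))
              (Var 0))
            (Var 0)))),
    list_rec 12 (Var 1) (Const 0)
      (If (Arith Less (Arith Mul (Fst (Fst (Fst (Var 1)))) (Const E))
                      (Arith Mul (Fst (Var 2)) (Const (E - 2))))
        (Var 0)
        (If (Arith Less (Snd (Var 2)) (Snd (Fst (Fst (Var 1)))))
          (Var 0)
          (MkPair (Snd (Fst (Var 1))) (Var 0)))),
    list_rec 13 (Var 1) (Const 0)
      (Call 8
        [Call 12
          [Call 11
            [Snd (Fst (Var 1)),
             MkPair (MkPair (MkPair (Fst (Fst (Var 2))) (Snd (Var 2))) (Snd (Snd (Fst (Var 2)))))
                    (Fst (Fst (Var 1)))],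
           MkPair (Fst (Fst (Var 2))) (Fst (Snd (Fst (Var 2))))],
         Var 0]),
    list_rec 14 (Var 1) (MkPair (Const 0) (Const 0))
      (If (Arith Less (Fst (Fst (Var 1))) (Var 2))
        (MkPair (Fst (Var 0)) (MkPair (Call 3 [Snd (Fst (Var 1)), Const 0]) (Snd (Var 0))))
        (MkPair (Arith Add (Fst (Var 0)) (Call 3 [Snd (Fst (Var 1)), Const 0]))
                (MkPair (Const 0) (Snd (Var 0))))),
    list_rec 15 (Snd (Var 1)) (Const 1)
      (If (Arith Eq (Fst (Var 1)) (Fst (Var 2))) (Var 0) (Const 0)),
    list_rec 16 (Var 1) (Const 0)
      (If (Call 15 [Call 14 [Snd (Fst (Var 1)), Fst (Var 2)], Snd (Var 2)])
        (Const 1) (Var 0)),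
    list_rec 17 (Var 1) (Const 0)
      (If (Call 16 [Var 0, MkPair (Var 2) (Call 14 [Snd (Fst (Var 1)), Var 2])])
        (Var 0) (MkPair (Fst (Var 1)) (Var 0))),
    list_rec 18 (Var 1)
      (MkPair (MkPair (Const 0) (Snd (Var 1))) (Const 0))
      (Call 17 [Call 13 [Var 0, MkPair (Fst (Var 1)) (Fst (Var 2))], Fst (Fst (Var 1))]),
    list_rec 19 (Var 1) (Const 0)
      (If (Arith Eq (Fst (Fst (Var 1))) (Var 2))
        (Arith Add (Snd (Fst (Var 1))) (Const 1)) (Var 0)),
    list_rec 20 (MkPair (Fst (Var 1)) (Arith Add (Snd (Var 1)) (Const 1))) (Const 0)
      (MkPair (Call 19 [Fst (Var 2), Snd (Var 2)]) (Var 0))]"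

lemma qprog_length: "length (qprog E) = 21"
  by (simp add: qprog_def)

text \<open>
  A class consists of a representative size and the jobs that remain in it, a partial solution of
  (job, machine) pairs and the classes. A choice for the current machine carries in addition the
  load and the number of its jobs.
\<close>

type_synonym cls = "nat \<times> nat list"
type_synonym partial = "(nat \<times> nat) list \<times> cls list"
type_synonym choice = "(nat \<times> nat) \<times> partial"

fun enc_cls :: "cls \<Rightarrow> val" where
  "enc_cls (r, l) = Pair (Nat r) (enc_list Nat l)"

fun enc_pair :: "nat \<times> nat \<Rightarrow> val" where
  "enc_pair (j, i) = Pair (Nat j) (Nat i)"

fun enc_partial :: "partial \<Rightarrow> val" where
  "enc_partial (a, cs) = Pair (enc_list enc_pair a) (enc_list enc_cls cs)"

fun enc_choice :: "choice \<Rightarrow> val" where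
  "enc_choice ((s, k), p) = Pair (Pair (Nat s) (Nat k)) (enc_partial p)"

lemmas enc_simps = enc_cls.simps enc_pair.simps enc_partial.simps enc_choice.simps

definition window :: "nat \<Rightarrow> nat \<Rightarrow> nat \<Rightarrow> bool" where
  "window D q r \<longleftrightarrow> r < D \<and> D < r * q"

fun add_cls :: "nat \<Rightarrow> nat list \<Rightarrow> choice \<Rightarrow> choice" where
  "add_cls r l ((s, k), (a, cs)) = ((s, k), (a, (r, l) # cs))"

fun take_job :: "nat \<Rightarrow> nat \<Rightarrow> nat \<Rightarrow> choice \<Rightarrow> choice" where
  "take_job r i j ((s, k), (a, cs)) = ((s + r, k + 1), ((j, i) # a, cs))"

definition near :: "nat \<Rightarrow> nat \<Rightarrow> nat \<Rightarrow> bool" where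
  "near E c r \<longleftrightarrow> c * E \<le> r * (E + 1) \<and> r * E \<le> c * (E + 1)"

fun add_job :: "nat \<Rightarrow> nat \<Rightarrow> nat \<Rightarrow> cls list \<Rightarrow> cls list" where
  "add_job E c j [] = [(c, [j])]"
| "add_job E c j ((r, l) # cs) = (if near E c r then (r, j # l) # cs else (r, l) # add_job E c j cs)"

fun classes :: "nat \<Rightarrow> nat list \<Rightarrow> nat \<Rightarrow> cls list" where
  "classes E [] j = []"
| "classes E (c # xs) j = add_job E c j (classes E xs (j + 1))"

definition num :: "rat \<Rightarrow> nat" where
  "num r = nat (fst (quotient_of r))"

definition den :: "rat \<Rightarrow> nat" where
  "den r = nat (snd (quotient_of r))"

lemma enc_rat_eq: "enc_rat r = Pair (Nat (num r)) (Nat (den r))"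
  by (simp add: enc_rat_def num_def den_def split: prod.split)

definition scale :: "nat \<Rightarrow> rat \<Rightarrow> nat" where
  "scale L r = num r * (L div den r)"

fun tagged :: "nat \<Rightarrow> (rat \<times> nat) list \<Rightarrow> nat \<Rightarrow> (nat \<times> nat \<times> nat) list" where
  "tagged L [] i = []"
| "tagged L ((d, f) # ms) i = (scale L d, f, i) # tagged L ms (i + 1)"

fun enc_machine :: "nat \<times> nat \<times> nat \<Rightarrow> val" where
  "enc_machine (d, f, i) = Pair (Nat d) (Pair (Nat f) (Nat i))"

primrec class_choices :: "nat \<Rightarrow> nat \<Rightarrow> nat \<Rightarrow> nat \<Rightarrow> nat list \<Rightarrow> choice \<Rightarrow> choice list" where
  "class_choices D q i r [] t = [add_cls r [] t]"
| "class_choices D q i r (j # l) t = add_cls r (j # l) t #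
     (if window D q r then class_choices D q i r l (take_job r i j t) else [])"

fun choices :: "nat \<Rightarrow> nat \<Rightarrow> nat \<Rightarrow> (nat \<times> nat) list \<Rightarrow> cls list \<Rightarrow> choice list" where
  "choices D q i a [] = [((0, 0), (a, []))]"
| "choices D q i a ((r, l) # cs) =
     (if r < D \<or> l = [] then []
      else [((r, 1), ((hd l, i) # a, (r, tl l) # cs))]) @
     concat (map (class_choices D q i r l) (choices D q i a cs))"

fun accept :: "nat \<Rightarrow> nat \<Rightarrow> nat \<Rightarrow> choice \<Rightarrow> bool" where
  "accept E D f ((s, k), p) \<longleftrightarrow> D * (E - 2) \<le> s * E \<and> k \<le> f"

fun expand :: "nat \<Rightarrow> nat \<Rightarrow> nat \<times> nat \<times> nat \<Rightarrow> partial \<Rightarrow> partial list" where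
  "expand E q (D, f, i) (a, cs) = map snd (filter (accept E D f) (choices D q i a cs))"

definition big_jobs :: "nat \<Rightarrow> cls list \<Rightarrow> nat" where
  "big_jobs D cs = (\<Sum>(r, l)\<leftarrow>cs. if r < D then 0 else length l)"

definition key :: "nat \<Rightarrow> cls list \<Rightarrow> nat list" where
  "key D cs = big_jobs D cs # map (\<lambda>(r, l). if r < D then length l else 0) cs"

primrec dedup :: "('a \<Rightarrow> 'b) \<Rightarrow> 'a list \<Rightarrow> 'a list" where
  "dedup g [] = []"
| "dedup g (x # xs) = (if g x \<in> g ` set (dedup g xs) then dedup g xs else x # dedup g xs)"

primrec dp :: "nat \<Rightarrow> nat \<Rightarrow> cls list \<Rightarrow> (nat \<times> nat \<times> nat) list \<Rightarrow> partial list" where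
  "dp E q cs [] = [([], cs)]"
| "dp E q cs (M # ms) =
     dedup (key (fst M) \<circ> snd) (concat (map (expand E q M) (dp E q cs ms)))"

section \<open>Evaluation of the functions of the program\<close>

lemma fn_append:
  "fn (qprog E) V 8 (enc_list ea xs) (enc_list ea ys) (enc_list ea (xs @ ys)) (Suc (length xs) * 20)"
  apply (rule fn_mono, rule fn_list_rec_const[where I = "\<lambda>_. True" and k = 11 and
        g = "\<lambda>xs. enc_list ea (xs @ ys)"], simp add: qprog_length,
      simp add: qprog_def del: One_nat_def)
     apply ((rule evb_eqI, (rule evb_intros | simp del: One_nat_def)+)[1] | simp)+
  done

lemma fn_class_choices:
  assumes "r \<le> V" "D \<le> V" "q \<le> V" "r * q \<le> V" "1 \<le> V"
    and "fst (fst t) + length l * r \<le> V" "snd (fst t) + length l \<le> V"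
  shows "fn (qprog E) V 9 (enc_list Nat l)
    (Pair (enc_choice t) (Pair (Nat r) (Pair (Pair (Nat D) (Nat q)) (Nat i))))
    (enc_list enc_choice (class_choices D q i r l t)) (Suc (length l) * 200)"
  apply (rule fn_mono, rule fn_list_rec[where
        I = "\<lambda>l t. fst (fst t) + length l * r \<le> V \<and> snd (fst t) + length l \<le> V" and k = 100 and k' = 90 and
        ep = "\<lambda>t. Pair (enc_choice t) (Pair (Nat r) (Pair (Pair (Nat D) (Nat q)) (Nat i)))" and
        h = "\<lambda>j t. take_job r i j t" and
        g = "\<lambda>l t. enc_list enc_choice (class_choices D q i r l t)"], simp add: qprog_length,
      simp add: qprog_def del: One_nat_def)
       apply (simp_all only: split_paired_all option_expr_def enc_simps take_job.simps)
       apply ((rule evb_eqI, (rule evb_intros | simp add: assms window_def del: One_nat_def)+)[1] | simp add: assms)+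
  done
lemma factor_le: "d * a \<le> V \<Longrightarrow> 0 < d \<Longrightarrow> a \<le> (V::nat)"
  by (cases d) auto

lemma fn_denominators_machines:
  assumes "foldr (\<lambda>x a. den (fst x) * a) ms p \<le> V"
    and "\<forall>x \<in> set ms. 0 < den (fst x) \<and> den (fst x) \<le> V"
  shows "fn (qprog E) V 1 (enc_list (\<lambda>(D, f). Pair (enc_rat D) (Nat f)) ms) (Nat p)
    (Nat (foldr (\<lambda>x a. den (fst x) * a) ms p)) (Suc (length ms) * 20)"
  apply (rule fn_mono, rule fn_list_rec_const[where I = "\<lambda>ms. foldr (\<lambda>x a. den (fst x) * a) ms p \<le> V \<and>
          (\<forall>x \<in> set ms. 0 < den (fst x) \<and> den (fst x) \<le> V)" and
        k = 11 and g = "\<lambda>ms. Nat (foldr (\<lambda>x a. den (fst x) * a) ms p)"], simp add: qprog_length,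
      simp add: qprog_def del: One_nat_def)
      apply (simp_all only: split_paired_all prod.case enc_rat_eq)
      apply ((rule evb_eqI, (rule evb_intros | simp del: One_nat_def)+)[1])
     apply (force intro: factor_le)
    apply ((rule evb_eqI, (rule evb_intros | (simp add: enc_rat_eq del: One_nat_def; fail) | (auto intro: factor_le; fail))+)[1])
   using assms apply simp
  apply simp
  done

lemma fn_denominators_jobs:
  assumes "foldr (\<lambda>x a. den x * a) js p \<le> V" "\<forall>x \<in> set js. 0 < den x \<and> den x \<le> V"
  shows "fn (qprog E) V 2 (enc_list enc_rat js) (Nat p)
    (Nat (foldr (\<lambda>x a. den x * a) js p)) (Suc (length js) * 20)"
  apply (rule fn_mono, rule fn_list_rec_const[where I = "\<lambda>js. foldr (\<lambda>x a. den x * a) js p \<le> V \<and>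
          (\<forall>x \<in> set js. 0 < den x \<and> den x \<le> V)" and
        k = 11 and g = "\<lambda>js. Nat (foldr (\<lambda>x a. den x * a) js p)"], simp add: qprog_length,
      simp add: qprog_def del: One_nat_def)
      apply (simp_all only: enc_rat_eq)
      apply ((rule evb_eqI, (rule evb_intros | simp del: One_nat_def)+)[1])
     apply (force intro: factor_le)
    apply ((rule evb_eqI, (rule evb_intros | (simp add: enc_rat_eq del: One_nat_def; fail) | (auto intro: factor_le; fail))+)[1])
   using assms apply simp
  apply simp
  done

lemma fn_length:
  assumes "length xs \<le> V" "1 \<le> V"
  shows "fn (qprog E) V 3 (enc_list ea xs) p (Nat (length xs)) (Suc (length xs) * 20)"
  apply (rule fn_mono, rule fn_list_rec_const[where I = "\<lambda>xs. length xs \<le> V" and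
        k = 11 and g = "\<lambda>xs. Nat (length xs)"], simp add: qprog_length,
      simp add: qprog_def del: One_nat_def)
     apply ((rule evb_eqI, (rule evb_intros | simp add: assms del: One_nat_def)+)[1] | simp add: assms)+
  done

lemma fn_insort:
  assumes "\<forall>M \<in> set ms. fst M \<le> V" "d \<le> V"
  shows "fn (qprog E) V 4 (enc_list enc_machine ms) (Pair (Nat d) (Pair (Nat f) (Nat i)))
    (enc_list enc_machine (insort_key fst (d, f, i) ms)) (Suc (length ms) * 40)"
  apply (rule fn_mono, rule fn_list_rec_const[where I = "\<lambda>ms. \<forall>M \<in> set ms. fst M \<le> V" and
        k = 31 and g = "\<lambda>ms. enc_list enc_machine (insort_key fst (d, f, i) ms)"], simp add: qprog_length,
      simp add: qprog_def del: One_nat_def)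
      apply (simp_all only: split_paired_all enc_machine.simps)
      apply ((rule evb_eqI, (rule evb_intros | simp del: One_nat_def)+)[1])
     apply simp
    apply ((rule evb_eqI, (rule evb_intros | simp add: assms(2) del: One_nat_def)+)[1])
   using assms apply simp
  apply simp
  done

lemma evb_scale:
  assumes "evb P V env l (Nat L) s" "evb P V env r (enc_rat x) t"
    and "L \<le> V" "num x \<le> V" "den x \<le> V"
  shows "evb P V env (scl_expr l r) (Nat (scale L x)) (s + 2 * t + 4)"
  unfolding scl_expr_def
  apply (rule evb_eqI)
    apply (rule evb_intros assms assms(2)[unfolded enc_rat_eq])+
       apply (use assms(3-) in \<open>simp_all add: scale_def\<close>)
  using div_le_dividend le_trans by blast

lemma length_tagged [simp]: "length (tagged L ms i) = length ms"
  by (induction ms arbitrary: i) auto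

lemma fn_tagged:
  assumes "\<forall>x \<in> set ms. num (fst x) \<le> V \<and> den (fst x) \<le> V \<and> scale L (fst x) \<le> V" "L \<le> V" "1 \<le> V"
    and "i + length ms \<le> V" "length ms \<le> Z"
  shows "fn (qprog E) V 5 (enc_list (\<lambda>(D, f). Pair (enc_rat D) (Nat f)) ms) (Pair (Nat L) (Nat i))
    (enc_list enc_machine (sort_key fst (tagged L ms i))) (Suc Z * (Suc Z * 40 + 70))"
proof -
  define I where "I = (\<lambda>(ms :: (rat \<times> nat) list) i. (\<forall>x \<in> set ms. num (fst x) \<le> V \<and> den (fst x) \<le> V \<and> scale L (fst x) \<le> V) \<and> i + length ms \<le> V \<and> length ms \<le> Z)"
  have bd: "\<forall>M\<in>set (sort_key fst (tagged L ms i)). fst M \<le> V" if "I ms i" for ms i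
    using that unfolding I_def set_sort
    by (induction L ms i rule: tagged.induct) auto
  have ins: "fn (qprog E) V 4 (enc_list enc_machine (sort_key fst (tagged L ms (i + 1))))
      (Pair (Nat (scale L d)) (Pair (Nat f) (Nat i)))
      (enc_list enc_machine (sort_key fst (tagged L ((d, f) # ms) i))) (Suc Z * 40)"
    if "I ((d, f) # ms) i" for d f ms i
  proof -
    have "I ms (i + 1)" "scale L d \<le> V" "length ms \<le> Z"
      using that by (auto simp: I_def)
    then show ?thesis
      using fn_insort[OF bd[of ms "i + 1"], of "scale L d" E f i]
      by (force intro: fn_mono)
  qed
  show ?thesis
    apply (rule fn_mono, rule fn_list_rec[where I = I and
        k = "Suc Z * 40 + 40" and k' = 10 and ep = "\<lambda>i. Pair (Nat L) (Nat i)" and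
        h = "\<lambda>_ i. i + 1" and
        g = "\<lambda>ms i. enc_list enc_machine (sort_key fst (tagged L ms i))"], simp add: qprog_length,
        simp add: qprog_def del: One_nat_def)
         apply (simp_all only: split_paired_all prod.case)
         apply ((rule evb_eqI, (rule evb_intros | simp del: One_nat_def)+)[1])
        apply ((rule evb_eqI, (rule evb_intros | simp add: I_def assms del: One_nat_def)+)[1])
       apply (simp add: I_def)
      apply ((rule evb_eqI, (rule evb_Call evb_MkPair evb_scale evb_Fst evb_Snd evb_Var ins | (simp only: enc_rat_eq; rule evb_Var evb_Fst) | assumption | simp add: assms I_def del: One_nat_def sort_key_simps; fail)+)[1])
     apply (simp add: I_def assms)
    using assms(5) by (intro mult_le_mono) auto
qed

lemma fn_add_job:
  assumes "\<forall>(r, l) \<in> set cs. r * (E + 1) \<le> V" "c * (E + 1) \<le> V" "E + 1 \<le> V"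
  shows "fn (qprog E) V 6 (enc_list enc_cls cs) (Pair (Nat c) (Nat j))
    (enc_list enc_cls (add_job E c j cs)) (Suc (length cs) * 150)"
proof -
  have *: "r \<le> V \<and> r * E \<le> V" if "r * (E + 1) \<le> V" for r
    using that by (auto simp: algebra_simps)
  have E: "E \<le> V"
    using assms(3) by simp
  have I: "\<forall>(r, l) \<in> set cs. r * (E + 1) \<le> V \<and> r \<le> V \<and> r * E \<le> V"
    using assms(1) * by blast
  show ?thesis
    apply (rule fn_mono, rule fn_list_rec_const[where I = "\<lambda>cs. \<forall>(r, l) \<in> set cs. r * (E + 1) \<le> V \<and> r \<le> V \<and> r * E \<le> V" and
        k = 120 and g = "\<lambda>cs. enc_list enc_cls (add_job E c j cs)"], simp add: qprog_length,
        simp add: qprog_def del: One_nat_def)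
        apply (simp_all only: split_paired_all enc_simps)
        apply ((rule evb_eqI, (rule evb_intros | simp del: One_nat_def; fail)+)[1])
      apply simp
     apply ((rule evb_eqI, (rule evb_intros | (simp only: assms(2,3) E *[OF assms(2)]; fail) | (simp only: list.set ball_simps prod.case; fail) | simp add: near_def not_less del: One_nat_def mult_Suc_right; fail)+)[1])
    apply (rule I)
    apply simp
    done
qed

lemma set_add_job: "fst ` set (add_job E c j cs) \<subseteq> insert c (fst ` set cs)"
  by (induction E c j cs rule: add_job.induct) auto

lemma length_add_job: "length (add_job E c j cs) \<le> Suc (length cs)"
  by (induction E c j cs rule: add_job.induct) auto

lemma set_classes: "fst ` set (classes E cs j) \<subseteq> set cs"
proof (induction E cs j rule: classes.induct)
  case (2 E c xs j)
  then show ?case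
    using set_add_job[of E c j "classes E xs (j + 1)"] unfolding classes.simps set_simps by blast
qed simp

lemma length_classes: "length (classes E cs j) \<le> length cs"
proof (induction E cs j rule: classes.induct)
  case (2 E c xs j)
  then show ?case
    using length_add_job[of E c j "classes E xs (j + 1)"] by simp
qed simp

lemma fn_classes:
  assumes "\<forall>x \<in> set js. num x \<le> V \<and> den x \<le> V \<and> scale L x * (E + 1) \<le> V" "L \<le> V" "E + 1 \<le> V"
    and "j + length js \<le> V" "length js \<le> Z"
  shows "fn (qprog E) V 7 (enc_list enc_rat js) (Pair (Nat L) (Nat j))
    (enc_list enc_cls (classes E (map (scale L) js) j)) (Suc Z * (Suc Z * 150 + 70))"
proof -
  define I where "I = (\<lambda>js j. (\<forall>x \<in> set js. num x \<le> V \<and> den x \<le> V \<and> scale L x * (E + 1) \<le> V) \<and>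
    j + length js \<le> V \<and> length js \<le> Z)"
  have V: "1 \<le> V"
    using assms(3) by simp
  have add: "fn (qprog E) V 6 (enc_list enc_cls (classes E (map (scale L) js) (j + 1)))
      (Pair (Nat (scale L x)) (Nat j))
      (enc_list enc_cls (classes E (map (scale L) (x # js)) j)) (Suc Z * 150)"
    if "I (x # js) j" for x js j
  proof -
    let ?cs = "classes E (map (scale L) js) (j + 1)"
    have "\<forall>(r, l) \<in> set ?cs. r * (E + 1) \<le> V"
    proof clarify
      fix r l assume "(r, l) \<in> set ?cs"
      then have "r \<in> scale L ` set js"
        using set_classes[of E "map (scale L) js" "j + 1"] by force
      then show "r * (E + 1) \<le> V"
        using that unfolding I_def by auto
    qed
    moreover have "scale L x * (E + 1) \<le> V" "length js \<le> Z"
      using that by (simp_all add: I_def)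
    moreover have "length ?cs \<le> Z"
      using length_classes[of E "map (scale L) js" "j + 1"] calculation(3) by simp
    ultimately show ?thesis
      using fn_add_job[of ?cs E V "scale L x" j] assms(3) by (auto intro: fn_mono)
  qed
  have b: "num x \<le> V" "den x \<le> V" "j + 1 \<le> V" "j \<le> V" "I xs (j + 1)" if "I (x # xs) j" for x xs j
    using that by (auto simp: I_def)
  show ?thesis
    apply (rule fn_mono, rule fn_list_rec[where I = I and
        k = "Suc Z * 150 + 40" and k' = 10 and ep = "\<lambda>j. Pair (Nat L) (Nat j)" and
        h = "\<lambda>_ j. j + 1" and
        g = "\<lambda>js j. enc_list enc_cls (classes E (map (scale L) js) j)"], simp add: qprog_length,
        simp add: qprog_def del: One_nat_def)
         apply ((rule evb_eqI, (rule evb_intros | simp del: One_nat_def)+)[1])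
        apply (simp only: enc_rat_eq)
        apply ((rule evb_eqI, (rule evb_intros | simp add: b assms V del: One_nat_def)+)[1])
       apply (rule b, assumption)
      apply ((rule evb_eqI, (rule evb_Call evb_MkPair evb_scale evb_Fst evb_Snd evb_Var add | assumption | simp add: assms b del: One_nat_def; fail)+)[1])
     apply (use assms in \<open>simp add: I_def\<close>)
    using assms(5) by (intro mult_le_mono) auto
qed

lemma class_choices_load:
  "t \<in> set (class_choices D q i r l t0) \<Longrightarrow>
    fst (fst t) \<le> fst (fst t0) + length l * r \<and> snd (fst t) \<le> snd (fst t0) + length l"
proof (induction l arbitrary: t0)
  case Nil
  obtain s k a cs where "t0 = ((s, k), (a, cs))"
    by (metis surj_pair)
  with Nil show ?case
    by simp
next
  case (Cons j l)
  obtain s k a cs where [simp]: "t0 = ((s, k), (a, cs))"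
    by (metis surj_pair)
  show ?case
    using Cons.prems Cons.IH[of "take_job r i j t0"] by (auto split: if_splits)
qed

lemma length_class_choices: "1 \<le> length (class_choices D q i r l t)" "length (class_choices D q i r l t) \<le> Suc (length l)"
  by (induction l arbitrary: t) auto

lemma fn_extend:
  assumes "r \<le> V" "D \<le> V" "q \<le> V" "r * q \<le> V" "1 \<le> V" "length l \<le> Z"
    and "\<forall>t \<in> set ts. fst (fst t) + length l * r \<le> V \<and> snd (fst t) + length l \<le> V"
  shows "fn (qprog E) V 10 (enc_list enc_choice ts)
    (Pair (Pair (Nat r) (enc_list Nat l)) (Pair (Pair (Nat D) (Nat q)) (Nat i)))
    (enc_list enc_choice (concat (map (class_choices D q i r l) ts)))
    (Suc (length ts) * (300 * Suc Z))"
proof -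
  have opts: "fn (qprog E) V 9 (enc_list Nat l)
    (Pair (enc_choice t) (Pair (Nat r) (Pair (Pair (Nat D) (Nat q)) (Nat i))))
    (enc_list enc_choice (class_choices D q i r l t)) (Suc Z * 200)"
    if "t \<in> set ts" for t
    using fn_class_choices[of r V D q t l E i] assms that by (auto intro: fn_mono)
  have app: "fn (qprog E) V 8 (enc_list enc_choice (class_choices D q i r l t))
    (enc_list enc_choice ys) (enc_list enc_choice (class_choices D q i r l t @ ys)) (Suc Z * 40)" for t ys
    using length_class_choices(2)[of D q i r l t] assms(6) by (intro fn_mono[OF fn_append]) simp
  show ?thesis
    apply (rule fn_mono, rule fn_list_rec_const[where I = "\<lambda>us. set us \<subseteq> set ts" and
          k = "Suc Z * 240 + 35" and
          g = "\<lambda>ts. enc_list enc_choice (concat (map (class_choices D q i r l) ts))"],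
        simp add: qprog_length, simp add: qprog_def del: One_nat_def)
        apply ((rule evb_eqI, (rule evb_intros | simp del: One_nat_def; fail)+)[1])
       apply simp
      apply ((rule evb_eqI, (rule evb_Call evb_MkPair evb_Fst evb_Snd evb_Var opts app | simp del: One_nat_def; fail)+)[1])
     apply simp
    apply (intro mult_le_mono) apply simp_all
    done
qed

definition total_size :: "cls list \<Rightarrow> nat" where
  "total_size cs = (\<Sum>(r, l)\<leftarrow>cs. length l * r)"

definition job_count :: "cls list \<Rightarrow> nat" where
  "job_count cs = (\<Sum>(r, l)\<leftarrow>cs. length l)"

definition bounded :: "nat \<Rightarrow> nat \<Rightarrow> nat \<Rightarrow> nat \<Rightarrow> cls list \<Rightarrow> bool" where
  "bounded V Z q E cs \<longleftrightarrow> length cs \<le> Z \<and> (\<forall>(r, l) \<in> set cs. r \<le> V \<and> r * q \<le> V \<and> length l \<le> Z) \<and>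
     total_size cs \<le> V \<and> total_size cs * E \<le> V \<and> job_count cs \<le> V"

lemma bounded_Cons:
  assumes "bounded V Z q E ((r, l) # cs)"
  shows "bounded V Z q E cs" "r \<le> V" "r * q \<le> V" "length l \<le> Z"
  using assms by (auto simp: bounded_def total_size_def job_count_def add_mult_distrib)

lemma choices_load:
  "t \<in> set (choices D q i a cs) \<Longrightarrow> fst (fst t) \<le> total_size cs \<and> snd (fst t) \<le> job_count cs"
proof (induction cs arbitrary: t)
  case (Cons c cs)
  obtain r l where [simp]: "c = (r, l)"
    by fastforce
  consider "t = ((r, 1), ((hd l, i) # a, (r, tl l) # cs))" "l \<noteq> []" |
    t0 where "t0 \<in> set (choices D q i a cs)" "t \<in> set (class_choices D q i r l t0)"
    using Cons.prems by (auto split: if_splits)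
  then show ?case
  proof cases
    case 1
    then have "1 \<le> length l"
      by (simp add: Suc_leI)
    then have "r \<le> length l * r"
      using mult_le_mono1[of 1 "length l" r] by simp
    with 1 \<open>1 \<le> length l\<close> show ?thesis
      using trans_le_add1[of r "length l * r"]
      by (simp add: total_size_def job_count_def)
  next
    case 2
    then show ?thesis
      using Cons.IH[OF 2(1)] class_choices_load[OF 2(2)] by (simp add: total_size_def job_count_def)
  qed
qed (simp add: total_size_def job_count_def)

lemma length_concat_ge:
  "(\<And>x. x \<in> set xs \<Longrightarrow> 1 \<le> length (g x)) \<Longrightarrow> length xs \<le> length (concat (map g xs))"
  by (induction xs) fastforce+

lemma length_choices_Cons: "length (choices D q i a cs) \<le> length (choices D q i a (c # cs))"
proof -
  obtain r l where [simp]: "c = (r, l)"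
    by fastforce
  show ?thesis
    using length_concat_ge[of "choices D q i a cs" "class_choices D q i r l"] length_class_choices(1)
    by (simp del: length_concat)
qed

lemma evb_If_IsPair:
  "evb P V env e (Pair x y) s \<Longrightarrow> evb P V env e1 v k \<Longrightarrow> evb P V env (If (IsPair e) e1 e2) v (s + k + 2)"
  "evb P V env e (Nat n) s \<Longrightarrow> evb P V env e2 v k \<Longrightarrow> evb P V env (If (IsPair e) e1 e2) v (s + k + 2)"
  using evb_If[OF evb_IsPair, of P V env e "Pair x y" s e1 v k e2 undefined 0]
    evb_If[OF evb_IsPair, of P V env e "Nat n" s e1 undefined 0 e2 v k] by auto

lemma fn_choices:
  assumes "bounded V Z q E cs" "D \<le> V" "q \<le> V" "1 \<le> V" "length (choices D q i a cs) \<le> C"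
  shows "fn (qprog E) V 11 (enc_list enc_cls cs)
    (Pair (Pair (Pair (Nat D) (Nat q)) (Nat i)) (enc_list enc_pair a))
    (enc_list enc_choice (choices D q i a cs)) (Suc Z * (Suc C * (300 * Suc Z) + 150))"
proof -
  define I where "I = (\<lambda>cs. bounded V Z q E cs \<and> length (choices D q i a cs) \<le> C)"
  have I: "I cs" "r \<le> V" if "I ((r, l) # cs)" for r l cs
    using that bounded_Cons[of V Z q E r l cs] length_choices_Cons[of D q i a cs "(r, l)"]
    unfolding I_def by auto
  have ext: "fn (qprog E) V 10 (enc_list enc_choice (choices D q i a cs))
    (Pair (Pair (Nat r) (enc_list Nat l)) (Pair (Pair (Nat D) (Nat q)) (Nat i)))
    (enc_list enc_choice (concat (map (class_choices D q i r l) (choices D q i a cs))))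
    (Suc C * (300 * Suc Z))" if "I ((r, l) # cs)" for r l cs
  proof -
    have "\<forall>t\<in>set (choices D q i a cs). fst (fst t) + length l * r \<le> V \<and> snd (fst t) + length l \<le> V"
    proof
      fix t assume "t \<in> set (choices D q i a cs)"
      from choices_load[OF this] show "fst (fst t) + length l * r \<le> V \<and> snd (fst t) + length l \<le> V"
        using that by (auto simp: I_def bounded_def total_size_def job_count_def)
    qed
    moreover have "bounded V Z q E ((r, l) # cs)"
      using that by (simp add: I_def)
    moreover have "length (choices D q i a cs) \<le> C"
      using I(1)[OF that] by (simp add: I_def)
    ultimately show ?thesis
      using bounded_Cons[of V Z q E r l cs] assms
      by (intro fn_mono[OF fn_extend[where Z = Z]]) auto
  qed
  show ?thesis
    apply (rule fn_mono, rule fn_list_rec_const[where I = I and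
          k = "Suc C * (300 * Suc Z) + 120" and
          g = "\<lambda>cs. enc_list enc_choice (choices D q i a cs)"],
        simp add: qprog_length, simp add: qprog_def del: One_nat_def)
        apply ((rule evb_eqI, (rule evb_intros | simp del: One_nat_def; fail)+)[1])
       apply (metis I(1) surj_pair)
      apply (simp_all only: split_paired_all enc_simps)
      subgoal for r l xs
        apply (cases l)
         apply (simp_all only: enc_list.simps)
         apply ((rule evb_eqI, (rule evb_Let evb_MkPair evb_Call evb_Fst evb_Snd evb_Var evb_If_IsPair(2) evb_Arith evb_Const
                ext[where l = "[]", unfolded enc_list.simps] evb_If
                | assumption | simp add: assms I(2) del: One_nat_def; fail)+)[1])
        apply ((rule evb_eqI, (rule evb_Let evb_MkPair evb_Call evb_Fst evb_Snd evb_Var evb_If_IsPair(1) evb_Arith evb_Const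
                ext[where l = "x # y" for x y, unfolded enc_list.simps] evb_If
                | assumption | simp add: assms I(2) del: One_nat_def; fail)+)[1])
        done
     apply (use assms in \<open>simp add: I_def\<close>)
    using assms(1) unfolding bounded_def apply (intro mult_le_mono) apply auto
    done
qed

lemma fn_filter_accept:
  assumes "\<forall>t \<in> set ts. fst (fst t) \<le> V \<and> fst (fst t) * E \<le> V \<and> snd (fst t) \<le> V"
    and "D \<le> V" "D * (E - 2) \<le> V" "f \<le> V" "E \<le> V"
  shows "fn (qprog E) V 12 (enc_list enc_choice ts) (Pair (Nat D) (Nat f))
    (enc_list enc_partial (map snd (filter (accept E D f) ts))) (Suc (length ts) * 100)"
proof -
  have E: "E - 2 \<le> V"
    using assms(5) by simp
  show ?thesis
    apply (rule fn_mono, rule fn_list_rec_const[where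
          I = "\<lambda>ts. \<forall>t \<in> set ts. fst (fst t) \<le> V \<and> fst (fst t) * E \<le> V \<and> snd (fst t) \<le> V" and
          k = 80 and g = "\<lambda>ts. enc_list enc_partial (map snd (filter (accept E D f) ts))"],
        simp add: qprog_length, simp add: qprog_def del: One_nat_def)
        apply (simp_all only: split_paired_all enc_choice.simps)
        apply ((rule evb_eqI, (rule evb_intros | simp del: One_nat_def; fail)+)[1])
       apply simp
      apply ((rule evb_eqI, (rule evb_intros | simp add: assms E not_less del: One_nat_def; fail)+)[1])
     apply (use assms in simp)
    apply simp
    done
qed

lemma fn_expand:
  assumes "\<forall>p \<in> set S. bounded V Z q E (snd p) \<and> length (choices D q i (fst p) (snd p)) \<le> C"
    and "D \<le> V" "D * (E - 2) \<le> V" "f \<le> V" "E \<le> V" "q \<le> V" "1 \<le> V"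
  shows "fn (qprog E) V 13 (enc_list enc_partial S) (Pair (enc_machine (D, f, i)) (Nat q))
    (enc_list enc_partial (concat (map (expand E q (D, f, i)) S)))
    (Suc (length S) * (Suc Z * (Suc C * (300 * Suc Z) + 150) + Suc C * 120 + 80))"
proof -
  let ?I = "\<lambda>S :: partial list.
    \<forall>p \<in> set S. bounded V Z q E (snd p) \<and> length (choices D q i (fst p) (snd p)) \<le> C"
  have cho: "fn (qprog E) V 11 (enc_list enc_cls cs)
      (Pair (Pair (Pair (Nat D) (Nat q)) (Nat i)) (enc_list enc_pair a))
      (enc_list enc_choice (choices D q i a cs)) (Suc Z * (Suc C * (300 * Suc Z) + 150))"
    if "?I ((a, cs) # S)" for a cs S
    using that assms by (intro fn_choices) auto
  have acc: "fn (qprog E) V 12 (enc_list enc_choice (choices D q i a cs)) (Pair (Nat D) (Nat f))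
      (enc_list enc_partial (expand E q (D, f, i) (a, cs))) (Suc C * 100)"
    if "?I ((a, cs) # S)" for a cs S
  proof -
    have "\<forall>t\<in>set (choices D q i a cs). fst (fst t) \<le> V \<and> fst (fst t) * E \<le> V \<and> snd (fst t) \<le> V"
    proof
      fix t assume "t \<in> set (choices D q i a cs)"
      note t = choices_load[OF this]
      have "fst (fst t) * E \<le> total_size cs * E"
        using t by simp
      moreover have "bounded V Z q E cs"
        using that by simp
      ultimately show "fst (fst t) \<le> V \<and> fst (fst t) * E \<le> V \<and> snd (fst t) \<le> V"
        using t unfolding bounded_def by linarith
    qed
    from fn_filter_accept[OF this assms(2-5)] show ?thesis
      using that by (auto intro: fn_mono)
  qed
  have app: "fn (qprog E) V 8 (enc_list enc_partial (expand E q (D, f, i) (a, cs)))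
      (enc_list enc_partial ys) (enc_list enc_partial (expand E q (D, f, i) (a, cs) @ ys)) (Suc C * 20)"
    if "?I ((a, cs) # S)" for a cs S ys
    using that length_filter_le[of "accept E D f" "choices D q i a cs"]
    by (intro fn_mono[OF fn_append]) (auto simp del: length_filter_le)
  show ?thesis
    apply (rule fn_mono, rule fn_list_rec_const[where I = ?I and
          k = "Suc Z * (Suc C * (300 * Suc Z) + 150) + Suc C * 120 + 70" and
          g = "\<lambda>S. enc_list enc_partial (concat (map (expand E q (D, f, i)) S))"],
        simp add: qprog_length, simp add: qprog_def del: One_nat_def)
        apply (simp_all only: split_paired_all enc_partial.simps enc_machine.simps)
        apply ((rule evb_eqI, (rule evb_intros | simp del: One_nat_def; fail)+)[1])
       apply simp
      apply ((rule evb_eqI, (rule evb_Call evb_MkPair evb_Fst evb_Snd evb_Var cho acc app | assumption | simp del: One_nat_def expand.simps; fail)+)[1])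
     apply (use assms in simp)
    apply (rule mult_le_mono2, simp)
    done
qed

lemma fn_key:
  assumes "bounded V Z q E cs" "D \<le> V" "1 \<le> V"
  shows "fn (qprog E) V 14 (enc_list enc_cls cs) (Nat D) (enc_list Nat (key D cs))
    (Suc Z * (Suc Z * 40 + 100))"
proof -
  have len: "fn (qprog E) V 3 (enc_list Nat l) p (Nat (length l)) (Suc Z * 20)"
    "r \<le> V" "length l \<le> V" "big_jobs D cs \<le> V" "bounded V Z q E cs"
    if "bounded V Z q E ((r, l) # cs)" for r l p and cs
  proof -
    show "length l \<le> V"
      using that by (auto simp: bounded_def job_count_def)
    then show "fn (qprog E) V 3 (enc_list Nat l) p (Nat (length l)) (Suc Z * 20)"
      using fn_length[of l V E Nat p] bounded_Cons(4)[OF that] assms(3) by (auto intro: fn_mono)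
    have "big_jobs D cs \<le> job_count cs"
      unfolding big_jobs_def job_count_def by (rule sum_list_mono) auto
    then show "big_jobs D cs \<le> V"
      using that by (auto simp: bounded_def job_count_def)
  qed (use bounded_Cons[OF that] in auto)
  show ?thesis
    apply (rule fn_mono, rule fn_list_rec_const[where I = "bounded V Z q E" and
          k = "Suc Z * 40 + 80" and g = "\<lambda>cs. enc_list Nat (key D cs)"],
        simp add: qprog_length, simp add: qprog_def del: One_nat_def)
        apply (simp_all only: split_paired_all enc_cls.simps key_def enc_list.simps)
        apply ((rule evb_eqI, (rule evb_intros | simp add: big_jobs_def del: One_nat_def; fail)+)[1])
       apply (rule len(5), assumption)
      apply ((rule evb_eqI, (rule evb_Call evb_If evb_Arith evb_Const evb_MkPair evb_Fst evb_Snd evb_Var len(1) assms(2) | assumption | (erule len(2-4)) | simp add: big_jobs_def del: One_nat_def; fail)+)[1])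
     apply (use assms in simp)
    using assms(1) unfolding bounded_def apply (intro mult_le_mono) apply auto
    done
qed

lemma fn_list_eq:
  assumes "length xs = length ys" "\<forall>x \<in> set xs. x \<le> V" "\<forall>y \<in> set ys. y \<le> V"
  shows "fn (qprog E) V 15 (enc_list Nat xs) (enc_list Nat ys) (Nat (if xs = ys then 1 else 0))
    (Suc (length xs) * 40)"
  apply (rule fn_mono, rule fn_list_rec[where
        I = "\<lambda>xs ys. length xs = length ys \<and> (\<forall>x \<in> set xs. x \<le> V) \<and> (\<forall>y \<in> set ys. y \<le> V)" and
        k = 25 and k' = 5 and ep = "enc_list Nat" and h = "\<lambda>_ ys. tl ys" and
        g = "\<lambda>xs ys. Nat (if xs = ys then 1 else 0)"], simp add: qprog_length,
      simp add: qprog_def del: One_nat_def)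
       apply ((rule evb_eqI, (rule evb_intros | simp del: One_nat_def; fail)+)[1])
  subgoal for x xs ys
    apply (cases ys)
     apply simp
    apply (simp only: list.sel enc_list.simps)
    apply ((rule evb_eqI, (rule evb_intros | simp del: One_nat_def; fail)+)[1])
    done
     apply (metis list.set_sel(2) list.size(3) length_Cons length_tl diff_Suc_1 set_subset_Cons subsetD nat.distinct(1))
  subgoal for x xs ys
    apply (cases ys)
     apply simp
    apply (simp only: list.sel enc_list.simps)
    apply ((rule evb_eqI, (rule evb_intros | simp del: One_nat_def; fail)+)[1])
    done
   apply (use assms in simp)
  apply simp
  done

lemma key_le:
  assumes "bounded V Z q E cs" "x \<in> set (key D cs)"
  shows "x \<le> V"
proof -
  have "big_jobs D cs \<le> job_count cs"
    unfolding big_jobs_def job_count_def by (rule sum_list_mono) auto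
  moreover have "length l \<le> job_count cs" if "(r, l) \<in> set cs" for r l
    unfolding job_count_def using that by (intro member_le_sum_list) (force, simp)
  ultimately have "x \<le> job_count cs"
    using assms(2) by (auto simp: key_def)
  then show ?thesis
    using assms(1) by (simp add: bounded_def)
qed

lemma fn_key_member:
  assumes "\<forall>p \<in> set S. bounded V Z q E (snd p) \<and> length (snd p) = k"
    and "length K = Suc k" "\<forall>x \<in> set K. x \<le> V" "D \<le> V" "1 \<le> V"
  shows "fn (qprog E) V 16 (enc_list enc_partial S) (Pair (Nat D) (enc_list Nat K))
    (Nat (if K \<in> (key D \<circ> snd) ` set S then 1 else 0)) (Suc (length S) * (Suc Z * (Suc Z * 40 + 180) + 40))"
proof -
  let ?I = "\<lambda>S :: partial list. \<forall>p \<in> set S. bounded V Z q E (snd p) \<and> length (snd p) = k"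
  have key: "fn (qprog E) V 14 (enc_list enc_cls cs) (Nat D) (enc_list Nat (key D cs))
    (Suc Z * (Suc Z * 40 + 100))"
    and eq: "fn (qprog E) V 15 (enc_list Nat (key D cs)) (enc_list Nat K)
    (Nat (if key D cs = K then 1 else 0)) (Suc Z * 80)" if "?I ((a, cs) # S)" for a cs S
  proof -
    have b: "bounded V Z q E cs"
      using that by simp
    show "fn (qprog E) V 14 (enc_list enc_cls cs) (Nat D) (enc_list Nat (key D cs))
      (Suc Z * (Suc Z * 40 + 100))"
      by (rule fn_key[OF b assms(4,5)])
    have "length (key D cs) = length K" "length cs \<le> Z"
      using that assms(2) by (auto simp: key_def bounded_def)
    then show "fn (qprog E) V 15 (enc_list Nat (key D cs)) (enc_list Nat K)
      (Nat (if key D cs = K then 1 else 0)) (Suc Z * 80)"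
      using key_le[OF b] assms(3) by (intro fn_mono[OF fn_list_eq]) (auto simp: key_def)
  qed
  show ?thesis
    apply (rule fn_mono, rule fn_list_rec_const[where I = ?I and
          k = "Suc Z * (Suc Z * 40 + 180) + 30" and
          g = "\<lambda>S. Nat (if K \<in> (key D \<circ> snd) ` set S then 1 else 0)"],
        simp add: qprog_length, simp add: qprog_def del: One_nat_def)
        apply (simp_all only: split_paired_all enc_partial.simps)
        apply ((rule evb_eqI, (rule evb_intros | simp del: One_nat_def; fail)+)[1])
       apply simp
      apply ((rule evb_eqI, (rule evb_Call evb_If evb_Const evb_MkPair evb_Fst evb_Snd evb_Var key eq | assumption | (simp del: One_nat_def; fail) | (auto simp: image_iff; fail) | (simp add: algebra_simps; fail))+)[1])
     apply (use assms in simp)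
    apply (rule mult_le_mono2, simp)
    done
qed

lemma set_dedup: "set (dedup g xs) \<subseteq> set xs"
  by (induction xs) auto

lemma length_dedup: "length (dedup g xs) \<le> length xs"
  by (induction xs) auto

lemma fn_dedup:
  assumes "\<forall>p \<in> set S. bounded V Z q E (snd p) \<and> length (snd p) = k" "length S \<le> Y" "D \<le> V" "1 \<le> V"
  shows "fn (qprog E) V 17 (enc_list enc_partial S) (Nat D)
    (enc_list enc_partial (dedup (key D \<circ> snd) S))
    (Suc Y * (Suc Y * (Suc Z * (Suc Z * 40 + 180) + 40) + Suc Z * (Suc Z * 40 + 100) + 40))"
proof -
  define I where "I = (\<lambda>S :: partial list. (\<forall>p \<in> set S. bounded V Z q E (snd p) \<and> length (snd p) = k) \<and> length S \<le> Y)"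
  have key: "fn (qprog E) V 14 (enc_list enc_cls cs) (Nat D) (enc_list Nat (key D cs))
    (Suc Z * (Suc Z * 40 + 100))"
    and mem: "fn (qprog E) V 16 (enc_list enc_partial (dedup (key D \<circ> snd) S)) (Pair (Nat D) (enc_list Nat (key D cs)))
    (Nat (if key D cs \<in> (key D \<circ> snd) ` set (dedup (key D \<circ> snd) S) then 1 else 0))
    (Suc Y * (Suc Z * (Suc Z * 40 + 180) + 40))" if "I ((a, cs) # S)" for a cs S
  proof -
    have b: "bounded V Z q E cs" "length cs = k" "Suc (length S) \<le> Y"
      using that by (simp_all add: I_def)
    show "fn (qprog E) V 14 (enc_list enc_cls cs) (Nat D) (enc_list Nat (key D cs))
      (Suc Z * (Suc Z * 40 + 100))"
      by (rule fn_key[OF b(1) assms(3,4)])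
    have "\<forall>p \<in> set (dedup (key D \<circ> snd) S). bounded V Z q E (snd p) \<and> length (snd p) = k"
      using that set_dedup[of "key D \<circ> snd" S] by (auto simp: I_def)
    moreover have "length (key D cs) = Suc k"
      using b(2) by (simp add: key_def)
    moreover have "length (dedup (key D \<circ> snd) S) \<le> Y"
      using b(3) length_dedup[of "key D \<circ> snd" S] by linarith
    ultimately show "fn (qprog E) V 16 (enc_list enc_partial (dedup (key D \<circ> snd) S)) (Pair (Nat D) (enc_list Nat (key D cs)))
      (Nat (if key D cs \<in> (key D \<circ> snd) ` set (dedup (key D \<circ> snd) S) then 1 else 0))
      (Suc Y * (Suc Z * (Suc Z * 40 + 180) + 40))"
      using key_le[OF b(1)] assms(3,4) by (intro fn_mono[OF fn_key_member]) auto
  qed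
  have bound: "I xs" if "I (p # xs)" for p xs
    using that by (auto simp: I_def)
  show ?thesis
    apply (rule fn_mono, rule fn_list_rec_const[where I = I and
          k = "Suc Y * (Suc Z * (Suc Z * 40 + 180) + 40) + Suc Z * (Suc Z * 40 + 100) + 30" and
          g = "\<lambda>S. enc_list enc_partial (dedup (key D \<circ> snd) S)"],
        simp add: qprog_length, simp add: qprog_def del: One_nat_def)
        apply ((rule evb_eqI, (rule evb_intros | simp del: One_nat_def; fail)+)[1])
       apply (rule bound, assumption)
      apply (simp_all only: split_paired_all enc_partial.simps)
      apply ((rule evb_eqI, (rule evb_Call evb_If evb_Const evb_MkPair evb_Fst evb_Snd evb_Var key mem | assumption | (simp del: One_nat_def; fail))+)[1])
     apply (use assms in \<open>simp add: I_def\<close>)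
    apply (rule mult_le_mono, use assms in simp_all)
    done
qed

definition expand_cost :: "nat \<Rightarrow> nat \<Rightarrow> nat \<Rightarrow> nat" where
  "expand_cost Z C Q = Suc Q * (Suc Z * (Suc C * (300 * Suc Z) + 150) + Suc C * 120 + 80)"

definition dedup_cost :: "nat \<Rightarrow> nat \<Rightarrow> nat" where
  "dedup_cost Z Y =
     Suc Y * (Suc Y * (Suc Z * (Suc Z * 40 + 180) + 40) + Suc Z * (Suc Z * 40 + 100) + 40)"

lemma fn_dp:
  assumes I: "I ms" "\<And>M ms. I (M # ms) \<Longrightarrow> I ms"
    and dp: "\<And>D f i ms p. I ((D, f, i) # ms) \<Longrightarrow> p \<in> set (dp E q cs ms) \<Longrightarrow>
      bounded V Z q E (snd p) \<and> length (choices D q i (fst p) (snd p)) \<le> C"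
    and len: "\<And>D f i ms. I ((D, f, i) # ms) \<Longrightarrow> length (dp E q cs ms) \<le> Q"
    and ex: "\<And>M ms p. I (M # ms) \<Longrightarrow> p \<in> set (concat (map (expand E q M) (dp E q cs ms))) \<Longrightarrow>
      bounded V Z q E (snd p) \<and> length (snd p) = k"
    and exlen: "\<And>M ms. I (M # ms) \<Longrightarrow> length (concat (map (expand E q M) (dp E q cs ms))) \<le> Y"
    and D: "\<And>D f i ms. I ((D, f, i) # ms) \<Longrightarrow> D \<le> V \<and> D * (E - 2) \<le> V \<and> f \<le> V"
    and V: "E \<le> V" "q \<le> V" "1 \<le> V" and ms: "length ms \<le> Z"
  shows "fn (qprog E) V 18 (enc_list enc_machine ms) (Pair (Nat q) (enc_list enc_cls cs))
    (enc_list enc_partial (dp E q cs ms)) (Suc Z * (expand_cost Z C Q + dedup_cost Z Y + 40))"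
proof -
  have exp: "fn (qprog E) V 13 (enc_list enc_partial (dp E q cs ms)) (Pair (enc_machine (D, f, i)) (Nat q))
      (enc_list enc_partial (concat (map (expand E q (D, f, i)) (dp E q cs ms)))) (expand_cost Z C Q)"
    and ded: "fn (qprog E) V 17 (enc_list enc_partial (concat (map (expand E q (D, f, i)) (dp E q cs ms)))) (Nat D)
      (enc_list enc_partial (dp E q cs ((D, f, i) # ms))) (dedup_cost Z Y)"
    if "I ((D, f, i) # ms)" for D f i ms
  proof -
    show "fn (qprog E) V 13 (enc_list enc_partial (dp E q cs ms)) (Pair (enc_machine (D, f, i)) (Nat q))
      (enc_list enc_partial (concat (map (expand E q (D, f, i)) (dp E q cs ms)))) (expand_cost Z C Q)"
      unfolding expand_cost_def
      using dp[OF that] len[OF that] D[OF that] V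
      by (intro fn_mono[OF fn_expand[where Z = Z and C = C]] mult_le_mono1) auto
    show "fn (qprog E) V 17 (enc_list enc_partial (concat (map (expand E q (D, f, i)) (dp E q cs ms)))) (Nat D)
      (enc_list enc_partial (dp E q cs ((D, f, i) # ms))) (dedup_cost Z Y)"
      unfolding dedup_cost_def dp.simps fst_conv
      using ex[OF that] exlen[OF that] D[OF that] V
      by (intro fn_dedup[where Z = Z and q = q and k = k]) blast+
  qed
  show ?thesis
    apply (rule fn_mono, rule fn_list_rec_const[where I = I and
          k = "expand_cost Z C Q + dedup_cost Z Y + 30" and
          g = "\<lambda>ms. enc_list enc_partial (dp E q cs ms)"],
        simp add: qprog_length, simp add: qprog_def del: One_nat_def)
        apply ((rule evb_eqI, (rule evb_intros | simp del: One_nat_def; fail)+)[1])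
       apply (rule I(2), assumption)
      apply (simp_all only: split_paired_all)
      apply ((rule evb_eqI, (rule evb_Call evb_MkPair evb_Var exp[unfolded enc_machine.simps] ded | (simp only: enc_machine.simps, rule evb_Fst evb_Snd) | rule evb_Fst evb_Snd evb_Var exp ded | assumption | (simp del: One_nat_def; fail))+)[1])
     apply (rule I(1))
    apply (rule mult_le_mono, use ms in simp_all)
    done
qed

lemma fn_lookup:
  assumes "\<forall>(j, i) \<in> set a. j \<le> V \<and> i \<le> V" "j \<le> V" "1 \<le> V"
  shows "fn (qprog E) V 19 (enc_list enc_pair a) (Nat j)
    (case map_of a j of None \<Rightarrow> Nat 0 | Some i \<Rightarrow> Nat (Suc i)) (Suc (length a) * 40)"
  apply (rule fn_mono, rule fn_list_rec_const[where I = "\<lambda>a. \<forall>(j, i) \<in> set a. j \<le> V \<and> i \<le> V" and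
        k = 30 and g = "\<lambda>a. case map_of a j of None \<Rightarrow> Nat 0 | Some i \<Rightarrow> Nat (Suc i)"],
      simp add: qprog_length, simp add: qprog_def del: One_nat_def)
      apply (simp_all only: split_paired_all enc_pair.simps)
      apply ((rule evb_eqI, (rule evb_intros | simp del: One_nat_def; fail)+)[1])
     apply simp
    apply ((rule evb_eqI, (rule evb_intros | simp add: assms del: One_nat_def; fail)+)[1])
   apply (use assms in simp)
  apply simp
  done

lemma fn_assignment:
  fixes js :: "'a list"
  assumes "\<forall>(j, i) \<in> set a. j \<le> V \<and> i \<le> V" "j + length js \<le> V" "1 \<le> V"
    and "length a \<le> Z" "length js \<le> Z"
  shows "fn (qprog E) V 20 (enc_list ea js) (Pair (enc_list enc_pair a) (Nat j))
    (enc_assignment (map (map_of a) [j..<j + length js])) (Suc Z * (Suc Z * 40 + 60))"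
proof -
  have look: "fn (qprog E) V 19 (enc_list enc_pair a) (Nat j)
    (case map_of a j of None \<Rightarrow> Nat 0 | Some i \<Rightarrow> Nat (Suc i)) (Suc Z * 40)" if "j \<le> V" for j
    using assms(4) by (intro fn_mono[OF fn_lookup[OF assms(1) that assms(3)]]) simp
  have Cons: "enc_assignment (map (map_of a) [j..<j + length (x # xs)]) =
    Pair (case map_of a j of None \<Rightarrow> Nat 0 | Some i \<Rightarrow> Nat (Suc i))
      (enc_assignment (map (map_of a) [j + 1..<j + 1 + length xs]))" for j x and xs :: "'a list"
    by (simp add: enc_assignment_def upt_conv_Cons del: upt_Suc)
  show ?thesis
    apply (rule fn_mono, rule fn_list_rec[where I = "\<lambda>js j. j + length js \<le> V" and
          k = "Suc Z * 40 + 30" and k' = 10 and ep = "\<lambda>j. Pair (enc_list enc_pair a) (Nat j)" and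
          h = "\<lambda>_ j. j + 1" and
          g = "\<lambda>js j. enc_assignment (map (map_of a) [j..<j + length js])"],
        simp add: qprog_length, simp add: qprog_def del: One_nat_def)
         apply ((rule evb_eqI, (rule evb_intros | simp add: enc_assignment_def del: One_nat_def; fail)+)[1])
        apply ((rule evb_eqI, (rule evb_intros | simp add: assms del: One_nat_def; fail)+)[1])
       apply simp
      apply ((rule evb_eqI, (rule evb_Call evb_MkPair evb_Fst evb_Snd evb_Var look | (simp only: Cons; fail) | simp; fail)+)[1])
     apply (rule assms(2))
    using assms(5) apply (intro mult_le_mono) apply simp_all
    done
qed

lemma runs_main:
  assumes "fn (qprog E) V 2 (enc_list enc_rat js) (Nat 1) (Nat L') k1"
    and "fn (qprog E) V 1 mv (Nat L') (Nat L) k2"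
    and "fn (qprog E) V 5 mv (Pair (Nat L) (Nat 0)) Mv k3"
    and "fn (qprog E) V 3 (enc_list enc_rat js) (Nat 0) (Nat n) k4"
    and "fn (qprog E) V 7 (enc_list enc_rat js) (Pair (Nat L) (Nat 0)) cv k5"
    and "fn (qprog E) V 18 Mv (Pair (Nat ((n + 1) * E)) cv) (enc_list enc_partial S) k6"
    and "\<And>a cs S'. S = (a, cs) # S' \<Longrightarrow>
      fn (qprog E) V 20 (enc_list enc_rat js) (Pair (enc_list enc_pair a) (Nat 0)) y k7"
    and "S = [] \<Longrightarrow> y = Nat 0"
    and "n + 1 \<le> V" "E \<le> V"
  shows "\<exists>t \<le> (k1 + k2 + k3 + k4 + k5 + k6 + k7 + 100) * (2 * bits V + 1).
    runs (qprog E) (Pair mv (enc_list enc_rat js)) y t"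
proof -
  have n: "n \<le> V" "1 \<le> V"
    using assms(9) by auto
  have "evb (qprog E) V [Pair mv (enc_list enc_rat js)] (main_body E) y
      (k1 + k2 + k3 + k4 + k5 + k6 + k7 + 90)"
  proof (cases S)
    case Nil
    note dp = assms(6)[unfolded Nil enc_list.simps]
    show ?thesis
      unfolding main_body_def
      apply ((rule evb_eqI, (rule evb_Let evb_If_IsPair(2) evb_Call evb_MkPair evb_Arith evb_Fst evb_Snd evb_Var evb_Const assms(1-5,9,10) dp n)+)[1])
      using assms(8)[OF Nil] by simp_all
  next
    case (Cons p S')
    obtain a cs where p: "p = (a, cs)"
      by fastforce
    note dp = assms(6)[unfolded Cons p enc_list.simps enc_partial.simps]
    note fin = assms(7)[OF Cons[unfolded p]]
    show ?thesis
      unfolding main_body_def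
      apply ((rule evb_eqI, (rule evb_Let evb_If_IsPair(1) evb_Call evb_MkPair evb_Arith evb_Fst evb_Snd evb_Var evb_Const assms(1-5,9,10) dp n fin)+)[1])
      by simp_all
  qed
  then obtain t where t: "t \<le> (k1 + k2 + k3 + k4 + k5 + k6 + k7 + 90) * (2 * bits V + 1)"
    "eval (qprog E) [Pair mv (enc_list enc_rat js)] (main_body E) y t"
    unfolding evb_def by blast
  have "eval (qprog E) [Pair mv (enc_list enc_rat js)] (Call 0 [Var 0]) y (Suc ((1 + 0) + t))"
    using t(2) evals_Cons[OF eval_Var evals_Nil, of 0 "[Pair mv (enc_list enc_rat js)]" "qprog E"]
    by (intro eval_Call) (simp_all add: qprog_length, simp add: qprog_def)
  moreover have "Suc ((1 + 0) + t) \<le> (k1 + k2 + k3 + k4 + k5 + k6 + k7 + 100) * (2 * bits V + 1)"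
    using t(1) by (simp add: add_mult_distrib)
  ultimately show ?thesis
    unfolding runs_def by blast
qed

section \<open>Correctness of the dynamic program\<close>

lemma class_choices_iff:
  "t \<in> set (class_choices D q i r l ((s, k), (a, cs))) \<longleftrightarrow>
   (\<exists>u l'. l = u @ l' \<and> (u = [] \<or> window D q r) \<and>
     t = ((s + length u * r, k + length u), (map (\<lambda>j. (j, i)) (rev u) @ a, (r, l') # cs)))"
proof (induction l arbitrary: s k a)
  case (Cons j l)
  show ?case (is "?L \<longleftrightarrow> ?R")
  proof
    assume ?L
    then consider "t = ((s, k), (a, (r, j # l) # cs))" |
      "window D q r" "t \<in> set (class_choices D q i r l ((s + r, k + 1), ((j, i) # a, cs)))"
      by (auto split: if_splits)
    then show ?R
    proof cases
      case 1
      then show ?thesis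
        by (intro exI[of _ "[]"] exI[of _ "j # l"]) simp
    next
      case 2
      then obtain u l' where "l = u @ l'"
        "t = (((s + r) + length u * r, k + 1 + length u), (map (\<lambda>j. (j, i)) (rev u) @ (j, i) # a, (r, l') # cs))"
        unfolding Cons.IH by blast
      with 2 show ?thesis
        by (intro exI[of _ "j # u"] exI[of _ l']) simp
    qed
  next
    assume ?R
    then obtain u l' where u: "j # l = u @ l'" "u = [] \<or> window D q r"
      "t = ((s + length u * r, k + length u), (map (\<lambda>j. (j, i)) (rev u) @ a, (r, l') # cs))"
      by blast
    show ?L
    proof (cases u)
      case Nil
      with u show ?thesis
        by auto
    next
      case (Cons j' u')
      then have "t \<in> set (class_choices D q i r l ((s + r, k + 1), ((j, i) # a, cs)))"
        unfolding Cons.IH using u by (intro exI[of _ u'] exI[of _ l']) auto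
      moreover have "window D q r"
        using u Cons by simp
      ultimately show ?thesis
        by simp
    qed
  qed
qed auto

lemma choices_cases:
  assumes "t \<in> set (choices D q i a ((r, l) # cs))"
  obtains
    "D \<le> r" "l \<noteq> []" "t = ((r, 1), ((hd l, i) # a, (r, tl l) # cs))" |
    s k a' cs' u l' where "((s, k), (a', cs')) \<in> set (choices D q i a cs)" "l = u @ l'"
      "u = [] \<or> window D q r"
      "t = ((s + length u * r, k + length u), (map (\<lambda>j. (j, i)) (rev u) @ a', (r, l') # cs'))"
proof -
  consider "D \<le> r" "l \<noteq> []" "t = ((r, 1), ((hd l, i) # a, (r, tl l) # cs))" |
    t0 where "t0 \<in> set (choices D q i a cs)" "t \<in> set (class_choices D q i r l t0)"
    using assms by (auto split: if_splits)
  then show ?thesis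
  proof cases
    case 2
    obtain s k a' cs' where t0: "t0 = ((s, k), (a', cs'))"
      by (metis surj_pair)
    from 2(2)[unfolded t0 class_choices_iff] obtain u l' where "l = u @ l'" "u = [] \<or> window D q r"
      "t = ((s + length u * r, k + length u), (map (\<lambda>j. (j, i)) (rev u) @ a', (r, l') # cs'))"
      by blast
    then show ?thesis
      by (rule that(2)[OF 2(1)[unfolded t0]])
  qed (use that(1) in blast)
qed

definition shrunk :: "nat \<Rightarrow> nat \<Rightarrow> cls list \<Rightarrow> cls list \<Rightarrow> bool" where
  "shrunk D q = list_all2 (\<lambda>(r', l') (r, l). r' = r \<and> length l' \<le> length l \<and> set l' \<subseteq> set l \<and>
     (r < D \<and> r * q \<le> D \<longrightarrow> l' = l))"

lemma shrunk_refl: "shrunk D q cs cs"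
  unfolding shrunk_def by (rule list_all2_refl) auto

lemma shrunk_trans: "shrunk D q cs1 cs2 \<Longrightarrow> shrunk D q cs2 cs3 \<Longrightarrow> shrunk D q cs1 cs3"
  unfolding shrunk_def by (rule list_all2_trans) auto

lemma shrunk_mono: "shrunk D q cs1 cs2 \<Longrightarrow> D' \<le> D \<Longrightarrow> shrunk D' q cs1 cs2"
  unfolding shrunk_def by (erule list_all2_mono) auto

lemma shrunk_map_fst: "shrunk D q cs1 cs2 \<Longrightarrow> map fst cs1 = map fst cs2"
  unfolding shrunk_def by (induction rule: list_all2_induct) auto

lemma choices_shrunk:
  "((s, k), (a', cs')) \<in> set (choices D q i a cs) \<Longrightarrow> shrunk D q cs' cs"
proof (induction cs arbitrary: s k a' cs')
  case Nil
  then show ?case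
    by (simp add: shrunk_def)
next
  case (Cons c cs)
  obtain r l where c: "c = (r, l)"
    by fastforce
  from Cons.prems[unfolded c] show ?case
  proof (cases rule: choices_cases)
    case 1
    then show ?thesis
      using shrunk_refl[of D q cs] unfolding c shrunk_def by (cases l) auto
  next
    case (2 s k a'' cs'' u l')
    then show ?thesis
      using Cons.IH[OF 2(1)] unfolding c shrunk_def window_def by (cases u) auto
  qed
qed

lemma choices_sound:
  assumes "((s, k), (a', cs')) \<in> set (choices D q i a cs)"
    and "\<forall>(r, l) \<in> set cs. \<forall>j \<in> set l. r * E \<le> c j * (E + 1)"
  shows "\<exists>new. a' = map (\<lambda>j. (j, i)) new @ a \<and> length new = k \<and>
    mset new + mset (concat (map snd cs')) = mset (concat (map snd cs)) \<and>
    s * E \<le> (\<Sum>j\<leftarrow>new. c j) * (E + 1)"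
  using assms
proof (induction cs arbitrary: s k a' cs')
  case Nil
  then show ?case
    by simp
next
  case (Cons x cs)
  obtain r l where x: "x = (r, l)"
    by fastforce
  from Cons.prems(1)[unfolded x] show ?case
  proof (cases rule: choices_cases)
    case 1
    then show ?thesis
      using Cons.prems(2) unfolding x by (intro exI[of _ "[hd l]"]) (cases l; auto)
  next
    case (2 s0 k0 a0 cs0 u l')
    then obtain new where new: "a0 = map (\<lambda>j. (j, i)) new @ a" "length new = k0"
      "mset new + mset (concat (map snd cs0)) = mset (concat (map snd cs))"
      "s0 * E \<le> (\<Sum>j\<leftarrow>new. c j) * (E + 1)"
      using Cons.IH[OF 2(1)] Cons.prems(2) x by auto
    have "length u * r * E \<le> (\<Sum>j\<leftarrow>u. c j) * (E + 1)"
      if "\<forall>j \<in> set u. r * E \<le> c j * (E + 1)" for u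
      using that by (induction u) (auto simp: algebra_simps)
    then have "length u * r * E \<le> (\<Sum>j\<leftarrow>u. c j) * (E + 1)"
      using Cons.prems(2) 2(2) x by auto
    then show ?thesis
      using 2 new unfolding x
      by (intro exI[of _ "rev u @ new"]) (simp add: algebra_simps rev_map[symmetric] sum_list_rev)
  qed
qed

text \<open>
  \<open>y\<close> gives the numbers of jobs of each size that an exact solution has left; the large jobs only
  need to be available in sufficient total number.
\<close>

definition dominates :: "nat \<Rightarrow> cls list \<Rightarrow> (nat \<Rightarrow> nat) \<Rightarrow> bool" where
  "dominates D cs y \<longleftrightarrow> (\<forall>(r, l) \<in> set cs. r < D \<longrightarrow> y r \<le> length l) \<and>
     (\<Sum>r\<leftarrow>map fst cs. if r < D then 0 else y r) \<le> big_jobs D cs"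

lemma dominates_mono:
  assumes "dominates D cs y" "D' \<le> D"
  shows "dominates D' cs y"
proof -
  have "\<forall>(r, l) \<in> set cs. r < D \<longrightarrow> y r \<le> length l \<Longrightarrow>
    (\<Sum>r\<leftarrow>map fst cs. if r < D' then 0 else y r) + big_jobs D cs
      \<le> (\<Sum>r\<leftarrow>map fst cs. if r < D then 0 else y r) + big_jobs D' cs"
    using assms(2) by (induction cs) (auto simp: big_jobs_def)
  then have "(\<Sum>r\<leftarrow>map fst cs. if r < D' then 0 else y r) \<le> big_jobs D' cs"
    using assms(1) unfolding dominates_def by simp
  then show ?thesis
    using assms unfolding dominates_def by auto
qed

lemma dominates_key:
  assumes "dominates D cs y" "key D cs = key D cs'" "map fst cs = map fst cs'"
  shows "dominates D cs' y"
  unfolding dominates_def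
proof
  have len: "length cs = length cs'"
    using assms(3) map_eq_imp_length_eq by blast
  show "\<forall>(r, l) \<in> set cs'. r < D \<longrightarrow> y r \<le> length l"
  proof clarify
    fix r l assume rl: "(r, l) \<in> set cs'" "r < D"
    then obtain k where k: "k < length cs'" "cs' ! k = (r, l)"
      by (metis in_set_conv_nth)
    obtain l0 where l0: "cs ! k = (r, l0)"
      using k len assms(3) by (metis eq_fst_iff fst_conv nth_map)
    have "map (\<lambda>(r, l). if r < D then length l else 0) cs ! k = map (\<lambda>(r, l). if r < D then length l else 0) cs' ! k"
      using assms(2) by (simp add: key_def)
    then have "length l0 = length l"
      using k l0 len rl(2) by simp
    moreover have "(r, l0) \<in> set cs"
      using l0 k(1) len by (metis nth_mem)
    ultimately show "y r \<le> length l"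
      using assms(1) rl(2) unfolding dominates_def by fastforce
  qed
  show "(\<Sum>r\<leftarrow>map fst cs'. if r < D then 0 else y r) \<le> big_jobs D cs'"
    using assms by (simp add: dominates_def key_def)
qed

lemma choices_big:
  "D \<le> r \<Longrightarrow> l \<noteq> [] \<Longrightarrow>
   ((r, 1), ((hd l, i) # a, cs1 @ (r, tl l) # cs2)) \<in> set (choices D q i a (cs1 @ (r, l) # cs2))"
proof (induction cs1)
  case (Cons c cs1)
  obtain r' l' where c: "c = (r', l')"
    by fastforce
  have "((r, 1), ((hd l, i) # a, c # cs1 @ (r, tl l) # cs2)) \<in>
    set (class_choices D q i r' l' ((r, 1), ((hd l, i) # a, cs1 @ (r, tl l) # cs2)))"
    unfolding class_choices_iff c by force
  then show ?case
    unfolding c append_Cons choices.simps set_append set_concat set_map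
    using Cons by blast
qed auto

lemma choices_window:
  fixes x :: "nat \<Rightarrow> nat"
  assumes "\<forall>(r, l) \<in> set cs. window D q r \<longrightarrow> x r \<le> length l"
  shows "\<exists>a'. ((\<Sum>r\<leftarrow>map fst cs. if window D q r then x r * r else 0,
      \<Sum>r\<leftarrow>map fst cs. if window D q r then x r else 0),
     (a', map (\<lambda>(r, l). (r, drop (if window D q r then x r else 0) l)) cs)) \<in> set (choices D q i a cs)"
  using assms
proof (induction cs)
  case (Cons c cs)
  obtain r l where c: "c = (r, l)"
    by fastforce
  let ?u = "if window D q r then x r else 0"
  from Cons obtain a' where a': "((\<Sum>r\<leftarrow>map fst cs. if window D q r then x r * r else 0,
      \<Sum>r\<leftarrow>map fst cs. if window D q r then x r else 0),
     (a', map (\<lambda>(r, l). (r, drop (if window D q r then x r else 0) l)) cs)) \<in> set (choices D q i a cs)"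
    (is "((?s, ?k), (_, ?cs)) \<in> _") by auto
  have u: "length (take ?u l) = ?u"
    using Cons.prems c by auto
  have "((?s + ?u * r, ?k + ?u), (map (\<lambda>j. (j, i)) (rev (take ?u l)) @ a', (r, drop ?u l) # ?cs))
    \<in> set (class_choices D q i r l ((?s, ?k), (a', ?cs)))"
    unfolding class_choices_iff
    by (rule exI[of _ "take ?u l"], rule exI[of _ "drop ?u l"]) (simp only: u, auto)
  then have "((?s + ?u * r, ?k + ?u), (map (\<lambda>j. (j, i)) (rev (take ?u l)) @ a', (r, drop ?u l) # ?cs))
    \<in> set (choices D q i a (c # cs))"
    unfolding c choices.simps set_append set_concat set_map using a' by blast
  moreover have "(\<Sum>r\<leftarrow>map fst (c # cs). if window D q r then x r * r else 0) = ?s + ?u * r"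
    "(\<Sum>r\<leftarrow>map fst (c # cs). if window D q r then x r else 0) = ?k + ?u"
    "map (\<lambda>(r, l). (r, drop (if window D q r then x r else 0) l)) (c # cs) = (r, drop ?u l) # ?cs"
    by (simp_all add: c)
  ultimately show ?case
    by (simp only:) (rule exI)
qed simp

lemma sum_list_diff:
  fixes x y :: "'a \<Rightarrow> nat"
  assumes "\<forall>r \<in> set rs. x r \<le> y r"
  shows "(\<Sum>r\<leftarrow>rs. y r - x r) + (\<Sum>r\<leftarrow>rs. x r) = (\<Sum>r\<leftarrow>rs. y r)"
  using assms by (induction rs) auto

lemma accept_window:
  fixes D E S T :: nat
  assumes "T * E \<le> D" "D * E \<le> (S + T) * (E + 1)" "2 \<le> E"
  shows "D * (E - 2) \<le> S * E"
proof -
  obtain e where e: "E = e + 2"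
    using assms(3) by (metis add.commute le_Suc_ex)
  have "D * E * E \<le> (S * E + T * E) * (E + 1)"
    using mult_le_mono1[OF assms(2), of E] by (simp add: algebra_simps)
  also have "\<dots> \<le> (S * E + D) * (E + 1)"
    using assms(1) by (intro mult_le_mono1) simp
  finally have "D * e * (e + 3) \<le> S * E * (e + 3)"
    unfolding e by (simp add: algebra_simps)
  then show ?thesis
    unfolding e by simp
qed

lemma machine_step:
  assumes dom: "dominates D cs y" and xy: "\<forall>r \<in> fst ` set cs. x r \<le> y r"
    and f: "(\<Sum>r\<leftarrow>map fst cs. x r) \<le> f" and n: "(\<Sum>r\<leftarrow>map fst cs. x r) \<le> n"
    and load: "D * E \<le> (\<Sum>r\<leftarrow>map fst cs. x r * r) * (E + 1)" and E: "2 \<le> E"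
  shows "\<exists>p \<in> set (expand E ((n + 1) * E) (D, f, i) (a, cs)). dominates D (snd p) (\<lambda>r. y r - x r)"
proof (cases "\<exists>r \<in> fst ` set cs. D \<le> r \<and> 1 \<le> x r")
  case True
  then obtain r0 where r0: "r0 \<in> fst ` set cs" "D \<le> r0" "1 \<le> x r0"
    by blast
  let ?b = "\<lambda>z r. if r < D then 0 else z r :: nat"
  have "(\<Sum>r\<leftarrow>map fst cs. ?b y r - ?b x r) + (\<Sum>r\<leftarrow>map fst cs. ?b x r) = (\<Sum>r\<leftarrow>map fst cs. ?b y r)"
    using xy by (intro sum_list_diff) auto
  moreover have "?b x r0 \<le> (\<Sum>r\<leftarrow>map fst cs. ?b x r)"
    using r0(1) by (intro member_le_sum_list) auto
  moreover have "(\<Sum>r\<leftarrow>map fst cs. ?b y r - ?b x r) = (\<Sum>r\<leftarrow>map fst cs. ?b (\<lambda>r. y r - x r) r)"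
    by (intro arg_cong[of _ _ sum_list] map_cong) auto
  moreover have bd: "(\<Sum>r\<leftarrow>map fst cs. ?b y r) \<le> big_jobs D cs"
    using dom by (simp add: dominates_def)
  ultimately have big: "(\<Sum>r\<leftarrow>map fst cs. ?b (\<lambda>r. y r - x r) r) + 1 \<le> big_jobs D cs"
    using r0(2,3) by simp
  then have "\<exists>(r, l) \<in> set cs. D \<le> r \<and> l \<noteq> []"
    unfolding big_jobs_def by (induction cs) (auto split: if_splits)
  then obtain r l where rl: "(r, l) \<in> set cs" "D \<le> r" "l \<noteq> []"
    by blast
  then obtain cs1 cs2 where cs: "cs = cs1 @ (r, l) # cs2" "D \<le> r" "l \<noteq> []"
    by (metis split_list)
  let ?cs = "cs1 @ (r, tl l) # cs2"
  have "1 \<le> x r0" "x r0 \<le> (\<Sum>r\<leftarrow>map fst cs. x r)"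
    using r0 by (simp, intro member_le_sum_list) force+
  then have "accept E D f ((r, 1), ((hd l, i) # a, ?cs))"
    using f cs(2) mult_le_mono[of D r "E - 2" E] by simp
  then have "((hd l, i) # a, ?cs) \<in> set (expand E ((n + 1) * E) (D, f, i) (a, cs))"
    using choices_big[OF cs(2,3), of i a cs1 cs2 "(n + 1) * E"] unfolding cs(1) by force
  moreover have "dominates D ?cs (\<lambda>r. y r - x r)"
    unfolding dominates_def
  proof
    show "\<forall>(r, l) \<in> set ?cs. r < D \<longrightarrow> y r - x r \<le> length l"
    proof clarify
      fix r' l' assume rl': "(r', l') \<in> set ?cs" "r' < D"
      then have "(r', l') \<in> set cs"
        using cs by auto
      then have "y r' \<le> length l'"
        using dom rl'(2) by (auto simp: dominates_def)
      then show "y r' - x r' \<le> length l'"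
        by simp
    qed
    have "big_jobs D ?cs + 1 = big_jobs D cs"
      using cs(2,3) unfolding cs(1) big_jobs_def by (cases l) auto
    moreover have "map fst ?cs = map fst cs"
      by (simp add: cs(1))
    ultimately show "(\<Sum>r\<leftarrow>map fst ?cs. ?b (\<lambda>r. y r - x r) r) \<le> big_jobs D ?cs"
      using big by simp
  qed
  ultimately show ?thesis
    by force
next
  case False
  let ?q = "(n + 1) * E"
  let ?W = "\<lambda>g r. if window D ?q r then g r else 0 :: nat"
  let ?T = "\<lambda>g r. if window D ?q r then 0 else g r :: nat"
  let ?cs = "map (\<lambda>(r, l). (r, drop (if window D ?q r then x r else 0) l)) cs"
  have x0: "x r = 0" if "r \<in> fst ` set cs" "D \<le> r" for r
    using False that by (metis less_one not_le)
  have "\<forall>(r, l) \<in> set cs. window D ?q r \<longrightarrow> x r \<le> length l"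
    using dom xy unfolding dominates_def window_def by fastforce
  from choices_window[OF this, of i a] obtain a' where
    a': "((\<Sum>r\<leftarrow>map fst cs. ?W (\<lambda>r. x r * r) r, \<Sum>r\<leftarrow>map fst cs. ?W x r), (a', ?cs))
      \<in> set (choices D ?q i a cs)"
    ..
  have W: "(\<Sum>r\<leftarrow>map fst cs. ?W g r) + (\<Sum>r\<leftarrow>map fst cs. ?T g r) = (\<Sum>r\<leftarrow>map fst cs. g r)" for g
    unfolding sum_list_addf[symmetric] by (intro arg_cong[of _ _ sum_list] map_cong) simp_all
  define T where "T = (\<Sum>r\<leftarrow>map fst cs. ?T (\<lambda>r. x r * r) r)"
  have "(\<Sum>r\<leftarrow>map fst cs. ?T (\<lambda>r. x r * r) r) * ?q =
      (\<Sum>r\<leftarrow>map fst cs. ?T (\<lambda>r. x r * r) r * ?q)"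
    by (rule sum_list_mult_const[symmetric])
  also have "\<dots> \<le> (\<Sum>r\<leftarrow>map fst cs. x r * D)"
  proof (rule sum_list_mono)
    fix r assume r: "r \<in> set (map fst cs)"
    show "?T (\<lambda>r. x r * r) r * ?q \<le> x r * D"
    proof (cases "D \<le> r \<or> window D ?q r")
      case True
      have "x r = 0" if "D \<le> r"
        using x0[OF _ that] r by simp
      then have "?T (\<lambda>r. x r * r) r = 0"
        using True by (elim disjE) simp_all
      then show ?thesis
        by (simp only: mult_zero_left zero_le)
    next
      case False
      then have nw: "\<not> window D ?q r" and "r < D"
        unfolding not_le[symmetric] by blast+
      then have "r * ?q \<le> D"
        unfolding window_def not_le[symmetric] by blast
      then have "x r * (r * ?q) \<le> x r * D"
        by (rule mult_le_mono2)
      then have "x r * r * ?q \<le> x r * D"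
        unfolding mult.assoc .
      then show ?thesis
        unfolding if_not_P[OF nw] .
    qed
  qed
  also have "\<dots> = (\<Sum>r\<leftarrow>map fst cs. x r) * D"
    by (rule sum_list_mult_const)
  also have "\<dots> \<le> (n + 1) * D"
    using n by (intro mult_le_mono1) simp
  finally have "T * ?q \<le> (n + 1) * D"
    unfolding T_def .
  then have "(n + 1) * (T * E) \<le> (n + 1) * D"
    unfolding mult.left_commute[of T "n + 1" E] .
  then have T: "T * E \<le> D"
    by (simp only: mult_le_cancel1)
  define S where "S = (\<Sum>r\<leftarrow>map fst cs. ?W (\<lambda>r. x r * r) r)"
  have ST: "S + T = (\<Sum>r\<leftarrow>map fst cs. x r * r)"
    unfolding S_def T_def by (rule W)
  have "D * E \<le> (S + T) * (E + 1)"
    unfolding ST by (rule load)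
  from accept_window[OF T this E] have "D * (E - 2) \<le> S * E" .
  moreover have "(\<Sum>r\<leftarrow>map fst cs. ?W x r) \<le> f"
    using f W[of x] by linarith
  ultimately have "accept E D f ((S, \<Sum>r\<leftarrow>map fst cs. ?W x r), (a', ?cs))"
    unfolding accept.simps ..
  then have "(a', ?cs) \<in> set (expand E ?q (D, f, i) (a, cs))"
    using a'[folded S_def] by force
  moreover have "dominates D ?cs (\<lambda>r. y r - x r)"
    unfolding dominates_def
  proof
    show "\<forall>(r, l) \<in> set ?cs. r < D \<longrightarrow> y r - x r \<le> length l"
    proof clarify
      fix r l' assume "(r, l') \<in> set ?cs" and r: "r < D"
      then obtain l where l: "(r, l) \<in> set cs" "l' = drop (if window D ?q r then x r else 0) l"
        by auto
      then have "y r \<le> length l"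
        using dom r by (auto simp: dominates_def)
      then show "y r - x r \<le> length l'"
        using l(2) by (auto intro: diff_le_mono)
    qed
    have big: "big_jobs D ?cs = big_jobs D cs"
      unfolding big_jobs_def map_map
      by (intro arg_cong[of _ _ sum_list] map_cong) (auto simp: window_def)
    have fst: "map fst ?cs = map fst cs"
      by auto
    have "(\<Sum>r\<leftarrow>map fst cs. if r < D then 0 else y r - x r)
        \<le> (\<Sum>r\<leftarrow>map fst cs. if r < D then 0 else y r)"
      by (rule sum_list_mono) auto
    also have "\<dots> \<le> big_jobs D cs"
      using dom by (simp add: dominates_def)
    finally show "(\<Sum>r\<leftarrow>map fst ?cs. if r < D then 0 else y r - x r) \<le> big_jobs D ?cs"
      unfolding big fst .
  qed
  ultimately show ?thesis
    by force
qed

lemma dedup_image: "g ` set (dedup g xs) = g ` set xs"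
  by (induction xs) auto

lemma dedup_complete:
  assumes "x \<in> set xs"
  shows "\<exists>y \<in> set (dedup g xs). g y = g x"
proof -
  have "g x \<in> g ` set (dedup g xs)"
    unfolding dedup_image using assms by (rule imageI)
  then obtain y where "g x = g y" "y \<in> set (dedup g xs)"
    by (rule imageE)
  then show ?thesis
    by (intro bexI[of _ y]) simp_all
qed

lemma length_dedup_card: "length (dedup g xs) = card (g ` set (dedup g xs))"
proof -
  have "distinct (map g (dedup g xs))"
    by (induction xs) auto
  from distinct_card[OF this] show ?thesis
    by simp
qed

lemma expand_shrunk:
  assumes "p \<in> set (expand E q M p0)"
  shows "shrunk (fst M) q (snd p) (snd p0)"
proof -
  obtain D f i where M: "M = (D, f, i)"
    by (cases M)
  obtain a0 cs0 where p0: "p0 = (a0, cs0)"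
    by fastforce
  obtain s k where "((s, k), p) \<in> set (choices D q i a0 cs0)"
    using assms unfolding M p0 by auto
  then show ?thesis
    using choices_shrunk[of s k "fst p" "snd p" D q i a0 cs0] unfolding M p0 by simp
qed

lemma dp_shrunk:
  assumes "p \<in> set (dp E q cs0 ms)" "\<forall>M \<in> set ms. D \<le> fst M"
  shows "shrunk D q (snd p) cs0"
  using assms
proof (induction ms arbitrary: p)
  case Nil
  then show ?case
    by (simp add: shrunk_refl)
next
  case (Cons M ms)
  have "p \<in> set (concat (map (expand E q M) (dp E q cs0 ms)))"
    by (rule subsetD[OF set_dedup Cons.prems(1)[unfolded dp.simps]])
  then obtain p0 where p0: "p0 \<in> set (dp E q cs0 ms)" "p \<in> set (expand E q M p0)"
    by auto
  have "shrunk D q (snd p) (snd p0)"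
    using shrunk_mono[OF expand_shrunk[OF p0(2)]] Cons.prems(2) by simp
  moreover have "shrunk D q (snd p0) cs0"
    using Cons p0(1) by simp
  ultimately show ?case
    by (rule shrunk_trans)
qed

lemma shrunk_mem:
  assumes "shrunk D q cs' cs" "(r, l) \<in> set cs'"
  obtains l0 where "(r, l0) \<in> set cs" "length l \<le> length l0" "set l \<subseteq> set l0"
  using assms unfolding shrunk_def
  by (induction rule: list_all2_induct) auto

lemma dp_complete:
  assumes "sorted (map fst ms)" "2 \<le> E"
    and "\<forall>(D, f, i) \<in> set ms. (\<Sum>r\<leftarrow>map fst cs0. x i r) \<le> f \<and> (\<Sum>r\<leftarrow>map fst cs0. x i r) \<le> n \<and>
      D * E \<le> (\<Sum>r\<leftarrow>map fst cs0. x i r * r) * (E + 1)"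
    and N: "\<forall>(r, l) \<in> set cs0. N r = length l"
    and "\<forall>r \<in> fst ` set cs0. (\<Sum>(D, f, i)\<leftarrow>ms. x i r) \<le> N r"
  shows "\<exists>p \<in> set (dp E ((n + 1) * E) cs0 ms). map fst (snd p) = map fst cs0 \<and>
    (\<forall>D. (\<forall>M \<in> set ms. D \<le> fst M) \<longrightarrow> dominates D (snd p) (\<lambda>r. N r - (\<Sum>(D, f, i)\<leftarrow>ms. x i r)))"
  using assms(1,3,5)
proof (induction ms)
  case Nil
  have "(\<Sum>r\<leftarrow>map fst cs0. if r < D then 0 else N r) = big_jobs D cs0" for D
    using N unfolding big_jobs_def by (induction cs0) auto
  with N show ?case
    by (auto simp: dominates_def)
next
  case (Cons M ms)
  obtain D f i where M: "M = (D, f, i)"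
    by (cases M)
  let ?y = "\<lambda>r. N r - (\<Sum>(D, f, i)\<leftarrow>ms. x i r)"
  have "\<exists>p \<in> set (dp E ((n + 1) * E) cs0 ms). map fst (snd p) = map fst cs0 \<and>
    (\<forall>D. (\<forall>M \<in> set ms. D \<le> fst M) \<longrightarrow> dominates D (snd p) ?y)"
    using Cons.prems by (intro Cons.IH) (auto simp: M)
  then obtain a cs where p: "(a, cs) \<in> set (dp E ((n + 1) * E) cs0 ms)" "map fst cs = map fst cs0"
    "\<forall>M \<in> set ms. D \<le> fst M \<Longrightarrow> dominates D cs ?y"
    by fastforce
  have dom: "dominates D cs ?y"
    using p(3) Cons.prems(1) unfolding M by simp
  have fst_cs: "fst ` set cs = fst ` set cs0"
    using p(2) by (metis list.set_map)
  have xy: "\<forall>r \<in> fst ` set cs. x i r \<le> ?y r"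
    unfolding fst_cs
  proof
    fix r assume "r \<in> fst ` set cs0"
    then have "x i r + (\<Sum>(D, f, i)\<leftarrow>ms. x i r) \<le> N r"
      using Cons.prems(3) unfolding M by auto
    then show "x i r \<le> ?y r"
      by simp
  qed
  have "\<exists>p \<in> set (expand E ((n + 1) * E) (D, f, i) (a, cs)). dominates D (snd p) (\<lambda>r. ?y r - x i r)"
    using Cons.prems(2) assms(2) unfolding M by (intro machine_step[OF dom xy]) (auto simp: p(2))
  then obtain p1 where p1: "p1 \<in> set (expand E ((n + 1) * E) M (a, cs))"
    "dominates D (snd p1) (\<lambda>r. ?y r - x i r)"
    unfolding M by blast
  have "p1 \<in> set (concat (map (expand E ((n + 1) * E) M) (dp E ((n + 1) * E) cs0 ms)))"
    using p1(1) p(1) by force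
  from dedup_complete[OF this, of "key D \<circ> snd"] obtain p2 where
    p2: "p2 \<in> set (dp E ((n + 1) * E) cs0 (M # ms))" "key D (snd p2) = key D (snd p1)"
    unfolding dp.simps M by auto
  have f1: "map fst (snd p1) = map fst cs0"
    using shrunk_map_fst[OF expand_shrunk[OF p1(1)]] p(2) by simp
  have "\<forall>M' \<in> set (M # ms). D \<le> fst M'"
    using Cons.prems(1) unfolding M by simp
  from shrunk_map_fst[OF dp_shrunk[OF p2(1) this]] have f2: "map fst (snd p2) = map fst cs0" .
  have "dominates D (snd p2) (\<lambda>r. ?y r - x i r)"
    using dominates_key[OF p1(2) p2(2)[symmetric]] f1 f2 by simp
  moreover have "(\<lambda>r. ?y r - x i r) = (\<lambda>r. N r - (\<Sum>(D, f, i)\<leftarrow>M # ms. x i r))"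
    by (auto simp: M)
  ultimately have "dominates D' (snd p2) (\<lambda>r. N r - (\<Sum>(D, f, i)\<leftarrow>M # ms. x i r))" if "D' \<le> D" for D'
    using dominates_mono that by simp
  with p2(1) f2 show ?case
    unfolding M by auto
qed

lemma dp_sound:
  assumes "(a, cs) \<in> set (dp E q cs0 ms)" "distinct (map (snd \<circ> snd) ms)"
    and c0: "distinct (concat (map snd cs0))"
    and near: "\<forall>(r, l) \<in> set cs0. \<forall>j \<in> set l. r * E \<le> c j * (E + 1)"
  shows "mset (map fst a) + mset (concat (map snd cs)) = mset (concat (map snd cs0)) \<and>
    snd ` set a \<subseteq> (snd \<circ> snd) ` set ms \<and>
    (\<forall>(D, f, i) \<in> set ms. card {j. (j, i) \<in> set a} \<le> f \<and>
       D * (E - 2) \<le> (\<Sum>j | (j, i) \<in> set a. c j) * (E + 1))"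
  using assms(1,2)
proof (induction ms arbitrary: a cs)
  case (Cons M ms)
  obtain D f i where M: "M = (D, f, i)"
    by (cases M)
  have "(a, cs) \<in> set (concat (map (expand E q M) (dp E q cs0 ms)))"
    by (rule subsetD[OF set_dedup Cons.prems(1)[unfolded dp.simps]])
  then obtain a0 cs1 where p0: "(a0, cs1) \<in> set (dp E q cs0 ms)" "(a, cs) \<in> set (expand E q M (a0, cs1))"
    by auto
  then obtain s k where sk: "((s, k), (a, cs)) \<in> set (choices D q i a0 cs1)" "accept E D f ((s, k), (a, cs))"
    unfolding M by auto
  have IH: "mset (map fst a0) + mset (concat (map snd cs1)) = mset (concat (map snd cs0))"
    "snd ` set a0 \<subseteq> (snd \<circ> snd) ` set ms"
    "\<forall>(D, f, i) \<in> set ms. card {j. (j, i) \<in> set a0} \<le> f \<and>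
       D * (E - 2) \<le> (\<Sum>j | (j, i) \<in> set a0. c j) * (E + 1)"
    using Cons.IH[OF p0(1)] Cons.prems(2) by auto
  have "shrunk 0 q cs1 cs0"
    using dp_shrunk[OF p0(1), of 0] by simp
  then have "\<forall>(r, l) \<in> set cs1. \<forall>j \<in> set l. r * E \<le> c j * (E + 1)"
    using near by (fastforce elim!: shrunk_mem)
  from choices_sound[OF sk(1) this] obtain new where new: "a = map (\<lambda>j. (j, i)) new @ a0" "length new = k"
    "mset new + mset (concat (map snd cs)) = mset (concat (map snd cs1))"
    "s * E \<le> (\<Sum>j\<leftarrow>new. c j) * (E + 1)"
    by blast
  have all: "mset (map fst a) + mset (concat (map snd cs)) = mset (concat (map snd cs0))"
  proof -
    have "mset (map fst a) + mset (concat (map snd cs)) =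
        mset (map fst a0) + (mset new + mset (concat (map snd cs)))"
      unfolding new(1) by (simp add: o_def ac_simps)
    then show ?thesis
      by (simp only: new(3) IH(1))
  qed
  have i: "i \<notin> snd ` set a0"
    using IH(2) Cons.prems(2) unfolding M by auto
  have "distinct (map fst a @ concat (map snd cs))"
    using all c0 mset_eq_imp_distinct_iff[of "map fst a @ concat (map snd cs)" "concat (map snd cs0)"]
    by simp
  then have "distinct new"
    unfolding new(1) by (simp add: o_def)
  have Ji: "{j. (j, i) \<in> set a} = set new"
    using i unfolding new(1) by force
  have Jn: "{j. (j, i') \<in> set a} = {j. (j, i') \<in> set a0}" if "i' \<noteq> i" for i'
    using that unfolding new(1) by auto
  have Mi: "card {j. (j, i) \<in> set a} \<le> f \<and> D * (E - 2) \<le> (\<Sum>j | (j, i) \<in> set a. c j) * (E + 1)"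
    using sk(2) new(2,4) \<open>distinct new\<close> unfolding Ji
    by (simp add: distinct_card sum_list_distinct_conv_sum_set)
  have ne: "i' \<noteq> i" if "(D', f', i') \<in> set ms" for D' f' i'
    using Cons.prems(2) that unfolding M by force
  have "\<forall>(D, f, i) \<in> set (M # ms). card {j. (j, i) \<in> set a} \<le> f \<and>
       D * (E - 2) \<le> (\<Sum>j | (j, i) \<in> set a. c j) * (E + 1)"
  proof (rule ballI, clarify)
    fix D' f' i' assume m: "(D', f', i') \<in> set (M # ms)"
    show "card {j. (j, i') \<in> set a} \<le> f' \<and>
       D' * (E - 2) \<le> (\<Sum>j | (j, i') \<in> set a. c j) * (E + 1)"
    proof (cases "i' = i")
      case True
      then have "(D', f', i') = (D, f, i)"
        using m ne unfolding M by auto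
      then show ?thesis
        using Mi by simp
    next
      case False
      then have "(D', f', i') \<in> set ms"
        using m unfolding M by auto
      then show ?thesis
        using IH(3) unfolding Jn[OF False] by blast
    qed
  qed
  moreover have "snd ` set a \<subseteq> (snd \<circ> snd) ` set (M # ms)"
    using IH(2) unfolding new(1) M by auto
  ultimately show ?case
    using all by blast
qed auto

section \<open>The number of states\<close>

definition window_count :: "nat \<Rightarrow> nat \<Rightarrow> cls list \<Rightarrow> nat" where
  "window_count D q cs = length (filter (window D q) (map fst cs))"

lemma length_concat_le:
  "(\<And>x. x \<in> set xs \<Longrightarrow> length (g x) \<le> B) \<Longrightarrow> length (concat (map g xs)) \<le> length xs * B"
  by (induction xs) (auto intro: add_mono)

lemma length_choices:
  assumes "\<forall>(r, l) \<in> set cs. length l \<le> n"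
  shows "length (choices D q i a cs) \<le> Suc (length cs) * (n + 1) ^ window_count D q cs"
  using assms
proof (induction cs)
  case Nil
  then show ?case
    by (simp add: window_count_def)
next
  case (Cons c cs)
  obtain r l where c: "c = (r, l)"
    by fastforce
  define B where "B = (if window D q r then n + 1 else 1)"
  have "length (class_choices D q i r l t) \<le> B" for t
    using length_class_choices(2)[of D q i r l t] Cons.prems
    by (cases l) (auto simp: B_def c)
  then have "length (choices D q i a (c # cs)) \<le> 1 + length (choices D q i a cs) * B"
    using length_concat_le[of "choices D q i a cs" "class_choices D q i r l" B]
    by (simp add: c del: length_concat)
  also have "\<dots> \<le> 1 + Suc (length cs) * (n + 1) ^ window_count D q cs * B"
    using Cons by (intro add_left_mono mult_le_mono1) auto
  also have "\<dots> = 1 + Suc (length cs) * (n + 1) ^ window_count D q (c # cs)"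
  proof -
    have "(n + 1) ^ window_count D q (c # cs) = (n + 1) ^ window_count D q cs * B"
      by (simp add: window_count_def B_def c)
    then show ?thesis
      by (simp only: mult.assoc)
  qed
  also have "\<dots> \<le> (n + 1) ^ window_count D q (c # cs) +
      Suc (length cs) * (n + 1) ^ window_count D q (c # cs)"
    by (intro add_right_mono one_le_power) simp
  also have "\<dots> = Suc (length (c # cs)) * (n + 1) ^ window_count D q (c # cs)"
    by (simp only: mult_Suc list.size add_0_right add_Suc_right)
  finally show ?case .
qed

lemma listset_card:
  assumes "\<forall>A \<in> set As. finite A"
  shows "finite (listset As) \<and> card (listset As) = prod_list (map card As)"
  using assms
proof (induction As)
  case (Cons A As)
  have "listset (A # As) = (\<lambda>(x, xs). x # xs) ` (A \<times> listset As)"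
    by (auto simp: set_Cons_def)
  moreover have "inj_on (\<lambda>(x, xs). x # xs) (A \<times> listset As)"
    by (auto simp: inj_on_def)
  ultimately show ?case
    using Cons by (simp add: card_image card_cartesian_product)
qed simp

lemma length_dp:
  assumes "sorted (map fst ms)" "\<forall>(r, l) \<in> set cs0. length l \<le> n" "job_count cs0 \<le> n"
    and W: "\<And>D. window_count D q cs0 \<le> W"
  shows "length (dp E q cs0 ms) \<le> (n + 1) ^ (W + 1)"
proof (cases ms)
  case Nil
  have "1 \<le> (n + 1) ^ (W + 1)"
    by (rule one_le_power) simp
  then show ?thesis
    using Nil by simp
next
  case (Cons M ms')
  define D where "D = fst M"
  let ?g = "key D \<circ> snd"
  define A where "A = (\<lambda>(r, l :: nat list). if r < D then if window D q r then {..n} else {length l} else {0})"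
  let ?K = "(\<lambda>(x, xs). x # xs) ` ({..n} \<times> listset (map A cs0))"
  have keys: "key D (snd p) \<in> ?K" if "p \<in> set (dp E q cs0 ms)" for p
  proof -
    have s: "shrunk D q (snd p) cs0"
      using dp_shrunk[OF that, of D] assms(1) unfolding Cons D_def by auto
    have "map (\<lambda>(r, l). if r < D then length l else 0) (snd p) \<in> listset (map A cs0)"
      using s[unfolded shrunk_def] assms(2)
      by (induction rule: list_all2_induct)
        (auto simp: A_def set_Cons_def window_def not_less split: if_splits)
    moreover have "big_jobs D (snd p) \<le> job_count cs0"
      using s[unfolded shrunk_def]
      by (induction rule: list_all2_induct) (auto simp: big_jobs_def job_count_def split: if_splits)
    ultimately show ?thesis
      using assms(3) by (auto simp: key_def)
  qed
  have finA: "\<forall>X \<in> set (map A cs0). finite X"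
    by (auto simp: A_def)
  have fin: "finite (listset (map A cs0))" and card: "card (listset (map A cs0)) = prod_list (map card (map A cs0))"
    using listset_card[of "map A cs0"] finA by blast+
  have "prod_list (map card (map A cs0)) = (n + 1) ^ window_count D q cs0"
    by (induction cs0) (auto simp: A_def window_count_def window_def)
  also have "\<dots> \<le> (n + 1) ^ W"
    using W by (intro power_increasing) auto
  finally have cardK: "card ?K \<le> (n + 1) ^ (W + 1)"
    using fin card card_image_le[of "{..n} \<times> listset (map A cs0)" "\<lambda>(x, xs). x # xs"]
    by (simp add: card_cartesian_product) (meson add_mono le_trans mult_le_mono2)
  have "length (dp E q cs0 ms) = card (?g ` set (dp E q cs0 ms))"
    unfolding Cons dp.simps D_def by (rule length_dedup_card)
  also have "\<dots> \<le> card ?K"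
    using keys fin by (intro card_mono) auto
  finally show ?thesis
    using cardK by simp
qed

text \<open>Separated sizes have distinct integer parts of their logarithms to base \<open>1 + 1/E\<close>.\<close>

lemma window_count_le:
  assumes "distinct (map fst cs)" "\<forall>r \<in> fst ` set cs. 0 < r" "0 < E" "0 < q"
    and sep: "\<forall>r \<in> fst ` set cs. \<forall>r' \<in> fst ` set cs. r \<noteq> r' \<longrightarrow> \<not> near E r r'"
  shows "real (window_count D q cs) \<le> log (1 + 1 / real E) (real q) + 2"
proof -
  let ?b = "1 + 1 / real E"
  let ?A = "set (filter (window D q) (map fst cs))"
  let ?g = "\<lambda>r. \<lfloor>log ?b (real r)\<rfloor>"
  have b: "1 < ?b"
    using assms(3) by simp
  have b0: "0 < ?b"
    using b by linarith
  have count: "window_count D q cs = card ?A"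
    using assms(1) unfolding window_count_def by (metis distinct_card distinct_filter)
  have less: "?g r < ?g r'" if r: "r \<in> ?A" "r' \<in> ?A" "r < r'" for r r'
  proof -
    have mem: "r \<in> fst ` set cs" "r' \<in> fst ` set cs"
      using r by auto
    have "\<not> near E r r'"
      using sep mem less_imp_neq[OF r(3)] by blast
    have "0 < r"
      using assms(2) mem by blast
    have "r * E \<le> r' * (E + 1)"
      using r(3) by (intro mult_le_mono) auto
    then have "r * (E + 1) < r' * E"
      using \<open>\<not> near E r r'\<close> unfolding near_def by auto
    then have "real (r * (E + 1)) < real (r' * E)"
      by (simp only: of_nat_less_iff)
    then have "real r * ?b < real r'"
      using assms(3) by (simp add: field_simps)
    then have "log ?b (real r * ?b) < log ?b (real r')"
      using b \<open>0 < r\<close> r(3) by (subst log_less_cancel_iff) (simp_all add: add_pos_nonneg)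
    moreover have "log ?b (real r * ?b) = log ?b (real r) + log ?b ?b"
      using b0 \<open>0 < r\<close> by (intro log_mult_pos) simp_all
    moreover have "log ?b ?b = 1"
      using b0 b by (intro log_eq_one) linarith+
    ultimately have "log ?b (real r) + 1 < log ?b (real r')"
      by (simp only:)
    then show ?thesis
      by linarith
  qed
  have inj: "inj_on ?g ?A"
    using less by (intro inj_onI) (metis less_irrefl linorder_neqE_nat)
  show ?thesis
  proof (cases "?A = {}")
    case True
    have "0 \<le> log ?b (real q)"
      using b assms(4) by (intro zero_le_log_cancel_iff[THEN iffD2]) auto
    then show ?thesis
      unfolding count True by simp
  next
    case False
    then have "0 < D"
      by (auto simp: window_def)
    let ?lo = "\<lfloor>log ?b (real D) - log ?b (real q)\<rfloor>" and ?hi = "\<lfloor>log ?b (real D)\<rfloor>"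
    have "?g ` ?A \<subseteq> {?lo..?hi}"
    proof
      fix z assume "z \<in> ?g ` ?A"
      then obtain r where r: "r \<in> ?A" "z = ?g r"
        by blast
      then have "0 < r" "r < D" "D < r * q"
        using assms(2) by (auto simp: window_def)
      have "real D \<le> real (r * q)"
        using \<open>D < r * q\<close> by (simp only: of_nat_le_iff less_imp_le)
      then have "log ?b (real D) \<le> log ?b (real (r * q))"
        using b \<open>0 < D\<close> by (intro log_mono) simp_all
      also have "\<dots> = log ?b (real r) + log ?b (real q)"
        using b \<open>0 < r\<close> assms(4) by (simp add: log_mult)
      finally have "?lo \<le> z"
        unfolding r(2) by (intro floor_mono) simp
      moreover have "z \<le> ?hi"
        unfolding r(2) using b \<open>0 < r\<close> \<open>r < D\<close> by (intro floor_mono) simp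
      ultimately show "z \<in> {?lo..?hi}"
        by simp
    qed
    from card_mono[OF finite_atLeastAtMost_int this] have "card ?A \<le> nat (?hi - ?lo + 1)"
      unfolding card_image[OF inj] card_atLeastAtMost_int .
    moreover have "?lo \<le> ?hi"
      using b assms(4) by (intro floor_mono) simp
    ultimately have "real (card ?A) \<le> real_of_int (?hi - ?lo + 1)"
      by linarith
    then show ?thesis
      unfolding count by linarith
  qed
qed

section \<open>Classes and scaling\<close>

lemma near_refl: "near E c c"
  by (simp add: near_def)

lemma near_sym: "near E c r \<longleftrightarrow> near E r c"
  by (auto simp: near_def)

lemma map_fst_add_job:
  "map fst (add_job E c j cs) =
    (if \<exists>r \<in> fst ` set cs. near E c r then map fst cs else map fst cs @ [c])"
  by (induction E c j cs rule: add_job.induct) auto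

lemma add_job_all:
  assumes "\<forall>(r, l) \<in> set cs. \<forall>x \<in> set l. P x r" "\<And>r. near E c r \<Longrightarrow> P j r"
  shows "\<forall>(r, l) \<in> set (add_job E c j cs). \<forall>x \<in> set l. P x r"
  using assms by (induction E c j cs rule: add_job.induct) (auto simp: near_refl)

lemma mset_add_job:
  "mset (concat (map snd (add_job E c j cs))) = add_mset j (mset (concat (map snd cs)))"
  by (induction E c j cs rule: add_job.induct) auto

lemma mset_classes:
  "mset (concat (map snd (classes E cs j))) = mset [j..<j + length cs]"
proof (induction E cs j rule: classes.induct)
  case (2 E c xs j)
  have "[j..<j + length (c # xs)] = j # [j + 1..<j + 1 + length xs]"
    by (simp add: upt_conv_Cons del: upt_Suc)
  then show ?case
    using 2 by (simp add: mset_add_job del: upt_Suc)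
qed simp

lemma classes_near:
  "\<forall>(r, l) \<in> set (classes E cs j). \<forall>x \<in> set l. j \<le> x \<and> near E (cs ! (x - j)) r"
proof (induction E cs j rule: classes.induct)
  case (2 E c xs j)
  have shift: "(c # xs) ! (x - j) = xs ! (x - (j + 1))" if "j + 1 \<le> x" for x
    using that by (simp add: nth_Cons' diff_commute)
  show ?case
    unfolding classes.simps
  proof (rule add_job_all)
    show "\<forall>(r, l) \<in> set (classes E xs (j + 1)). \<forall>x \<in> set l. j \<le> x \<and> near E ((c # xs) ! (x - j)) r"
      using 2 shift by fastforce
  qed simp
qed simp

lemma classes_separated:
  "distinct (map fst (classes E cs j)) \<and>
   (\<forall>r \<in> fst ` set (classes E cs j). \<forall>r' \<in> fst ` set (classes E cs j). r \<noteq> r' \<longrightarrow> \<not> near E r r')"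
proof (induction E cs j rule: classes.induct)
  case (2 E c xs j)
  show ?case
  proof (cases "\<exists>r \<in> fst ` set (classes E xs (j + 1)). near E c r")
    case True
    then have "map fst (classes E (c # xs) j) = map fst (classes E xs (j + 1))"
      by (simp add: map_fst_add_job)
    with 2 show ?thesis
      by (metis list.set_map)
  next
    case False
    then have "map fst (classes E (c # xs) j) = map fst (classes E xs (j + 1)) @ [c]"
      by (simp add: map_fst_add_job)
    moreover from this have "fst ` set (classes E (c # xs) j) = insert c (fst ` set (classes E xs (j + 1)))"
      by (metis list.set_map Un_insert_right append_Nil2 list.simps(15) set_append set_empty2 sup_bot.right_neutral)
    ultimately show ?thesis
      using 2 False near_refl near_sym by (auto simp del: classes.simps)
  qed
qed simp

lemma tagged_eq:
  "tagged L ms i = map (\<lambda>k. (scale L (fst (ms ! k)), snd (ms ! k), i + k)) [0..<length ms]"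
proof (induction L ms i rule: tagged.induct)
  case (2 L d f ms i)
  then show ?case
    by (simp add: upt_conv_Cons map_Suc_upt[symmetric] o_def del: upt_Suc)
qed simp

lemma num_den:
  assumes "0 < r"
  shows "0 < num r" "0 < den r" "r = of_nat (num r) / of_nat (den r)"
proof -
  obtain p q where pq: "quotient_of r = (p, q)"
    by fastforce
  have q: "0 < q" and r: "r = of_int p / of_int q"
    using quotient_of_denom_pos[OF pq] quotient_of_div[OF pq] by simp_all
  have "0 < p"
    using assms q unfolding r by (simp add: zero_less_divide_iff)
  then show "0 < num r" "0 < den r" "r = of_nat (num r) / of_nat (den r)"
    using q r pq by (simp_all add: num_def den_def)
qed

lemma of_nat_scale:
  assumes "0 < r" "den r dvd L"
  shows "of_nat (scale L r) = r * of_nat L"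
proof -
  obtain k where k: "L = den r * k"
    using assms(2) by blast
  have "den r \<noteq> 0"
    using num_den(2)[OF assms(1)] by simp
  then show ?thesis
    using num_den(3)[OF assms(1)] unfolding scale_def k by (simp add: field_simps)
qed

lemma dvd_foldr_mult:
  fixes h :: "'a \<Rightarrow> nat"
  shows "p dvd foldr (\<lambda>x a. h x * a) xs p"
    "x \<in> set xs \<Longrightarrow> h x dvd foldr (\<lambda>x a. h x * a) xs p"
  by (induction xs) auto

lemma foldr_mult_pos:
  fixes h :: "'a \<Rightarrow> nat"
  shows "\<forall>x \<in> set xs. 0 < h x \<Longrightarrow> 0 < p \<Longrightarrow> 0 < foldr (\<lambda>x a. h x * a) xs p"
  by (induction xs) auto

lemma le_power_bits: "x \<le> 2 ^ bits x"
proof (cases "x = 0")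
  case False
  have "x < 2 ^ floorlog 2 x"
    using floorlog_bounds[of x 2] False by simp
  then show ?thesis
    by (simp add: bits_def)
qed simp

lemma foldr_mult_le:
  fixes h :: "'a \<Rightarrow> nat"
  shows "foldr (\<lambda>x a. h x * a) xs p \<le> 2 ^ (\<Sum>x\<leftarrow>xs. bits (h x)) * p"
proof (induction xs)
  case (Cons x xs)
  then show ?case
    using mult_le_mono[OF le_power_bits[of "h x"] Cons] by (simp add: power_add mult.assoc)
qed simp

lemma val_size_enc_list: "val_size (enc_list e xs) = Suc (\<Sum>x\<leftarrow>xs. Suc (val_size (e x)))"
  by (induction xs) (auto simp: bits_def floorlog_def)



section \<open>Quasi-polynomial bounds\<close>

lemma quasi_polynomialE:
  assumes "quasi_polynomial T"
  obtains C k where "0 \<le> C" "\<And>N. 2 \<le> N \<Longrightarrow> real (T N) \<le> 2 powr (C * log 2 (real N) ^ k)"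
proof -
  obtain C k where C: "\<And>N. 2 \<le> N \<Longrightarrow> real (T N) \<le> 2 powr (C * log 2 (real N) ^ k)"
    using assms unfolding quasi_polynomial_def by blast
  show thesis
  proof (rule that[of "max C 0" k])
    fix N :: nat assume "2 \<le> N"
    have "C * log 2 (real N) ^ k \<le> max C 0 * log 2 (real N) ^ k"
      using \<open>2 \<le> N\<close> by (intro mult_right_mono) auto
    then show "real (T N) \<le> 2 powr (max C 0 * log 2 (real N) ^ k)"
      using C[OF \<open>2 \<le> N\<close>] by (meson order_trans powr_mono one_le_numeral)
  qed simp
qed

lemma quasi_polynomial_mult:
  assumes "quasi_polynomial S" "quasi_polynomial T"
  shows "quasi_polynomial (\<lambda>N. S N * T N)"
proof -
  obtain C k where C: "0 \<le> C" "\<And>N. 2 \<le> N \<Longrightarrow> real (S N) \<le> 2 powr (C * log 2 (real N) ^ k)"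
    using quasi_polynomialE[OF assms(1)] by blast
  obtain C' k' where C': "0 \<le> C'" "\<And>N. 2 \<le> N \<Longrightarrow> real (T N) \<le> 2 powr (C' * log 2 (real N) ^ k')"
    using quasi_polynomialE[OF assms(2)] by blast
  show ?thesis
    unfolding quasi_polynomial_def
  proof (intro exI allI impI)
    fix N :: nat assume N: "2 \<le> N"
    let ?L = "log 2 (real N)"
    have L: "1 \<le> ?L"
      using N by simp
    have "real (S N * T N) \<le> 2 powr (C * ?L ^ k) * 2 powr (C' * ?L ^ k')"
      using mult_mono[OF C(2)[OF N] C'(2)[OF N]] by simp
    also have "\<dots> = 2 powr (C * ?L ^ k + C' * ?L ^ k')"
      by (simp add: powr_add)
    also have "\<dots> \<le> 2 powr ((C + C') * ?L ^ (max k k'))"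
      using C(1) C'(1) L
      by (intro powr_mono) (simp_all add: distrib_right add_mono mult_left_mono power_increasing)
    finally show "real (S N * T N) \<le> 2 powr ((C + C') * ?L ^ (max k k'))" .
  qed
qed

lemma quasi_polynomial_mono:
  assumes "quasi_polynomial T" "\<And>N. 2 \<le> N \<Longrightarrow> S N \<le> T N"
  shows "quasi_polynomial S"
  using assms unfolding quasi_polynomial_def by (meson of_nat_mono order_trans)

lemma quasi_polynomial_const: "quasi_polynomial (\<lambda>_. c)"
  unfolding quasi_polynomial_def
proof (intro exI allI impI)
  fix N :: nat
  have "real c \<le> 2 ^ c"
    using less_exp[of c] by (simp add: of_nat_less_two_power less_imp_le)
  then show "real c \<le> 2 powr (real c * log 2 (real N) ^ 0)"
    by (simp add: powr_realpow)
qed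

lemma quasi_polynomial_id: "quasi_polynomial (\<lambda>N. N)"
  unfolding quasi_polynomial_def
  by (intro exI[of _ 1]) simp

lemma quasi_polynomial_add:
  assumes "quasi_polynomial S" "quasi_polynomial T"
  shows "quasi_polynomial (\<lambda>N. S N + T N)"
proof -
  have "quasi_polynomial (\<lambda>N. max 1 (U N))" if U: "quasi_polynomial U" for U
  proof -
    obtain C k where C: "0 \<le> C" "\<And>N. 2 \<le> N \<Longrightarrow> real (U N) \<le> 2 powr (C * log 2 (real N) ^ k)"
      using quasi_polynomialE[OF U] by blast
    have "1 \<le> 2 powr (C * log 2 (real N) ^ k)" if "2 \<le> N" for N :: nat
      using C(1) that by (intro ge_one_powr_ge_zero) auto
    then show ?thesis
      using C(2) unfolding quasi_polynomial_def by (intro exI[of _ C] exI[of _ k]) (auto simp: max_def)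
  qed
  then have "quasi_polynomial (\<lambda>N. 2 * (max 1 (S N) * max 1 (T N)))"
    using assms by (intro quasi_polynomial_mult quasi_polynomial_const) auto
  then show ?thesis
  proof (rule quasi_polynomial_mono)
    fix N
    have "a + b \<le> 2 * (a * b)" if "1 \<le> a" "1 \<le> b" for a b :: nat
      using mult_le_mono1[OF that(1), of b] mult_le_mono2[OF that(2), of a] by linarith
    from this[of "max 1 (S N)" "max 1 (T N)"] show "S N + T N \<le> 2 * (max 1 (S N) * max 1 (T N))"
      by linarith
  qed
qed

lemma quasi_polynomial_Suc: "quasi_polynomial T \<Longrightarrow> quasi_polynomial (\<lambda>N. Suc (T N))"
  using quasi_polynomial_add[of T "\<lambda>_. 1"] quasi_polynomial_const[of 1] by simp

definition window_bound :: "nat \<Rightarrow> nat \<Rightarrow> nat" where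
  "window_bound E N = nat \<lceil>log (1 + 1 / real E) (real ((N + 1) * E)) + 2\<rceil>"

lemma quasi_polynomial_window:
  assumes "0 < E"
  shows "quasi_polynomial (\<lambda>N. (N + 1) ^ window_bound E N)"
proof -
  define b where "b = 1 + 1 / real E"
  define K where "K = 1 / log 2 b"
  have b: "1 < b"
    using assms by (simp add: b_def)
  have K: "0 < K"
    unfolding K_def using b by simp
  have conv: "log b x = K * log 2 x" if "0 < x" for x
    using b that unfolding K_def by (simp add: log_def field_simps)
  define A where "A = 2 * K + K * log 2 (real E) + 3"
  have lE: "0 \<le> log 2 (real E)"
    using assms by simp
  have A: "0 \<le> A"
    using K lE by (simp add: A_def)
  have "real ((N + 1) ^ window_bound E N) \<le> 2 powr (2 * A * log 2 (real N) ^ 2)" if N: "2 \<le> N" for N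
  proof -
    let ?L = "log 2 (real N)"
    have L: "1 \<le> ?L"
      using N by simp
    have "real (N + 1) \<le> real N ^ 2"
    proof -
      have "N + 1 \<le> N * N"
        using N mult_le_mono1[OF N, of N] by linarith
      then show ?thesis
        unfolding power2_eq_square by (metis of_nat_le_iff of_nat_mult)
    qed
    then have "log 2 (real (N + 1)) \<le> log 2 (real N ^ 2)"
      using N by (intro log_mono) auto
    also have "\<dots> = 2 * ?L"
      using N by (simp add: log_nat_power)
    finally have N1: "log 2 (real (N + 1)) \<le> 2 * ?L" .
    have "log b (real ((N + 1) * E)) = K * (log 2 (real (N + 1)) + log 2 (real E))"
    proof -
      have "log 2 (real ((N + 1) * E)) = log 2 (real (N + 1)) + log 2 (real E)"
        unfolding of_nat_mult using assms by (intro log_mult_pos) simp_all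
      moreover have "0 < real ((N + 1) * E)"
        unfolding of_nat_mult using assms by (intro mult_pos_pos) simp_all
      ultimately show ?thesis
        using conv by metis
    qed
    also have "\<dots> \<le> K * (2 * ?L + log 2 (real E) * ?L)"
      using N1 K L lE mult_left_mono[OF L lE] by (intro mult_left_mono add_mono) auto
    finally have "log b (real ((N + 1) * E)) + 3 \<le> A * ?L"
      using L unfolding A_def by (simp add: algebra_simps)
    moreover have "0 \<le> log b (real ((N + 1) * E))"
    proof -
      have "1 * 1 \<le> real (N + 1) * real E"
        using assms by (intro mult_mono) simp_all
      then show ?thesis
        unfolding of_nat_mult using b by (intro zero_le_log_cancel_iff[THEN iffD2]) linarith+
    qed
    ultimately have W: "real (window_bound E N) \<le> A * ?L"
      unfolding window_bound_def b_def[symmetric] by linarith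
    have "real ((N + 1) ^ window_bound E N) = real (N + 1) powr real (window_bound E N)"
      unfolding of_nat_power by (rule powr_realpow[symmetric]) simp
    also have "\<dots> = (2 powr log 2 (real (N + 1))) powr real (window_bound E N)"
      by (subst powr_log_cancel) simp_all
    also have "\<dots> = 2 powr (real (window_bound E N) * log 2 (real (N + 1)))"
      by (simp only: powr_powr mult.commute)
    also have "\<dots> \<le> 2 powr ((A * ?L) * (2 * ?L))"
      using W N1 A L by (intro powr_mono mult_mono) auto
    finally show ?thesis
      by (simp add: power2_eq_square algebra_simps)
  qed
  then show ?thesis
    unfolding quasi_polynomial_def by blast
qed

section \<open>The algorithm on an instance\<close>

definition common_denominator :: "alloc_instance \<Rightarrow> nat" where
  "common_denominator I =
     foldr (\<lambda>x a. den (fst x) * a) (machines I) (foldr (\<lambda>x a. den x * a) (jobs I) 1)"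

definition scaled_jobs :: "alloc_instance \<Rightarrow> nat list" where
  "scaled_jobs I = map (scale (common_denominator I)) (jobs I)"

definition sorted_machines :: "alloc_instance \<Rightarrow> (nat \<times> nat \<times> nat) list" where
  "sorted_machines I = sort_key fst (tagged (common_denominator I) (machines I) 0)"

definition job_classes :: "nat \<Rightarrow> alloc_instance \<Rightarrow> cls list" where
  "job_classes E I = classes E (scaled_jobs I) 0"

definition final_states :: "nat \<Rightarrow> alloc_instance \<Rightarrow> partial list" where
  "final_states E I = dp E ((length (jobs I) + 1) * E) (job_classes E I) (sorted_machines I)"

lemma job_count_eq: "job_count cs = length (concat (map snd cs))"
  unfolding job_count_def by (induction cs) auto

lemma job_classes_mset: "mset (concat (map snd (job_classes E I))) = mset [0..<length (jobs I)]"
  using mset_classes[of E "scaled_jobs I" 0] by (simp add: job_classes_def scaled_jobs_def)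

lemma job_classes_distinct: "distinct (concat (map snd (job_classes E I)))"
  using mset_eq_imp_distinct_iff[OF job_classes_mset[of E I]] by simp

lemma job_classes_set: "set (concat (map snd (job_classes E I))) = {..<length (jobs I)}"
  using mset_eq_setD[OF job_classes_mset[of E I]] by auto

lemma job_classes_count: "job_count (job_classes E I) = length (jobs I)"
  using mset_eq_length[OF job_classes_mset[of E I]] unfolding job_count_eq by simp

lemma job_classes_near:
  assumes "(r, l) \<in> set (job_classes E I)" "j \<in> set l"
  shows "j < length (jobs I)" "near E (scaled_jobs I ! j) r"
proof -
  show "j < length (jobs I)"
    using job_classes_set[of E I] assms by fastforce
  show "near E (scaled_jobs I ! j) r"
    using classes_near[of E "scaled_jobs I" 0] assms unfolding job_classes_def by fastforce
qed

lemma set_sorted_machines: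
  "set (sorted_machines I) =
    (\<lambda>i. (scale (common_denominator I) (demand I i), card_bound I i, i)) ` {..<length (machines I)}"
  unfolding sorted_machines_def tagged_eq by auto

lemma sorted_sorted_machines: "sorted (map fst (sorted_machines I))"
  unfolding sorted_machines_def by simp

lemma sum_sorted_machines:
  "(\<Sum>(D, f, i)\<leftarrow>sorted_machines I. g i) = (\<Sum>i<length (machines I). g i)"
proof -
  have "(\<Sum>(D, f, i)\<leftarrow>sorted_machines I. g i) =
      (\<Sum>(D, f, i)\<leftarrow>tagged (common_denominator I) (machines I) 0. g i)"
    unfolding sorted_machines_def sum_mset_sum_list[symmetric] by simp
  also have "\<dots> = (\<Sum>i\<leftarrow>[0..<length (machines I)]. g i)"
    unfolding tagged_eq by (simp add: o_def)
  also have "\<dots> = (\<Sum>i<length (machines I). g i)"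
    by (simp add: sum_list_distinct_conv_sum_set lessThan_atLeast0)
  finally show ?thesis .
qed

lemma distinct_sorted_machines: "distinct (map (snd \<circ> snd) (sorted_machines I))"
proof -
  have "mset (map (snd \<circ> snd) (sorted_machines I)) = mset [0..<length (machines I)]"
    unfolding sorted_machines_def by (simp add: tagged_eq multiset.map_comp o_def)
  from mset_eq_imp_distinct_iff[OF this] show ?thesis
    by simp
qed

lemma common_denominator:
  assumes "valid_instance I"
  shows "0 < common_denominator I"
    and "i < length (machines I) \<Longrightarrow> den (demand I i) dvd common_denominator I"
    and "j < length (jobs I) \<Longrightarrow> den (capacity I j) dvd common_denominator I"
proof -
  let ?p = "foldr (\<lambda>x a. den x * a) (jobs I) 1"
  have jobs: "\<forall>x \<in> set (jobs I). 0 < den x"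
    using assms num_den(2) unfolding valid_instance_def by (metis in_set_conv_nth)
  have machines: "\<forall>x \<in> set (machines I). 0 < den (fst x)"
    using assms num_den(2) unfolding valid_instance_def by (metis in_set_conv_nth)
  show "0 < common_denominator I"
    unfolding common_denominator_def
    by (intro foldr_mult_pos[OF machines] foldr_mult_pos[OF jobs]) simp
  show "den (demand I i) dvd common_denominator I" if "i < length (machines I)"
    unfolding common_denominator_def by (rule dvd_foldr_mult(2)) (simp add: that)
  have "?p dvd common_denominator I"
    unfolding common_denominator_def by (rule dvd_foldr_mult(1))
  moreover have "den (capacity I j) dvd ?p" if "j < length (jobs I)"
    by (rule dvd_foldr_mult(2)) (simp add: that)
  ultimately show "den (capacity I j) dvd common_denominator I" if "j < length (jobs I)"
    using that dvd_trans by blast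
qed

lemma scaled_load:
  assumes "valid_instance I" "A \<subseteq> {..<length (jobs I)}"
  shows "of_nat (\<Sum>j\<in>A. scaled_jobs I ! j) = (\<Sum>j\<in>A. capacity I j) * of_nat (common_denominator I)"
  unfolding of_nat_sum sum_distrib_right
proof (rule sum.cong)
  fix j assume "j \<in> A"
  then have j: "j < length (jobs I)"
    using assms(2) by auto
  then have "0 < capacity I j"
    using assms(1) by (simp add: valid_instance_def)
  from of_nat_scale[OF this common_denominator(3)[OF assms(1) j]]
  show "of_nat (scaled_jobs I ! j) = capacity I j * of_nat (common_denominator I)"
    using j by (simp add: scaled_jobs_def)
qed simp

lemma scaled_demand:
  assumes "valid_instance I" "i < length (machines I)"
  shows "of_nat (scale (common_denominator I) (demand I i)) = demand I i * of_nat (common_denominator I)"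
  using assms by (intro of_nat_scale common_denominator(2)) (auto simp: valid_instance_def)

lemma final_states_sound:
  assumes "valid_instance I" "(a, cs) \<in> set (final_states E I)"
  defines "n \<equiv> length (jobs I)"
  shows "distinct (map fst a)" "fst ` set a \<subseteq> {..<n}" "snd ` set a \<subseteq> {..<length (machines I)}"
    "length a \<le> n"
    "respects_cardinalities I (map (map_of a) [0..<n])"
    "i < length (machines I) \<Longrightarrow>
      demand I i * of_nat (E - 2) \<le> load I (map (map_of a) [0..<n]) i * of_nat (E + 1)"
proof -
  let ?L = "common_denominator I"
  let ?J = "\<lambda>i. {j. (j, i) \<in> set a}"
  have near: "\<forall>(r, l) \<in> set (job_classes E I). \<forall>j \<in> set l. r * E \<le> scaled_jobs I ! j * (E + 1)"
    using job_classes_near(2) unfolding near_def by blast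
  have sound: "mset (map fst a) + mset (concat (map snd cs)) = mset (concat (map snd (job_classes E I)))"
    "snd ` set a \<subseteq> (snd \<circ> snd) ` set (sorted_machines I)"
    "\<forall>(D, f, i) \<in> set (sorted_machines I). card (?J i) \<le> f \<and>
       D * (E - 2) \<le> (\<Sum>j\<in>?J i. scaled_jobs I ! j) * (E + 1)"
    using dp_sound[OF assms(2)[unfolded final_states_def] distinct_sorted_machines job_classes_distinct near]
    by simp_all
  have m: "mset (map fst a @ concat (map snd cs)) = mset [0..<n]"
    using sound(1) by (simp add: job_classes_mset n_def)
  show dist: "distinct (map fst a)"
    using mset_eq_imp_distinct_iff[OF m] by simp
  have "set (map fst a @ concat (map snd cs)) = {..<n}"
    using mset_eq_setD[OF m] by auto
  then show fst_a: "fst ` set a \<subseteq> {..<n}"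
    by auto
  show "length a \<le> n"
    using mset_eq_length[OF m] by simp
  show snd_a: "snd ` set a \<subseteq> {..<length (machines I)}"
    using sound(2) unfolding set_sorted_machines by auto
  let ?\<sigma> = "map (map_of a) [0..<n]"
  have on: "jobs_on ?\<sigma> i = ?J i" for i
    using fst_a dist unfolding jobs_on_def by (auto simp: map_of_eq_Some_iff)
  have J: "card (?J i) \<le> card_bound I i"
    "scale ?L (demand I i) * (E - 2) \<le> (\<Sum>j\<in>?J i. scaled_jobs I ! j) * (E + 1)"
    if "i < length (machines I)" for i
    using sound(3) that unfolding set_sorted_machines by auto
  show "respects_cardinalities I ?\<sigma>"
    unfolding respects_cardinalities_def on
  proof (intro conjI allI impI)
    show "i < length (machines I)" if some: "Some i \<in> set ?\<sigma>" for i
    proof -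
      obtain j where "Some i = map_of a j"
        using some unfolding set_map by blast
      then have "(j, i) \<in> set a"
        by (intro map_of_SomeD) simp
      then show ?thesis
        using snd_a by force
    qed
  qed (use J(1) in \<open>simp_all add: n_def\<close>)
  show "demand I i * of_nat (E - 2) \<le> load I ?\<sigma> i * of_nat (E + 1)" if i: "i < length (machines I)"
  proof -
    have sub: "?J i \<subseteq> {..<length (jobs I)}"
      using fst_a unfolding n_def by force
    have "(of_nat (scale ?L (demand I i) * (E - 2)) :: rat) \<le>
        of_nat ((\<Sum>j\<in>?J i. scaled_jobs I ! j) * (E + 1))"
      using J(2)[OF i] by (simp only: of_nat_le_iff)
    then have "(demand I i * of_nat (E - 2)) * of_nat ?L \<le>
        ((\<Sum>j\<in>?J i. capacity I j) * of_nat (E + 1)) * of_nat ?L"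
      unfolding of_nat_mult scaled_demand[OF assms(1) i] scaled_load[OF assms(1) sub]
      by (simp only: ac_simps)
    then show ?thesis
      using common_denominator(1)[OF assms(1)] unfolding load_def on
      by (simp add: mult_le_cancel_right)
  qed
qed

lemma distinct_concat_unique:
  assumes "distinct (concat (map snd cs))" "(r, l) \<in> set cs" "(r', l') \<in> set cs" "j \<in> set l" "j \<in> set l'"
  shows "r = r'"
  using assms by (induction cs) force+

lemma distinct_concat_mem:
  assumes "distinct (concat (map snd cs))" "(r, l) \<in> set cs"
  shows "distinct l"
  using assms by (induction cs) auto

lemma final_states_nonempty:
  assumes "valid_instance I" "feasible I \<sigma>" "2 \<le> E"
  shows "final_states E I \<noteq> []"
proof -
  let ?L = "common_denominator I" and ?cl = "job_classes E I" and ?n = "length (jobs I)"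
  define rep where "rep j = (SOME r. \<exists>l. (r, l) \<in> set ?cl \<and> j \<in> set l)" for j
  have rep: "\<exists>l. (rep j, l) \<in> set ?cl \<and> j \<in> set l" if "j < ?n" for j
  proof -
    have "j \<in> set (concat (map snd ?cl))"
      using that unfolding job_classes_set by simp
    then obtain r l where "(r, l) \<in> set ?cl" "j \<in> set l"
      by auto
    then have "\<exists>r l. (r, l) \<in> set ?cl \<and> j \<in> set l"
      by blast
    then show ?thesis
      unfolding rep_def by (rule someI_ex)
  qed
  have rep_eq: "rep j = r" if rl: "(r, l) \<in> set ?cl" "j \<in> set l" for r l j
  proof -
    obtain l' where "(rep j, l') \<in> set ?cl" "j \<in> set l'"
      using rep[OF job_classes_near(1)[OF rl]] by blast
    then show ?thesis
      using rl by (intro distinct_concat_unique[OF job_classes_distinct])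
  qed
  have dist: "distinct (map fst ?cl)"
    using classes_separated[of E "scaled_jobs I" 0] by (simp add: job_classes_def)
  have len: "length l = card {j. j < ?n \<and> rep j = r}" if "(r, l) \<in> set ?cl" for r l
  proof -
    have "{j. j < ?n \<and> rep j = r} = set l"
    proof (intro equalityI subsetI)
      fix j assume "j \<in> {j. j < ?n \<and> rep j = r}"
      then obtain l' where "(r, l') \<in> set ?cl" "j \<in> set l'"
        using rep by blast
      moreover have "l' = l"
        using dist that \<open>(r, l') \<in> set ?cl\<close> by (meson eq_key_imp_eq_value)
      ultimately show "j \<in> set l"
        by simp
    qed (use that rep_eq job_classes_near(1) in auto)
    moreover have "distinct l"
      by (rule distinct_concat_mem[OF job_classes_distinct that])
    ultimately show ?thesis
      by (simp add: distinct_card)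
  qed
  define x where "x i r = card {j \<in> jobs_on \<sigma> i. rep j = r}" for i r
  have card: "respects_cardinalities I \<sigma>" and loads: "\<And>i. i < length (machines I) \<Longrightarrow> demand I i \<le> load I \<sigma> i"
    using assms(2) by (auto simp: feasible_def)
  have on: "jobs_on \<sigma> i \<subseteq> {..<?n}" for i
    using card by (auto simp: jobs_on_def respects_cardinalities_def)
  have fin: "finite (jobs_on \<sigma> i)" for i
    using on finite_subset by blast
  have sum_x: "(\<Sum>r\<leftarrow>map fst ?cl. x i r * g r) = (\<Sum>j\<in>jobs_on \<sigma> i. g (rep j))" for g i
  proof -
    have "(\<Sum>r\<leftarrow>map fst ?cl. x i r * g r) = (\<Sum>r\<in>fst ` set ?cl. \<Sum>j\<in>{j \<in> jobs_on \<sigma> i. rep j = r}. g (rep j))"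
      unfolding sum_list_distinct_conv_sum_set[OF dist] set_map x_def by simp
    also have "\<dots> = (\<Sum>j\<in>jobs_on \<sigma> i. g (rep j))"
    proof (rule sum.group[OF fin])
      show "rep ` jobs_on \<sigma> i \<subseteq> fst ` set ?cl"
      proof
        fix r assume "r \<in> rep ` jobs_on \<sigma> i"
        then obtain j where "j < ?n" "r = rep j"
          using on by blast
        then show "r \<in> fst ` set ?cl"
          using rep[of j] by force
      qed
    qed simp
    finally show ?thesis .
  qed
  have sum_x1: "(\<Sum>r\<leftarrow>map fst ?cl. x i r) = card (jobs_on \<sigma> i)" for i
    using sum_x[of i "\<lambda>_. 1"] by simp
  have mach: "(\<Sum>r\<leftarrow>map fst ?cl. x i r) \<le> card_bound I i \<and> (\<Sum>r\<leftarrow>map fst ?cl. x i r) \<le> ?n \<and>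
      scale ?L (demand I i) * E \<le> (\<Sum>r\<leftarrow>map fst ?cl. x i r * r) * (E + 1)"
    if i: "i < length (machines I)" for i
  proof (intro conjI)
    show "(\<Sum>r\<leftarrow>map fst ?cl. x i r) \<le> card_bound I i"
      using card i unfolding sum_x1 by (simp add: respects_cardinalities_def)
    show "(\<Sum>r\<leftarrow>map fst ?cl. x i r) \<le> ?n"
      using card_mono[OF _ on[of i]] unfolding sum_x1 by simp
    have "demand I i * of_nat ?L \<le> load I \<sigma> i * of_nat ?L"
      using loads[OF i] by (intro mult_right_mono) auto
    then have "scale ?L (demand I i) \<le> (\<Sum>j\<in>jobs_on \<sigma> i. scaled_jobs I ! j)"
      unfolding load_def scaled_demand[OF assms(1) i, symmetric] scaled_load[OF assms(1) on, symmetric]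
      by (simp only: of_nat_le_iff)
    then have "scale ?L (demand I i) * E \<le> (\<Sum>j\<in>jobs_on \<sigma> i. scaled_jobs I ! j * E)"
      unfolding sum_distrib_right[symmetric] by (rule mult_le_mono1)
    also have "\<dots> \<le> (\<Sum>j\<in>jobs_on \<sigma> i. rep j * (E + 1))"
    proof (rule sum_mono)
      fix j assume "j \<in> jobs_on \<sigma> i"
      then have "j < ?n"
        using on by blast
      from rep[OF this] show "scaled_jobs I ! j * E \<le> rep j * (E + 1)"
        using job_classes_near(2) unfolding near_def by blast
    qed
    finally show "scale ?L (demand I i) * E \<le> (\<Sum>r\<leftarrow>map fst ?cl. x i r * r) * (E + 1)"
      unfolding sum_x sum_distrib_right .
  qed
  have total: "(\<Sum>(D, f, i)\<leftarrow>sorted_machines I. x i r) \<le> card {j. j < ?n \<and> rep j = r}" for r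
  proof -
    have "(\<Sum>i<length (machines I). x i r) = card (\<Union>i<length (machines I). {j \<in> jobs_on \<sigma> i. rep j = r})"
      unfolding x_def by (intro card_UN_disjoint[symmetric]) (auto simp: fin, auto simp: jobs_on_def)
    also have "\<dots> \<le> card {j. j < ?n \<and> rep j = r}"
      using on by (intro card_mono) auto
    finally show ?thesis
      unfolding sum_sorted_machines .
  qed
  have "\<exists>p \<in> set (final_states E I). map fst (snd p) = map fst ?cl \<and>
    (\<forall>D. (\<forall>M \<in> set (sorted_machines I). D \<le> fst M) \<longrightarrow>
      dominates D (snd p) (\<lambda>r. card {j. j < ?n \<and> rep j = r} - (\<Sum>(D, f, i)\<leftarrow>sorted_machines I. x i r)))"
    unfolding final_states_def
    by (rule dp_complete[OF sorted_sorted_machines assms(3)]) (use mach len total in \<open>auto simp: set_sorted_machines\<close>)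
  then show ?thesis
    by auto
qed

lemma shrunk_bounded:
  assumes "shrunk D q cs' cs" "bounded V Z q' E cs"
  shows "bounded V Z q' E cs'"
proof -
  have "total_size cs' \<le> total_size cs \<and> job_count cs' \<le> job_count cs"
    using assms(1)[unfolded shrunk_def]
    by (induction rule: list_all2_induct) (auto simp: total_size_def job_count_def add_mono)
  moreover from this have "total_size cs' * E \<le> total_size cs * E"
    by simp
  moreover have "length cs' = length cs"
    using assms(1) by (simp add: shrunk_def list_all2_lengthD)
  moreover have "\<forall>(r, l) \<in> set cs'. r \<le> V \<and> r * q' \<le> V \<and> length l \<le> Z"
  proof clarify
    fix r l assume "(r, l) \<in> set cs'"
    then obtain l0 where "(r, l0) \<in> set cs" "length l \<le> length l0"
      using shrunk_mem[OF assms(1)] by blast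
    then show "r \<le> V \<and> r * q' \<le> V \<and> length l \<le> Z"
      using assms(2) unfolding bounded_def by force
  qed
  moreover have "length cs \<le> Z" "total_size cs \<le> V" "total_size cs * E \<le> V" "job_count cs \<le> V"
    using assms(2) by (simp_all add: bounded_def)
  ultimately show ?thesis
    unfolding bounded_def by (intro conjI; (linarith | blast))
qed

lemma total_size_le:
  "\<forall>(r, l) \<in> set cs. r \<le> B \<Longrightarrow> total_size cs \<le> job_count cs * B"
  by (induction cs) (auto simp: total_size_def job_count_def add_mult_distrib intro: add_mono)

lemma length_expand_le: "length (expand E q (D, f, i) p) \<le> length (choices D q i (fst p) (snd p))"
  by (cases p) simp

lemma window_count_le_bound:
  assumes "distinct (map fst cs)" "\<forall>r \<in> fst ` set cs. 0 < r" "0 < E" "n \<le> N"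
    and "\<forall>r \<in> fst ` set cs. \<forall>r' \<in> fst ` set cs. r \<noteq> r' \<longrightarrow> \<not> near E r r'"
  shows "window_count D ((n + 1) * E) cs \<le> window_bound E N"
proof -
  let ?b = "1 + 1 / real E"
  have b: "1 < ?b"
    using assms(3) by simp
  have "0 < (n + 1) * E"
    using assms(3) by simp
  moreover have "(n + 1) * E \<le> (N + 1) * E"
    using assms(4) by simp
  ultimately have "log ?b (real ((n + 1) * E)) \<le> log ?b (real ((N + 1) * E))"
    using b by (intro log_mono) (simp_all only: of_nat_0_less_iff of_nat_le_iff)
  moreover have "real (window_count D ((n + 1) * E) cs) \<le> log ?b (real ((n + 1) * E)) + 2"
    using assms by (intro window_count_le) simp_all
  ultimately have "real (window_count D ((n + 1) * E) cs) \<le> log ?b (real ((N + 1) * E)) + 2"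
    by linarith
  then show ?thesis
    unfolding window_bound_def by linarith
qed

lemma instance_size_eq:
  "instance_size I = 3 +
    (\<Sum>M\<leftarrow>machines I. 3 + bits (num (fst M)) + bits (den (fst M)) + bits (snd M)) +
    (\<Sum>x\<leftarrow>jobs I. 2 + bits (num x) + bits (den x))"
proof -
  have "Suc (val_size ((\<lambda>(D, f). Pair (enc_rat D) (Nat f)) M)) =
      3 + bits (num (fst M)) + bits (den (fst M)) + bits (snd M)" for M
    by (cases M) (simp add: enc_rat_eq)
  moreover have "Suc (val_size (enc_rat x)) = 2 + bits (num x) + bits (den x)" for x
    by (simp add: enc_rat_eq)
  ultimately show ?thesis
    unfolding instance_size_def enc_instance_def by (simp add: val_size_enc_list eval_nat_numeral)
qed

lemma le_power_mono: "bits x \<le> N \<Longrightarrow> x \<le> 2 ^ N"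
  using le_power_bits[of x] power_increasing[of "bits x" N "2 :: nat"] by linarith

lemma instance_bounds:
  defines "B \<equiv> \<lambda>I. 2 ^ instance_size I"
  shows "length (jobs I) < instance_size I" "length (machines I) < instance_size I"
    and "x \<in> set (jobs I) \<Longrightarrow> num x \<le> B I \<and> den x \<le> B I"
    and "M \<in> set (machines I) \<Longrightarrow> num (fst M) \<le> B I \<and> den (fst M) \<le> B I \<and> snd M \<le> B I"
    and "common_denominator I \<le> B I"
    and "foldr (\<lambda>x a. den x * a) (jobs I) 1 \<le> B I"
proof -
  let ?N = "instance_size I"
  let ?gm = "\<lambda>M :: rat \<times> nat. 3 + bits (num (fst M)) + bits (den (fst M)) + bits (snd M)"
  let ?gj = "\<lambda>x. 2 + bits (num x) + bits (den x)"
  let ?m = "\<Sum>M\<leftarrow>machines I. ?gm M" and ?j = "\<Sum>x\<leftarrow>jobs I. ?gj x"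
  have N: "?N = 3 + ?m + ?j"
    by (rule instance_size_eq)
  have "(\<Sum>x\<leftarrow>jobs I. 1) \<le> ?j" "(\<Sum>M\<leftarrow>machines I. 1) \<le> ?m"
    by (rule sum_list_mono; simp)+
  then show "length (jobs I) < ?N" "length (machines I) < ?N"
    unfolding N by (simp_all add: sum_list_triv)
  show "num x \<le> B I \<and> den x \<le> B I" if "x \<in> set (jobs I)"
  proof -
    have "?gj x \<le> ?j"
      using that by (intro member_le_sum_list) auto
    then show ?thesis
      unfolding B_def using N by (intro conjI le_power_mono) linarith+
  qed
  show "num (fst M) \<le> B I \<and> den (fst M) \<le> B I \<and> snd M \<le> B I" if "M \<in> set (machines I)"
  proof -
    have "?gm M \<le> ?m"
      using that by (intro member_le_sum_list) auto
    then show ?thesis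
      unfolding B_def using N by (intro conjI le_power_mono) linarith+
  qed
  have dj: "(\<Sum>x\<leftarrow>jobs I. bits (den x)) \<le> ?j" and dm: "(\<Sum>M\<leftarrow>machines I. bits (den (fst M))) \<le> ?m"
    by (rule sum_list_mono; simp)+
  have "foldr (\<lambda>x a. den x * a) (jobs I) 1 \<le> 2 ^ (\<Sum>x\<leftarrow>jobs I. bits (den x)) * 1"
    by (rule foldr_mult_le)
  also have "\<dots> \<le> 2 ^ ?j"
    unfolding mult_1_right by (intro power_increasing dj) simp
  finally have J: "foldr (\<lambda>x a. den x * a) (jobs I) 1 \<le> 2 ^ ?j" .
  note J
  also have "\<dots> \<le> B I"
    unfolding B_def N by (intro power_increasing) auto
  finally show "foldr (\<lambda>x a. den x * a) (jobs I) 1 \<le> B I" .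
  have "common_denominator I \<le> 2 ^ (\<Sum>M\<leftarrow>machines I. bits (den (fst M))) * foldr (\<lambda>x a. den x * a) (jobs I) 1"
    unfolding common_denominator_def by (rule foldr_mult_le)
  also have "\<dots> \<le> 2 ^ ?m * 2 ^ ?j"
    by (intro mult_le_mono J power_increasing dm) simp
  also have "\<dots> \<le> B I"
    unfolding B_def N power_add[symmetric] by (intro power_increasing) auto
  finally show "common_denominator I \<le> B I" .
qed

definition dp_cost :: "nat \<Rightarrow> nat \<Rightarrow> nat" where
  "dp_cost E N =
     (let W = (N + 1) ^ window_bound E N; C = Suc N * W; Q = (N + 1) * W
      in Suc N * (expand_cost N C Q + dedup_cost N (Q * C) + 40))"

definition time_bound :: "nat \<Rightarrow> nat \<Rightarrow> nat" where
  "time_bound E N =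
     (Suc N * 20 + Suc N * 20 + Suc N * (Suc N * 40 + 70) + Suc N * 20 + Suc N * (Suc N * 150 + 70) +
      dp_cost E N + Suc N * (Suc N * 40 + 60) + 100) * (2 * (3 * N + E + 2) + 1)"

lemma quasi_polynomial_time_bound:
  assumes "0 < E"
  shows "quasi_polynomial (time_bound E)"
  unfolding time_bound_def dp_cost_def expand_cost_def dedup_cost_def Let_def
  by (intro quasi_polynomial_mult quasi_polynomial_add quasi_polynomial_Suc quasi_polynomial_const
      quasi_polynomial_id quasi_polynomial_window assms)

lemma job_classes_bounded:
  assumes "valid_instance I"
  defines "N \<equiv> instance_size I"
  defines "n \<equiv> length (jobs I)"
  assumes V: "V = (2 ^ N) ^ 3 * (E + 1)"
  shows "bounded V N ((n + 1) * E) E (job_classes E I)"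
    "\<forall>(r, l) \<in> set (job_classes E I). length l \<le> n"
    "\<forall>r \<in> fst ` set (job_classes E I). 0 < r"
    "x \<in> set (jobs I) \<Longrightarrow> scale (common_denominator I) x * (E + 1) \<le> V"
    "M \<in> set (machines I) \<Longrightarrow> scale (common_denominator I) (fst M) * (E + 1) \<le> V"
    "n + 1 \<le> 2 ^ N" "2 ^ N * (E + 1) \<le> V"
proof -
  let ?B = "2 ^ N :: nat" and ?L = "common_denominator I" and ?J = "job_classes E I"
  have B: "1 \<le> ?B"
    by simp
  have V3: "V = ?B * ?B * ?B * (E + 1)"
    unfolding V by (simp add: power3_eq_cube)
  have VI: "a * (b * (E + 1)) \<le> V" if "a \<le> ?B * ?B" "b \<le> ?B" for a b
  proof -
    have "a * b * (E + 1) \<le> ?B * ?B * ?B * (E + 1)"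
      by (intro mult_le_mono that order_refl)
    then show ?thesis
      unfolding V3 by (simp only: mult.assoc)
  qed
  have n: "n < N" and L: "?L \<le> ?B"
    using instance_bounds(1,5)[of I] by (simp_all add: n_def N_def)
  then show n1: "n + 1 \<le> ?B"
    using less_exp[of N] by linarith
  have sc: "scale ?L x \<le> ?B * ?B" if "num x \<le> ?B" for x
    unfolding scale_def using that L by (intro mult_le_mono) (auto intro: le_trans[OF div_le_dividend])
  have scj: "scale ?L x \<le> ?B * ?B" if "x \<in> set (jobs I)" for x
    using sc instance_bounds(3)[OF that] by (simp add: N_def)
  show "scale ?L x * (E + 1) \<le> V" if "x \<in> set (jobs I)"
    using VI[OF scj[OF that] B] by simp
  have "num (fst M) \<le> ?B" if "M \<in> set (machines I)"
    using instance_bounds(4)[OF that] by (simp add: N_def)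
  then show "scale ?L (fst M) * (E + 1) \<le> V" if "M \<in> set (machines I)"
    using VI[OF sc B] that by simp
  show "?B * (E + 1) \<le> V"
    using VI[of 1 ?B] by simp
  have fstJ: "\<exists>x \<in> set (jobs I). r = scale ?L x" if "r \<in> fst ` set ?J" for r
    using set_classes[of E "scaled_jobs I" 0] that unfolding job_classes_def scaled_jobs_def by auto
  have r: "r \<le> ?B * ?B" if "r \<in> fst ` set ?J" for r
    using fstJ[OF that] scj by auto
  show "\<forall>r \<in> fst ` set ?J. 0 < r"
  proof
    fix r assume "r \<in> fst ` set ?J"
    then obtain j where j: "j < length (jobs I)" "r = scale ?L (capacity I j)"
      using fstJ by (metis in_set_conv_nth)
    have c: "0 < capacity I j"
      using assms(1) j(1) by (simp add: valid_instance_def)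
    then have "(0 :: rat) < of_nat r"
      unfolding j(2) of_nat_scale[OF c common_denominator(3)[OF assms(1) j(1)]]
      using common_denominator(1)[OF assms(1)] by simp
    then show "0 < r"
      by simp
  qed
  have l: "length l \<le> n" if "(r, l) \<in> set ?J" for r l
  proof -
    have "length l \<le> job_count ?J"
      unfolding job_count_def using that by (intro member_le_sum_list) (force, simp)
    then show ?thesis
      by (simp add: job_classes_count n_def)
  qed
  then show "\<forall>(r, l) \<in> set ?J. length l \<le> n"
    by blast
  have rq: "r \<le> V \<and> r * ((n + 1) * E) \<le> V" if "r \<in> fst ` set ?J" for r
  proof
    show "r \<le> V"
      using VI[OF r[OF that] B] by simp
    have "r * ((n + 1) * E) \<le> r * ((n + 1) * (E + 1))"
      by (intro mult_le_mono2) simp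
    also have "\<dots> \<le> V"
      by (rule VI[OF r[OF that] n1])
    finally show "r * ((n + 1) * E) \<le> V" .
  qed
  have "total_size ?J \<le> n * (?B * ?B)"
    using total_size_le[of ?J "?B * ?B"] r by (force simp: job_classes_count n_def)
  then have "total_size ?J * (E + 1) \<le> n * (?B * ?B) * (E + 1)"
    by (rule mult_le_mono1)
  also have "\<dots> = ?B * ?B * (n * (E + 1))"
    by (simp only: ac_simps)
  also have "\<dots> \<le> V"
    using n1 by (intro VI) simp_all
  finally have "total_size ?J \<le> V \<and> total_size ?J * E \<le> V"
    by simp
  moreover have "job_count ?J \<le> V"
    using VI[of 1 n] n1 by (simp add: job_classes_count n_def)
  moreover have "length ?J \<le> N"
    using length_classes[of E "scaled_jobs I" 0] n by (simp add: job_classes_def scaled_jobs_def n_def)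
  ultimately show "bounded V N ((n + 1) * E) E ?J"
    unfolding bounded_def using rq l n by fastforce
qed

lemma bits_bound: "bits ((2 ^ N) ^ 3 * (E + 1)) \<le> 3 * N + E + 2"
proof -
  have "(2 ^ N) ^ 3 = (2 :: nat) ^ (3 * N)"
    by (simp add: power_mult[symmetric] mult.commute)
  then have "(2 ^ N) ^ 3 * (E + 1) < (2 :: nat) ^ (3 * N) * 2 ^ (E + 1)"
    using less_exp[of "E + 1"] by (simp only: mult_less_cancel1) simp
  then have "(2 ^ N) ^ 3 * (E + 1) < (2 :: nat) ^ (3 * N + (E + 1))"
    unfolding power_add[of 2 "3 * N"] .
  then have "floorlog 2 ((2 ^ N) ^ 3 * (E + 1)) \<le> 3 * N + (E + 1)"
    by (intro floorlog_leI) simp_all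
  then show ?thesis
    by (simp add: bits_def)
qed

lemma fn_final_states:
  assumes I: "valid_instance I" and E: "1 \<le> E"
  defines "N \<equiv> instance_size I" and "q \<equiv> (length (jobs I) + 1) * E"
  defines "V \<equiv> (2 ^ N) ^ 3 * (E + 1)"
  shows "fn (qprog E) V 18 (enc_list enc_machine (sorted_machines I))
    (Pair (Nat q) (enc_list enc_cls (job_classes E I))) (enc_list enc_partial (final_states E I))
    (dp_cost E N)"
proof -
  let ?n = "length (jobs I)" and ?cl = "job_classes E I" and ?ms = "sorted_machines I"
  let ?L = "common_denominator I"
  define W where "W = window_bound E N"
  define C where "C = Suc N * (N + 1) ^ W"
  define Q where "Q = (N + 1) ^ (W + 1)"
  define J where "J ms \<longleftrightarrow> sorted (map fst ms) \<and> set ms \<subseteq> set ?ms" for ms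
  note bd = job_classes_bounded[OF I, of V E, folded N_def q_def, OF V_def[THEN meta_eq_to_obj_eq]]
  have n: "?n \<le> N" and m: "length (machines I) \<le> N"
    using instance_bounds(1,2)[of I] by (simp_all add: N_def)
  have lenN: "\<forall>(r, l) \<in> set ?cl. length l \<le> N"
    using bd(2) n by fastforce
  have window: "window_count D q ?cl \<le> W" for D
    unfolding q_def W_def using classes_separated[of E "scaled_jobs I" 0] bd(3) E n
    by (intro window_count_le_bound) (auto simp: job_classes_def)
  have choices: "length (choices D q i a cs) \<le> C" if "shrunk 0 q cs ?cl" for D i a cs
  proof -
    have b: "bounded V N q E cs"
      using shrunk_bounded[OF that bd(1)] .
    then have "length (choices D q i a cs) \<le> Suc (length cs) * (N + 1) ^ window_count D q cs"
      by (intro length_choices) (auto simp: bounded_def)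
    also have "window_count D q cs = window_count D q ?cl"
      unfolding window_count_def shrunk_map_fst[OF that] ..
    also have "Suc (length cs) * (N + 1) ^ window_count D q ?cl \<le> C"
      unfolding C_def using b window[of D] by (intro mult_le_mono power_increasing) (auto simp: bounded_def)
    finally show ?thesis .
  qed
  have dp: "shrunk 0 q (snd p) ?cl" if "p \<in> set (dp E q ?cl ms)" for p ms
    using dp_shrunk[OF that] by simp
  have len: "length (dp E q ?cl ms) \<le> Q" if "J ms" for ms
    unfolding Q_def using that lenN window job_classes_count[of E I] n
    by (intro length_dp) (auto simp: J_def)
  have ex: "length (expand E q M p) \<le> C" if "p \<in> set (dp E q ?cl ms)" for M p ms
  proof -
    obtain D f i where "M = (D, f, i)"
      by (cases M)
    then show ?thesis
      using length_expand_le[of E q D f i p] choices[OF dp[OF that], of D i "fst p"] by simp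
  qed
  have ms: "length ?ms \<le> N"
    using m by (simp add: sorted_machines_def)
  have E_le: "(E + 1) \<le> V" "E \<le> V" "1 \<le> V" "2 ^ N \<le> V"
  proof -
    have "1 * (E + 1) \<le> 2 ^ N * (E + 1)"
      by (intro mult_le_mono1) simp
    from le_trans[OF this bd(7)] show "E + 1 \<le> V"
      unfolding mult_1 .
    then show "E \<le> V" "1 \<le> V"
      by simp_all
    show "2 ^ N \<le> V"
      using bd(7) by simp
  qed
  have "fn (qprog E) V 18 (enc_list enc_machine ?ms) (Pair (Nat q) (enc_list enc_cls ?cl))
    (enc_list enc_partial (dp E q ?cl ?ms))
    (Suc N * (expand_cost N C Q + dedup_cost N (Q * C) + 40))"
  proof (rule fn_dp[where I = J and k = "length ?cl"])
    show "J ?ms"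
      by (simp add: J_def sorted_sorted_machines)
    show "J ms" if "J (M # ms)" for M ms
      using that by (simp add: J_def)
    show "bounded V N q E (snd p) \<and> length (choices D q i (fst p) (snd p)) \<le> C"
      if "J ((D, f, i) # ms)" "p \<in> set (dp E q ?cl ms)" for D f i ms p
      using shrunk_bounded[OF dp[OF that(2)] bd(1)] choices[OF dp[OF that(2)]] by simp
    show "length (dp E q ?cl ms) \<le> Q" if "J ((D, f, i) # ms)" for D f i ms
      using that by (intro len) (simp add: J_def)
    show "bounded V N q E (snd p) \<and> length (snd p) = length ?cl"
      if J: "J (M # ms)" and p: "p \<in> set (concat (map (expand E q M) (dp E q ?cl ms)))" for M ms p
    proof -
      obtain p0 where p0: "p0 \<in> set (dp E q ?cl ms)" "p \<in> set (expand E q M p0)"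
        using p by auto
      have "shrunk 0 q (snd p) (snd p0)"
        using shrunk_mono[OF expand_shrunk[OF p0(2)]] by simp
      then have "shrunk 0 q (snd p) ?cl"
        using dp[OF p0(1)] by (rule shrunk_trans)
      then show ?thesis
        using shrunk_bounded[OF _ bd(1)] by (metis shrunk_map_fst length_map)
    qed
    show "length (concat (map (expand E q M) (dp E q ?cl ms))) \<le> Q * C" if "J (M # ms)" for M ms
    proof -
      have "length (concat (map (expand E q M) (dp E q ?cl ms))) \<le> length (dp E q ?cl ms) * C"
        using ex by (intro length_concat_le)
      also have "\<dots> \<le> Q * C"
        using that by (intro mult_le_mono1 len) (simp add: J_def)
      finally show ?thesis .
    qed
    show "D \<le> V \<and> D * (E - 2) \<le> V \<and> f \<le> V" if "J ((D, f, i) # ms)" for D f i ms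
    proof -
      have "(D, f, i) \<in> set ?ms"
        using that by (simp add: J_def)
      then have i: "i < length (machines I)" "D = scale ?L (demand I i)" "f = card_bound I i"
        unfolding set_sorted_machines by auto
      have "D * (E + 1) \<le> V"
        unfolding i(2) by (rule bd(5)) (simp add: i(1))
      moreover have "D * (E - 2) \<le> D * (E + 1)"
        by (intro mult_le_mono2) simp
      moreover have "f \<le> 2 ^ N"
        using instance_bounds(4)[of "machines I ! i" I] i(1) unfolding i(3) N_def by simp
      ultimately show ?thesis
        using E_le(4) by simp
    qed
    show "q \<le> V"
    proof -
      have "q \<le> 2 ^ N * (E + 1)"
        unfolding q_def using bd(6) by (intro mult_le_mono) simp_all
      then show ?thesis
        using bd(7) by linarith
    qed
  qed (use E_le ms in auto)
  moreover have "Suc N * (expand_cost N C Q + dedup_cost N (Q * C) + 40) = dp_cost E N"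
    unfolding dp_cost_def Let_def C_def Q_def W_def by simp
  ultimately show ?thesis
    unfolding final_states_def q_def by simp
qed

lemma qprog_runs:
  assumes I: "valid_instance I" and E: "1 \<le> E"
  shows "\<exists>y t. runs (qprog E) (enc_instance I) y t \<and> t \<le> time_bound E (instance_size I) \<and>
    (\<forall>a cs S. final_states E I = (a, cs) # S \<longrightarrow>
      y = enc_assignment (map (map_of a) [0..<length (jobs I)]))"
proof -
  define N where "N = instance_size I"
  define V where "V = (2 ^ N) ^ 3 * (E + 1)"
  let ?n = "length (jobs I)" and ?L = "common_denominator I" and ?S = "final_states E I"
  let ?js = "enc_list enc_rat (jobs I)"
  let ?mv = "enc_list (\<lambda>(D, f). Pair (enc_rat D) (Nat f)) (machines I)"
  let ?L' = "foldr (\<lambda>x a. den x * a) (jobs I) 1"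
  define y where "y = (case ?S of [] \<Rightarrow> Nat 0 | p # _ \<Rightarrow> enc_assignment (map (map_of (fst p)) [0..<?n]))"
  note bd = job_classes_bounded[OF I, of V E, folded N_def, OF V_def]
  have le: "x \<le> V" if "x \<le> 2 ^ N" for x
    using that bd(7) by simp
  have V1: "E + 1 \<le> V" "E \<le> V" "1 \<le> V"
  proof -
    have "1 * (E + 1) \<le> 2 ^ N * (E + 1)"
      by (intro mult_le_mono1) simp
    from le_trans[OF this bd(7)] show "E + 1 \<le> V"
      unfolding mult_1 .
    then show "E \<le> V" "1 \<le> V"
      by simp_all
  qed
  have n: "?n \<le> N" "?n + 1 \<le> V" and m: "length (machines I) \<le> N" "length (machines I) \<le> V"
  proof -
    show "?n \<le> N" "length (machines I) \<le> N"
      using instance_bounds(1,2)[of I] by (simp_all add: N_def)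
    then show "length (machines I) \<le> V"
      using less_exp[of N] by (intro le) linarith
    show "?n + 1 \<le> V"
      using bd(6) by (rule le)
  qed
  have dj: "\<forall>x \<in> set (jobs I). 0 < den x"
    using I num_den(2) unfolding valid_instance_def by (metis in_set_conv_nth)
  have dm: "\<forall>M \<in> set (machines I). 0 < den (fst M)"
    using I num_den(2) unfolding valid_instance_def by (metis in_set_conv_nth)
  have bj: "num x \<le> V" "den x \<le> V" if "x \<in> set (jobs I)" for x
    using instance_bounds(3)[OF that] by (simp_all add: le N_def)
  have bm: "num (fst M) \<le> V" "den (fst M) \<le> V" "scale ?L (fst M) \<le> V" if "M \<in> set (machines I)" for M
    using instance_bounds(4)[OF that] bd(5)[OF that] by (simp_all add: le N_def)
  have L: "?L \<le> V" "?L' \<le> V"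
    using instance_bounds(5,6)[of I] by (simp_all only: le N_def)
  have f2: "fn (qprog E) V 2 ?js (Nat 1) (Nat ?L') (Suc N * 20)"
    using dj bj(2) L(2) n(1) by (intro fn_mono[OF fn_denominators_jobs]) simp_all
  have f1: "fn (qprog E) V 1 ?mv (Nat ?L') (Nat ?L) (Suc N * 20)"
    using dm bm(2) L(1) m(1) unfolding common_denominator_def
    by (intro fn_mono[OF fn_denominators_machines]) simp_all
  have f5: "fn (qprog E) V 5 ?mv (Pair (Nat ?L) (Nat 0)) (enc_list enc_machine (sorted_machines I))
    (Suc N * (Suc N * 40 + 70))"
    unfolding sorted_machines_def using bm L(1) V1 m by (intro fn_tagged) simp_all
  have f3: "fn (qprog E) V 3 ?js (Nat 0) (Nat ?n) (Suc N * 20)"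
    using n V1 by (intro fn_mono[OF fn_length]) simp_all
  have f7: "fn (qprog E) V 7 ?js (Pair (Nat ?L) (Nat 0)) (enc_list enc_cls (job_classes E I))
    (Suc N * (Suc N * 150 + 70))"
    unfolding job_classes_def scaled_jobs_def using bj bd(4) L(1) V1 n
    by (intro fn_classes) simp_all
  have f18: "fn (qprog E) V 18 (enc_list enc_machine (sorted_machines I))
    (Pair (Nat ((?n + 1) * E)) (enc_list enc_cls (job_classes E I))) (enc_list enc_partial ?S) (dp_cost E N)"
    using fn_final_states[OF I E] by (simp only: V_def N_def)
  have f20: "fn (qprog E) V 20 ?js (Pair (enc_list enc_pair a) (Nat 0)) y (Suc N * (Suc N * 40 + 60))"
    if S: "?S = (a, cs) # S'" for a cs S'
  proof -
    have "(a, cs) \<in> set ?S"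
      using S by simp
    note a = final_states_sound(2-4)[OF I this]
    have "\<forall>(j, i) \<in> set a. j \<le> V \<and> i \<le> V"
      using a(1,2) n(2) m(2) by fastforce
    then have "fn (qprog E) V 20 ?js (Pair (enc_list enc_pair a) (Nat 0))
        (enc_assignment (map (map_of a) [0..<0 + ?n])) (Suc N * (Suc N * 40 + 60))"
      using a(3) n V1 by (intro fn_assignment) simp_all
    then show ?thesis
      by (simp add: y_def S)
  qed
  have "\<exists>t \<le> (Suc N * 20 + Suc N * 20 + Suc N * (Suc N * 40 + 70) + Suc N * 20 + Suc N * (Suc N * 150 + 70) +
      dp_cost E N + Suc N * (Suc N * 40 + 60) + 100) * (2 * bits V + 1).
    runs (qprog E) (Pair ?mv ?js) y t"
    by (rule runs_main[OF f2 f1 f5 f3 f7 f18 f20]) (use n(2) V1 in \<open>simp_all add: y_def\<close>)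
  then obtain t where t: "runs (qprog E) (enc_instance I) y t"
    "t \<le> (Suc N * 20 + Suc N * 20 + Suc N * (Suc N * 40 + 70) + Suc N * 20 + Suc N * (Suc N * 150 + 70) +
      dp_cost E N + Suc N * (Suc N * 40 + 60) + 100) * (2 * bits V + 1)"
    unfolding enc_instance_def by blast
  note t(2)
  also have "\<dots> \<le> time_bound E N"
    unfolding time_bound_def using bits_bound[of N E] unfolding V_def
    by (intro mult_le_mono2) simp
  finally have "t \<le> time_bound E (instance_size I)"
    unfolding N_def .
  then show ?thesis
    using t(1) by (intro exI[of _ y] exI[of _ t]) (simp add: y_def)
qed

theorem theorem2:
  fixes \<epsilon> :: real
  assumes "\<epsilon> > 0"
  shows "\<exists>(P :: prog) (T :: nat \<Rightarrow> nat).
    quasi_polynomial T \<and>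
    (\<forall>I. valid_instance I \<longrightarrow>
      (\<exists>y t. runs P (enc_instance I) y t \<and> t \<le> T (instance_size I) \<and>
        ((\<exists>\<sigma>. feasible I \<sigma>) \<longrightarrow>
          (\<exists>\<sigma>. y = enc_assignment \<sigma> \<and> approx_solution (1 + \<epsilon>) I \<sigma>))))"
proof -
  define E where "E = nat \<lceil>2 + 3 / \<epsilon>\<rceil>"
  have "0 < 3 / \<epsilon>"
    using assms by simp
  then have E: "2 \<le> E" and "2 + 3 / \<epsilon> \<le> real E"
    unfolding E_def by linarith+
  then have "3 / \<epsilon> * \<epsilon> \<le> (real E - 2) * \<epsilon>"
    using assms by (intro mult_right_mono) simp_all
  then have E_eps: "real (E + 1) \<le> real (E - 2) * (1 + \<epsilon>)"
    using assms E by (simp add: algebra_simps of_nat_diff)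
  have approx: "approx_solution (1 + \<epsilon>) I (map (map_of a) [0..<length (jobs I)])"
    if I: "valid_instance I" "(a, cs) \<in> set (final_states E I)" for I a cs
    unfolding approx_solution_def
  proof (intro conjI allI impI)
    let ?\<sigma> = "map (map_of a) [0..<length (jobs I)]"
    show "respects_cardinalities I ?\<sigma>"
      by (rule final_states_sound(5)[OF I])
    fix i assume i: "i < length (machines I)"
    have "(of_rat (demand I i * of_nat (E - 2)) :: real) \<le> of_rat (load I ?\<sigma> i * of_nat (E + 1))"
      unfolding of_rat_less_eq by (rule final_states_sound(6)[OF I i])
    then have "of_rat (demand I i) * real (E - 2) \<le> of_rat (load I ?\<sigma> i) * real (E + 1)"
      by (simp only: of_rat_mult of_rat_of_nat_eq)
    also have "\<dots> \<le> of_rat (load I ?\<sigma> i) * (real (E - 2) * (1 + \<epsilon>))"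
    proof (intro mult_left_mono E_eps)
      have "0 \<le> load I ?\<sigma> i"
        unfolding load_def using I(1)
        by (intro sum_nonneg) (auto simp: jobs_on_def valid_instance_def less_imp_le)
      then show "0 \<le> (of_rat (load I ?\<sigma> i) :: real)"
        by simp
    qed
    finally have "real (E - 2) * of_rat (demand I i) \<le> real (E - 2) * (of_rat (load I ?\<sigma> i) * (1 + \<epsilon>))"
      by (simp only: ac_simps)
    moreover have "0 < real (E - 2)"
      using E_eps by (cases "E - 2 = 0") simp_all
    ultimately have "of_rat (demand I i) \<le> of_rat (load I ?\<sigma> i) * (1 + \<epsilon>)"
      by (simp only: mult_le_cancel_left_pos)
    then show "of_rat (demand I i) / (1 + \<epsilon>) \<le> of_rat (load I ?\<sigma> i)"
      using assms by (simp add: pos_divide_le_eq)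
  qed
  show ?thesis
  proof (intro exI[of _ "qprog E"] exI[of _ "time_bound E"] conjI allI impI)
    show "quasi_polynomial (time_bound E)"
      using E by (intro quasi_polynomial_time_bound) simp
    fix I assume I: "valid_instance I"
    obtain y t where yt: "runs (qprog E) (enc_instance I) y t" "t \<le> time_bound E (instance_size I)"
      "\<And>a cs S. final_states E I = (a, cs) # S \<Longrightarrow>
        y = enc_assignment (map (map_of a) [0..<length (jobs I)])"
      using qprog_runs[OF I, of E] E by auto
    have "\<exists>\<sigma>. y = enc_assignment \<sigma> \<and> approx_solution (1 + \<epsilon>) I \<sigma>" if feasible: "feasible I \<sigma>0" for \<sigma>0
    proof -
      obtain a cs S where S: "final_states E I = (a, cs) # S"
        using final_states_nonempty[OF I feasible E] by (metis list.exhaust surj_pair)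
      then have "(a, cs) \<in> set (final_states E I)"
        by simp
      from approx[OF I this] yt(3)[OF S] show ?thesis
        by blast
    qed
    with yt(1,2) show "\<exists>y t. runs (qprog E) (enc_instance I) y t \<and> t \<le> time_bound E (instance_size I) \<and>
        ((\<exists>\<sigma>. feasible I \<sigma>) \<longrightarrow> (\<exists>\<sigma>. y = enc_assignment \<sigma> \<and> approx_solution (1 + \<epsilon>) I \<sigma>))"
      by blast
  qed
qed

end
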